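(* Let $M\in\{1,2\}$, and let $F:\mathbb{R}^2\to\mathbb{R}^2$, $G:\mathbb{R}^2\to\mathbb{M}_{2\times M}$ (with columns $G_i$) be of class $\mathcal{C}^{1,1}$ with Lipschitz constant $L$, with $F(0)=0$, $\mathrm{Rank}\,[G_i(0),DF(0)G_i(0)]=2$ for $i=1,\dots,M$, and $DG(0)=0$. Consider the control system $\dot x=F(x)+G(x)u$, $u\in[-1,1]^M$, let $\mathcal{R}^\tau$ be its reachable set from the origin at time $\tau$, and let $T$ be the minimum time function to reach the origin. Then there exist $\mathcal{T}>0$ and $\gamma>0$, depending only on $L,DF(0),G(0)$, such that for every $0<\tau<\mathcal{T}$, $x_1\in\mathrm{bdry}\,\mathcal{R}^\tau$, $x_2\in\mathcal{R}^\tau$, $\zeta\in N^P_{\mathcal{R}^\tau}(x_1)$, $$\langle\zeta,x_2-x_1\rangle\le-\gamma\|\zeta\|\,\|x_2-x_1\|^2,$$ and such that every $\bar x\in\mathbb{R}^2\setminus\{0\}$ with $T(\bar x)<\mathcal{T}$ is an optimal point.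
   Context: A function is of class $\mathcal{C}^{1,1}$ if its partial derivatives exist and are Lipschitz. Admissible controls are measurable functions with values a.e. in $[-1,1]^M$; $y^{x,u}$ is the solution of $\dot y=F(y)+G(y)u$, $y(0)=x$. $\mathcal{R}^\tau=\{y^{0,u}(\tau):u\text{ admissible}\}$. The minimum time function is $T(x)=\inf_u\min\{t\ge0:y^{x,u}(t)=0\}\in[0,+\infty]$, the infimum being over admissible controls. For closed $K$ and $x\in K$, the proximal normal cone $N^P_K(x)$ is the set of $v$ such that for some $\sigma\ge0$, $\langle v,y-x\rangle\le\sigma\|y-x\|^2$ for all $y\in K$. A point $x\ne0$ is optimal if there exist a point $x_1$ with $T(x_1)>T(x)$ and an admissible control $u$ such that $y^{x_1,u}$ steers $x_1$ to $0$ in the optimal time $T(x_1)$ and $x=y^{x_1,u}(T(x_1)-T(x))$. *)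

theory Defs
  imports "HOL-Analysis.Analysis"
begin

definition partial_deriv ::
    "(real ^ 'n \<Rightarrow> 'b::real_normed_vector) \<Rightarrow> 'n \<Rightarrow> real ^ 'n \<Rightarrow> 'b" where
  "partial_deriv f j x = vector_derivative (\<lambda>t. f (x + t *\<^sub>R axis j 1)) (at 0)"

text \<open>The constant bounds the partial derivatives only; the function itself need not be
  globally Lipschitz.\<close>

definition C11_with :: "real \<Rightarrow> (real ^ 'n \<Rightarrow> 'b::real_normed_vector) \<Rightarrow> bool" where
  "C11_with L f \<longleftrightarrow>
     (\<forall>j. (\<forall>x. (\<lambda>t. f (x + t *\<^sub>R axis j 1)) differentiable (at 0)) \<and>
          L-lipschitz_on UNIV (partial_deriv f j))"

definition admissible :: "(real \<Rightarrow> real ^ 'm) \<Rightarrow> bool" where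
  "admissible u \<longleftrightarrow>
     u \<in> borel_measurable (lebesgue_on {0..}) \<and>
     (AE t in lebesgue_on {0..}. \<forall>i. u t $ i \<in> {-1..1})"

text \<open>\<open>y\<close> is the Caratheodory solution on \<open>[0,t]\<close> of \<open>y' = F(y) + G(y) u\<close>, \<open>y(0) = x\<close>, the equation
  being understood in integral form since \<open>u\<close> is only measurable.  For continuous \<open>y\<close> and admissible
  \<open>u\<close> the integrand is measurable and essentially bounded, so the integral is the Lebesgue integral.
  For \<open>C\<^sup>1\<^sup>,\<^sup>1\<close> data the solution is unique where it exists, but it may blow up in finite time, hence
  a relation with an explicit time horizon instead of a flow function.\<close>

definition trajectory ::
    "(real ^ 'n \<Rightarrow> real ^ 'n) \<Rightarrow> (real ^ 'n \<Rightarrow> real ^ 'm ^ 'n) \<Rightarrow> real ^ 'n \<Rightarrow> (real \<Rightarrow> real ^ 'm)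
      \<Rightarrow> real \<Rightarrow> (real \<Rightarrow> real ^ 'n) \<Rightarrow> bool" where
  "trajectory F G x u t y \<longleftrightarrow>
     continuous_on {0..t} y \<and>
     (\<forall>s\<in>{0..t}. ((\<lambda>r. F (y r) + G (y r) *v u r) has_integral (y s - x)) {0..s})"

definition reachable ::
    "(real ^ 'n \<Rightarrow> real ^ 'n) \<Rightarrow> (real ^ 'n \<Rightarrow> real ^ 'm ^ 'n) \<Rightarrow> real \<Rightarrow> (real ^ 'n) set" where
  "reachable F G \<tau> = {y \<tau> |y u. admissible u \<and> trajectory F G 0 u \<tau> y}"

text \<open>The infimum of the empty set is \<open>\<infinity>\<close>, as usual for minimum times.\<close>

definition min_time ::
    "(real ^ 'n \<Rightarrow> real ^ 'n) \<Rightarrow> (real ^ 'n \<Rightarrow> real ^ 'm ^ 'n) \<Rightarrow> real ^ 'n \<Rightarrow> ereal" where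
  "min_time F G x =
     (INF u \<in> {u. admissible u}.
        Inf {ereal t |t. 0 \<le> t \<and> (\<exists>y. trajectory F G x u t y \<and> y t = 0)})"

definition proximal_normal_cone :: "'a::real_inner set \<Rightarrow> 'a \<Rightarrow> 'a set" where
  "proximal_normal_cone K x =
     {v. \<exists>\<sigma>\<ge>0. \<forall>y\<in>K. v \<bullet> (y - x) \<le> \<sigma> * (norm (y - x))\<^sup>2}"

definition optimal_point ::
    "(real ^ 'n \<Rightarrow> real ^ 'n) \<Rightarrow> (real ^ 'n \<Rightarrow> real ^ 'm ^ 'n) \<Rightarrow> real ^ 'n \<Rightarrow> bool" where
  "optimal_point F G x \<longleftrightarrow>
     x \<noteq> 0 \<and>
     (\<exists>x1 u y t1 t. min_time F G x1 > min_time F G x \<and>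
        min_time F G x1 = ereal t1 \<and> min_time F G x = ereal t \<and>
        admissible u \<and> trajectory F G x1 u t1 y \<and> y t1 = 0 \<and> x = y (t1 - t))"

end

theory Submission
  imports Defs
begin

text \<open>Along a trajectory \<open>x\<close> of a control \<open>u\<close> let \<open>l\<close> solve the adjoint equation and let
  \<open>\<sigma>\<^sub>i = l \<bullet> G\<^sub>i(x)\<close> be the switching functions. Comparing with the trajectory \<open>y\<close> of another control
  \<open>w\<close>, one finds \<open>l(\<tau>) \<bullet> (y(\<tau>) - x(\<tau>)) = \<integral> \<Sum>\<^sub>i (w\<^sub>i - u\<^sub>i) \<sigma>\<^sub>i + O(\<tau> |l| U\<^sup>2)\<close>, where \<open>U\<close> is the
  \<open>L\<^sup>1\<close> distance of \<open>u\<close> and \<open>w\<close>; the factor \<open>\<tau>\<close> is due to \<open>DG(0) = 0\<close>. The rank condition makes each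
  \<open>\<sigma>\<^sub>i\<close> either bounded away from zero or strictly monotone with slope of order \<open>|l|\<close>, so that
  \<open>\<integral> |\<sigma>\<^sub>i| |w\<^sub>i - sgn \<sigma>\<^sub>i|\<close> dominates a multiple of \<open>|l|\<close> times the square of the \<open>L\<^sup>1\<close> norm. Hence if \<open>u\<close>
  nearly satisfies the maximum condition, then
  \<open>l(\<tau>) \<bullet> (y(\<tau>) - x(\<tau>)) \<le> o(1) - \<gamma> |l| U\<^sup>2\<close> for all \<open>w\<close> when \<open>\<tau>\<close> is small.

  A proximal normal forces the maximum condition approximately on trajectories ending near its base
  point, as one sees by moving \<open>u\<close> slightly towards \<open>sgn \<sigma>\<close>; this gives the first claim without
  knowing that reachable sets are closed.

  For the second claim reverse time. Let \<open>s\<close> be the least time for which \<open>p\<close> lies in the closure of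
  the reachable set, and project \<open>p\<close> to the closures of earlier reachable sets. The inequality makes
  the corresponding controls an \<open>L\<^sup>1\<close> Cauchy sequence, whose limit steers to \<open>p\<close> in time \<open>s\<close> and
  satisfies the maximum condition. That control is extended a little beyond \<open>s\<close> by constants keeping
  the maximum condition. An endpoint of the extension reached earlier would also be reached by a
  control that vanishes at first, which strictness excludes as the extremal control is bang-bang.\<close>

subsection \<open>Integrals and measurable functions on an interval\<close>

text \<open>The slope of \<open>\<sigma>\<^sub>i\<close> consists of
  \<open>- l \<bullet> DF(0) G\<^sub>i(0)\<close>, of terms in \<open>u\<^sub>j\<close> and the
  bracket of \<open>G\<^sub>j\<close> with \<open>G\<^sub>i\<close>, whose sign the control could
  choose, and of further terms that are small near the origin. The brackets carry a factor
  \<open>DG\<close>, so on \<open>{0..T}\<close> they are O(T |l|) and cannot beat the rank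
  condition, used in the form \<open>c |l| \<le> |l \<bullet> G\<^sub>i(0)| + |l \<bullet> DF(0)
  G\<^sub>i(0)|\<close>. All errors are expressed through \<open>c\<close>, a common bound
  \<open>K\<close> and the number of inputs, so that the time and \<gamma> can be fixed before
  \<open>F\<close> and \<open>G\<close> are given.

  As a boundary point need not be the endpoint of any trajectory, failure of the maximum condition
  is not excluded but measured, by a number called the defect. Only trajectories with small defect
  ending nearby are needed. The strict inequality then serves twice: as the claim, and as a
  substitute for weak compactness of controls, since it yields strong L1 convergence.

  Controls being merely measurable, arcs are integrals throughout, and statements about derivatives
  appear as statements about increments.\<close>

lemma bounded_measurable_integrable:
  fixes f :: "real \<Rightarrow> 'a::euclidean_space"
  assumes "f \<in> borel_measurable (lebesgue_on {0..T})"
    and "\<And>t. t \<in> {0..T} \<Longrightarrow> norm (f t) \<le> C" and "0 \<le> a" "b \<le> T"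
  shows "f integrable_on {a..b}"
proof -
  have "f integrable_on {0..T}"
    by (rule measurable_bounded_by_integrable_imp_integrable[OF assms(1), of "\<lambda>_. C"])
      (use assms(2) in auto)
  then show ?thesis
    using assms(3,4) by (auto intro: integrable_on_subinterval)
qed

lemma has_integral_norm_bound_const:
  fixes f :: "real \<Rightarrow> 'a::euclidean_space"
  assumes "(f has_integral i) {s..t}" "s \<le> t" "\<And>r. r \<in> {s..t} \<Longrightarrow> norm (f r) \<le> C"
  shows "norm i \<le> C * (t - s)"
proof -
  have "((\<lambda>_. C) has_integral (t - s) *\<^sub>R C) {s..t}"
    using assms(2) by (metis content_real has_integral_const_real)
  then have "norm (integral {s..t} f) \<le> integral {s..t} (\<lambda>_. C)"
    by (intro integral_norm_bound_integral) (use assms in auto)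
  then show ?thesis using assms by (simp add: integral_unique mult.commute)
qed

text \<open>The bound makes the derivative vanish at every point. This identifies functions given by
  integrals of measurable densities without differentiating them almost everywhere.\<close>

lemma constant_if_quadratic_increments:
  fixes P :: "real \<Rightarrow> 'a::real_normed_vector"
  assumes q: "\<And>s t. 0 \<le> s \<Longrightarrow> s \<le> t \<Longrightarrow> t \<le> T \<Longrightarrow> norm (P t - P s) \<le> C * (t - s)\<^sup>2"
    and t: "t \<in> {0..T}"
  shows "P t = P 0"
proof -
  have q': "norm (P t - P s) \<le> C * \<bar>t - s\<bar>\<^sup>2" if "s \<in> {0..T}" "t \<in> {0..T}" for s t
    using q[of s t] q[of t s] that by (cases "s \<le> t") (auto simp: norm_minus_commute power2_commute)
  have "(P has_derivative (\<lambda>h. 0)) (at s within {0..T})" if s: "s \<in> {0..T}" for s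
  proof (rule has_derivativeI_sandwich[of 1 _ _ _ _ "\<lambda>y. C * \<bar>y - s\<bar>"])
    fix y assume "y \<in> {0..T}" "y \<noteq> s"
    then show "norm (P y - P s - 0) / norm (y - s) \<le> C * \<bar>y - s\<bar>"
      using q'[of s y] s by (simp add: divide_le_eq power2_eq_square mult.assoc)
  next
    have "((\<lambda>y. C * \<bar>y - s\<bar>) \<longlongrightarrow> C * \<bar>s - s\<bar>) (at s within {0..T})"
      by (intro tendsto_intros)
    then show "((\<lambda>y. C * \<bar>y - s\<bar>) \<longlongrightarrow> 0) (at s within {0..T})" by simp
  qed auto
  then obtain c where "\<And>s. s \<in> {0..T} \<Longrightarrow> P s = c"
    using has_derivative_zero_constant[of "{0..T}" P] by auto
  then show ?thesis using t by auto
qed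

lemma continuous_on_if_increments:
  fixes a :: "real \<Rightarrow> 'a::real_normed_vector"
  assumes "\<And>s t. 0 \<le> s \<Longrightarrow> s \<le> t \<Longrightarrow> t \<le> T \<Longrightarrow> norm (a t - a s) \<le> C * (t - s)"
  shows "continuous_on {0..T} a"
proof (cases "0 \<le> T")
  case True
  have "\<bar>C\<bar>-lipschitz_on {0..T} a"
  proof (rule lipschitz_onI)
    fix s t assume st: "s \<in> {0..T}" "t \<in> {0..T}"
    have "norm (a t - a s) \<le> \<bar>C\<bar> * \<bar>t - s\<bar>" if "0 \<le> s" "s \<le> t" "t \<le> T" for s t
      using assms[OF that] that by (smt (verit) mult_right_mono)
    from this[of s t] this[of t s] st show "dist (a s) (a t) \<le> \<bar>C\<bar> * dist s t"
      by (cases "s \<le> t") (auto simp: dist_norm norm_minus_commute abs_minus_commute)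
  qed simp
  then show ?thesis by (rule lipschitz_on_continuous_on)
qed simp

lemma has_integral_inner_product_rule:
  fixes a b \<alpha> \<beta> :: "real \<Rightarrow> 'a::euclidean_space"
  assumes \<tau>: "\<tau> \<in> {0..T}"
    and a: "\<And>s t. 0 \<le> s \<Longrightarrow> s \<le> t \<Longrightarrow> t \<le> T \<Longrightarrow> (\<alpha> has_integral a t - a s) {s..t}"
    and b: "\<And>s t. 0 \<le> s \<Longrightarrow> s \<le> t \<Longrightarrow> t \<le> T \<Longrightarrow> (\<beta> has_integral b t - b s) {s..t}"
    and m: "\<alpha> \<in> borel_measurable (lebesgue_on {0..T})" "\<beta> \<in> borel_measurable (lebesgue_on {0..T})"
    and bd: "\<And>t. t \<in> {0..T} \<Longrightarrow> norm (\<alpha> t) \<le> C" "\<And>t. t \<in> {0..T} \<Longrightarrow> norm (\<beta> t) \<le> C"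
  shows "((\<lambda>r. \<alpha> r \<bullet> b r + a r \<bullet> \<beta> r) has_integral (a \<tau> \<bullet> b \<tau> - a 0 \<bullet> b 0)) {0..\<tau>}"
proof -
  have T: "0 \<le> T" using \<tau> by simp
  have C: "0 \<le> C" using order_trans[OF norm_ge_zero bd(1)[of 0]] T by simp
  have la: "norm (a t - a s) \<le> C * (t - s)" if "0 \<le> s" "s \<le> t" "t \<le> T" for s t
    by (rule has_integral_norm_bound_const[OF a]) (use that bd in auto)
  have lb: "norm (b t - b s) \<le> C * (t - s)" if "0 \<le> s" "s \<le> t" "t \<le> T" for s t
    by (rule has_integral_norm_bound_const[OF b]) (use that bd in auto)
  have ca: "continuous_on {0..T} a" by (rule continuous_on_if_increments[OF la])
  have cb: "continuous_on {0..T} b" by (rule continuous_on_if_increments[OF lb])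
  have ma[measurable]: "a \<in> borel_measurable (lebesgue_on {0..T})" "b \<in> borel_measurable (lebesgue_on {0..T})"
    using ca cb by (auto intro!: continuous_imp_measurable_on_sets_lebesgue)
  obtain D1 where D1: "\<And>t. t \<in> {0..T} \<Longrightarrow> norm (a t) \<le> D1"
    using compact_imp_bounded[OF compact_continuous_image[OF ca compact_Icc]] unfolding bounded_iff by blast
  obtain D2 where D2: "\<And>t. t \<in> {0..T} \<Longrightarrow> norm (b t) \<le> D2"
    using compact_imp_bounded[OF compact_continuous_image[OF cb compact_Icc]] unfolding bounded_iff by blast
  define h where "h r = \<alpha> r \<bullet> b r + a r \<bullet> \<beta> r" for r
  note m[measurable]
  have hm: "h \<in> borel_measurable (lebesgue_on {0..T})"
    unfolding h_def[abs_def] by measurable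
  have hb: "norm (h t) \<le> C * D2 + D1 * C" if "t \<in> {0..T}" for t
  proof -
    have "\<bar>\<alpha> t \<bullet> b t\<bar> \<le> C * D2"
      by (rule order_trans[OF Cauchy_Schwarz_ineq2 mult_mono]) (use bd D2 that C in auto)
    moreover have "\<bar>a t \<bullet> \<beta> t\<bar> \<le> D1 * C"
    proof (rule order_trans[OF Cauchy_Schwarz_ineq2 mult_mono])
      show "0 \<le> D1" using D1[OF that] norm_ge_zero[of "a t"] by linarith
    qed (use bd D1 that C in auto)
    ultimately show ?thesis unfolding h_def by simp
  qed
  have hi: "h integrable_on {s..t}" if "0 \<le> s" "t \<le> T" for s t
    by (rule bounded_measurable_integrable[OF hm hb that])
  define P where "P t = a t \<bullet> b t - integral {0..t} h" for t
  have "P \<tau> = P 0"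
  proof (rule constant_if_quadratic_increments[where C="2 * C\<^sup>2" and T=T])
    fix s t assume st: "0 \<le> s" "s \<le> t" "t \<le> T"
    have 1: "integral {0..t} h - integral {0..s} h = integral {s..t} h"
      using Henstock_Kurzweil_Integration.integral_combine[of 0 s t h] hi st by auto
    have "((\<lambda>r. \<alpha> r \<bullet> b t + a s \<bullet> \<beta> r) has_integral ((a t - a s) \<bullet> b t + a s \<bullet> (b t - b s))) {s..t}"
      by (intro has_integral_add has_integral_linear[OF a[OF st] bounded_linear_inner_left, unfolded o_def]
           has_integral_linear[OF b[OF st] bounded_linear_inner_right, unfolded o_def])
    from has_integral_diff[OF this integrable_integral[OF hi]] st
    have "((\<lambda>r. \<alpha> r \<bullet> b t + a s \<bullet> \<beta> r - h r) has_integral (P t - P s)) {s..t}"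
      unfolding P_def using 1 by (simp add: inner_diff_left inner_diff_right algebra_simps)
    then have "norm (P t - P s) \<le> (2 * C\<^sup>2 * (t - s)) * (t - s)"
    proof (rule has_integral_norm_bound_const[OF _ st(2)])
      fix r assume r: "r \<in> {s..t}"
      have e: "\<alpha> r \<bullet> b t + a s \<bullet> \<beta> r - h r = \<alpha> r \<bullet> (b t - b r) - (a r - a s) \<bullet> \<beta> r"
        unfolding h_def by (simp add: inner_diff_left inner_diff_right)
      have "\<bar>\<alpha> r \<bullet> (b t - b r)\<bar> \<le> C * (C * (t - s))"
      proof (rule order_trans[OF Cauchy_Schwarz_ineq2 mult_mono])
        have "norm (b t - b r) \<le> C * (t - r)" using lb[of r t] r st by auto
        also have "\<dots> \<le> C * (t - s)" using C r by (intro mult_left_mono) auto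
        finally show "norm (b t - b r) \<le> C * (t - s)" .
      qed (use r st C bd in auto)
      moreover have "\<bar>(a r - a s) \<bullet> \<beta> r\<bar> \<le> (C * (t - s)) * C"
      proof (rule order_trans[OF Cauchy_Schwarz_ineq2 mult_mono])
        have "norm (a r - a s) \<le> C * (r - s)" using la[of s r] r st by auto
        also have "\<dots> \<le> C * (t - s)" using C r by (intro mult_left_mono) auto
        finally show "norm (a r - a s) \<le> C * (t - s)" .
      qed (use r st C bd in auto)
      ultimately show "norm (\<alpha> r \<bullet> b t + a s \<bullet> \<beta> r - h r) \<le> 2 * C\<^sup>2 * (t - s)"
        unfolding e real_norm_def power2_eq_square by (simp add: algebra_simps)
    qed
    then show "norm (P t - P s) \<le> 2 * C\<^sup>2 * (t - s)\<^sup>2" by (simp add: power2_eq_square mult.assoc)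
  qed (use \<tau> in auto)
  then have "integral {0..\<tau>} h = a \<tau> \<bullet> b \<tau> - a 0 \<bullet> b 0" unfolding P_def by simp
  then show ?thesis using integrable_integral[OF hi[of 0 \<tau>]] \<tau> unfolding h_def by simp
qed

lemma has_integral_reverse:
  fixes h :: "real \<Rightarrow> 'a::euclidean_space"
  assumes "(h has_integral i) {t - s..t}"
  shows "((\<lambda>r. h (t - r)) has_integral i) {0..s}"
proof -
  have "((\<lambda>x. h (-1 *\<^sub>R x + t)) has_integral (1 / (\<bar>-1\<bar> ^ DIM(real))) *\<^sub>R i)
      ((\<lambda>x. (1 / -1) *\<^sub>R x + -((1 / -1) *\<^sub>R t)) ` cbox (t - s) t)"
    by (rule has_integral_affinity) (use assms in auto)
  moreover have "(\<lambda>x. (1 / -1) *\<^sub>R x + -((1 / -1) *\<^sub>R t)) ` cbox (t - s) t = {0..s}"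
  proof -
    have "(\<lambda>x. t - x) ` {t - s..t} = {0..s}"
    proof (intro equalityI subsetI)
      fix x assume "x \<in> {0..s}"
      then show "x \<in> (\<lambda>x. t - x) ` {t - s..t}" by (intro image_eqI[of _ _ "t - x"]) auto
    qed auto
    then show ?thesis by simp
  qed
  ultimately show ?thesis by simp
qed

lemma has_integral_Icc_diff:
  fixes g :: "real \<Rightarrow> 'a::euclidean_space"
  assumes s: "(g has_integral a) {0..s}" and t: "(g has_integral b) {0..t}" and "0 \<le> s" "s \<le> t"
  shows "(g has_integral b - a) {s..t}"
proof -
  have "g integrable_on {0..t}" using t by blast
  then have i: "g integrable_on {s..t}"
    by (rule integrable_subinterval_real) (use assms in auto)
  have "a + integral {s..t} g = b"
    by (rule has_integral_unique[OF has_integral_combine[OF assms(3,4) s integrable_integral[OF i]] t])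
  then have "integral {s..t} g = b - a" by (simp add: algebra_simps)
  then show ?thesis using integrable_integral[OF i] by simp
qed

lemma borel_measurable_vec_iff:
  fixes u :: "'b \<Rightarrow> real ^ 'm"
  shows "u \<in> borel_measurable M \<longleftrightarrow> (\<forall>i. (\<lambda>r. u r $ i) \<in> borel_measurable M)"
proof
  assume "\<forall>i. (\<lambda>r. u r $ i) \<in> borel_measurable M"
  then show "u \<in> borel_measurable M"
    by (subst borel_measurable_euclidean_space) (auto simp: Basis_vec_def inner_axis)
next
  assume "u \<in> borel_measurable M"
  then have "\<forall>b\<in>Basis. (\<lambda>r. u r \<bullet> b) \<in> borel_measurable M"
    by (subst (asm) borel_measurable_euclidean_space)
  then show "\<forall>i. (\<lambda>r. u r $ i) \<in> borel_measurable M"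
    by (auto simp: cart_eq_inner_axis axis_in_Basis_iff)
qed

text \<open>Banach's argument in the uniform norm, run on the iterates so that functions on
  \<open>{0..T}\<close> need no type of their own. The set \<open>K\<close> is the unit ball for
  trajectories and everything for adjoint arcs.\<close>

lemma uniform_contraction_fixpoint:
  fixes \<Phi> :: "(real \<Rightarrow> 'a::banach) \<Rightarrow> real \<Rightarrow> 'a"
  assumes T: "0 \<le> T" and K: "closed K" and y0: "continuous_on {0..T} y0" "y0 ` {0..T} \<subseteq> K"
    and self: "\<And>y. continuous_on {0..T} y \<Longrightarrow> y ` {0..T} \<subseteq> K \<Longrightarrow>
                 continuous_on {0..T} (\<Phi> y) \<and> \<Phi> y ` {0..T} \<subseteq> K"
    and contr: "\<And>y z e t. \<lbrakk>continuous_on {0..T} y; y ` {0..T} \<subseteq> K; continuous_on {0..T} z; z ` {0..T} \<subseteq> K;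
                 \<And>t. t \<in> {0..T} \<Longrightarrow> norm (y t - z t) \<le> e; t \<in> {0..T}\<rbrakk> \<Longrightarrow> norm (\<Phi> y t - \<Phi> z t) \<le> e / 2"
  shows "\<exists>y. continuous_on {0..T} y \<and> y ` {0..T} \<subseteq> K \<and> (\<forall>t\<in>{0..T}. \<Phi> y t = y t)"
proof -
  define Y where "Y n = (\<Phi> ^^ n) y0" for n
  have YS: "Y (Suc n) = \<Phi> (Y n)" for n by (simp add: Y_def)
  have Yc: "continuous_on {0..T} (Y n) \<and> Y n ` {0..T} \<subseteq> K" for n
    by (induction n) (use y0 self in \<open>auto simp: Y_def\<close>)
  have "continuous_on {0..T} (\<lambda>t. Y 1 t - Y 0 t)" using Yc by (intro continuous_intros) auto
  from compact_imp_bounded[OF compact_continuous_image[OF this compact_Icc]]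
  obtain e where e: "\<And>t. t \<in> {0..T} \<Longrightarrow> norm (Y 1 t - Y 0 t) \<le> e" unfolding bounded_iff by blast
  have st: "norm (Y (Suc n) t - Y n t) \<le> e * (1/2)^n" if "t \<in> {0..T}" for n t
    using that
  proof (induction n arbitrary: t)
    case 0 then show ?case using e by simp
  next
    case (Suc n)
    have "norm (\<Phi> (Y (Suc n)) t - \<Phi> (Y n) t) \<le> e * (1/2)^n / 2"
      using Suc Yc by (intro contr) auto
    then show ?case by (simp add: YS)
  qed
  have tele: "(\<Sum>i<n. Y (Suc i) t - Y i t) = Y n t - Y 0 t" for n t
    by (rule sum_lessThan_telescope)
  have "uniform_limit {0..T} (\<lambda>n t. \<Sum>i<n. Y (Suc i) t - Y i t) (\<lambda>t. \<Sum>i. Y (Suc i) t - Y i t) sequentially"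
    by (rule Weierstrass_m_test[where M="\<lambda>n. e * (1/2)^n"]) (use st in \<open>auto intro!: summable_mult summable_geometric\<close>)
  then have ul: "uniform_limit {0..T} (\<lambda>n t. Y n t - Y 0 t) (\<lambda>t. \<Sum>i. Y (Suc i) t - Y i t) sequentially"
    unfolding tele .
  define y where "y t = Y 0 t + (\<Sum>i. Y (Suc i) t - Y i t)" for t
  have ul: "uniform_limit {0..T} Y y sequentially"
    using uniform_limit_add[OF uniform_limit_const[where c="Y 0"] ul] unfolding y_def[abs_def] by simp
  have cy: "continuous_on {0..T} y"
    by (rule uniform_limit_theorem[OF _ ul]) (use Yc in auto)
  have yK: "y t \<in> K" if "t \<in> {0..T}" for t
    using closed_sequentially[OF K _ tendsto_uniform_limitI[OF ul that]] Yc that by blast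
  have "\<Phi> y t = y t" if t: "t \<in> {0..T}" for t
  proof -
    have "\<forall>\<^sub>F n in sequentially. norm (\<Phi> y t - y t) \<le> d" if d: "d > 0" for d :: real
    proof -
      have "\<forall>\<^sub>F n in sequentially. \<forall>t\<in>{0..T}. dist (Y n t) (y t) < d/2"
        using uniform_limitD[OF ul, of "d/2"] d by auto
      moreover from this have "\<forall>\<^sub>F n in sequentially. \<forall>t\<in>{0..T}. dist (Y (Suc n) t) (y t) < d/2"
        by (subst eventually_sequentially_Suc)
      ultimately show ?thesis
      proof eventually_elim
        case (elim n)
        have "norm (\<Phi> y t - \<Phi> (Y n) t) \<le> (d/2) / 2"
          using cy yK Yc elim(1) t by (intro contr) (auto simp: dist_norm norm_minus_commute less_imp_le)
        moreover have "norm (Y (Suc n) t - y t) < d/2" using elim(2) t by (auto simp: dist_norm)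
        ultimately show ?case using norm_triangle_ineq[of "\<Phi> y t - Y (Suc n) t" "Y (Suc n) t - y t"] d
          unfolding YS by simp
      qed
    qed
    then have "norm (\<Phi> y t - y t) \<le> d" if "d > 0" for d :: real
      using that by (auto simp: eventually_sequentially)
    then have "norm (\<Phi> y t - y t) \<le> 0" by (meson dense_ge)
    then show ?thesis by simp
  qed
  then show ?thesis using cy yK by blast
qed

text \<open>A density at most 2 has mass at most 4 \<delta> within distance \<delta> of
  \<open>s\<close>; the remaining mass is weighted by at least \<delta>.\<close>

lemma integral_weighted_distance_ge:
  fixes w :: "real \<Rightarrow> real"
  assumes \<tau>: "\<tau> \<in> {0..T}" and m: "w \<in> borel_measurable (lebesgue_on {0..T})"
    and w: "\<And>t. t \<in> {0..\<tau>} \<Longrightarrow> 0 \<le> w t \<and> w t \<le> 2"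
  shows "(integral {0..\<tau>} w)\<^sup>2 / 16 \<le> integral {0..\<tau>} (\<lambda>t. \<bar>t - s\<bar> * w t)"
proof -
  have m: "w \<in> borel_measurable (lebesgue_on {0..\<tau>})"
    using \<tau> by (intro measurable_restrict_mono[OF m]) auto
  define W where "W = integral {0..\<tau>} w"
  \<comment> \<open>This maximises the resulting lower bound \<delta> W - 4 \<delta>^2, with value
    W^2 / 16.\<close>
  define \<delta> where "\<delta> = W / 8"
  have wi: "w integrable_on {0..\<tau>}"
    by (rule bounded_measurable_integrable[OF m, of 2]) (use w in auto)
  have "0 \<le> W" unfolding W_def using w by (intro integral_nonneg wi) auto
  then have \<delta>: "0 \<le> \<delta>" unfolding \<delta>_def by simp
  have mm: "(\<lambda>t. \<bar>t - s\<bar> * w t) \<in> borel_measurable (lebesgue_on {0..\<tau>})"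
    by (intro borel_measurable_times m continuous_imp_measurable_on_sets_lebesgue continuous_intros) auto
  have wi': "(\<lambda>t. \<bar>t - s\<bar> * w t) integrable_on {0..\<tau>}"
  proof (rule bounded_measurable_integrable[OF mm])
    show "norm (\<bar>t - s\<bar> * w t) \<le> (\<tau> + \<bar>s\<bar>) * 2" if "t \<in> {0..\<tau>}" for t
    proof -
      have "\<bar>t - s\<bar> * w t \<le> (\<tau> + \<bar>s\<bar>) * 2"
        by (intro mult_mono) (use w[OF that] that in auto)
      then show ?thesis using w[OF that] by (simp add: abs_mult)
    qed
  qed auto
  define ind where "ind t = (if t \<in> {s - \<delta>..s + \<delta>} then 2 * \<delta> else 0)" for t
  have int: "{s - \<delta>..s + \<delta>} \<inter> {0..\<tau>} = {max 0 (s - \<delta>)..min \<tau> (s + \<delta>)}" by auto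
  have ii: "ind integrable_on {0..\<tau>}"
    unfolding ind_def[abs_def] integrable_restrict_Int int by (rule integrable_const_ivl)
  have int': "{0..\<tau>} \<inter> {s - \<delta>..s + \<delta>} = {max 0 (s - \<delta>)..min \<tau> (s + \<delta>)}" by auto
  have "integral {0..\<tau>} ind = integral {max 0 (s - \<delta>)..min \<tau> (s + \<delta>)} (\<lambda>_. 2 * \<delta>)"
    unfolding ind_def[abs_def] integral_restrict_Int by (simp only: int int')
  also have "\<dots> = measure lborel {max 0 (s - \<delta>)..min \<tau> (s + \<delta>)} * (2 * \<delta>)"
    by simp
  also have "\<dots> \<le> 2 * \<delta> * (2 * \<delta>)"
    using \<delta> by (intro mult_right_mono) (auto simp: content_real_if)
  finally have I: "integral {0..\<tau>} ind \<le> 4 * \<delta>\<^sup>2" by (simp add: power2_eq_square)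
  have "integral {0..\<tau>} (\<lambda>t. \<delta> * w t - ind t) \<le> integral {0..\<tau>} (\<lambda>t. \<bar>t - s\<bar> * w t)"
  proof (rule integral_le)
    show "(\<lambda>t. \<delta> * w t - ind t) integrable_on {0..\<tau>}"
      using integrable_cmul[OF wi, of \<delta>] ii by (intro integrable_diff) auto
    fix t assume t: "t \<in> {0..\<tau>}"
    show "\<delta> * w t - ind t \<le> \<bar>t - s\<bar> * w t"
    proof (cases "t \<in> {s - \<delta>..s + \<delta>}")
      case True
      have "\<delta> * w t \<le> \<delta> * 2" using w[OF t] \<delta> by (intro mult_left_mono) auto
      moreover have "0 \<le> \<bar>t - s\<bar> * w t" using w[OF t] by auto
      ultimately show ?thesis using True unfolding ind_def by auto
    next
      case False
      then show ?thesis using w[OF t] unfolding ind_def by (auto intro!: mult_right_mono)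
    qed
  qed (rule wi')
  moreover have "integral {0..\<tau>} (\<lambda>t. \<delta> * w t - ind t) = \<delta> * W - integral {0..\<tau>} ind"
    unfolding W_def using integrable_cmul[OF wi, of \<delta>] ii
    by (subst Henstock_Kurzweil_Integration.integral_diff) auto
  ultimately show ?thesis using I unfolding W_def[symmetric] \<delta>_def
    by (simp add: power2_eq_square field_simps)
qed

text \<open>Summable successive L1 distances make the pointwise distances summable almost
  everywhere, so the controls converge there, and dominated convergence turns this back into L1
  convergence.\<close>

lemma L1_limit_of_fast_cauchy:
  fixes u :: "nat \<Rightarrow> real \<Rightarrow> real ^ 'm"
  assumes m: "\<And>n i. (\<lambda>r. u n r $ i) \<in> borel_measurable (lebesgue_on {0..T})"
    and b: "\<And>n i r. r \<in> {0..T} \<Longrightarrow> \<bar>u n r $ i\<bar> \<le> 1"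
    and c: "\<And>n. integral {0..T} (\<lambda>r. \<Sum>i\<in>UNIV. \<bar>u (Suc n) r $ i - u n r $ i\<bar>) \<le> C * (1/2)^n"
  shows "\<exists>v :: real \<Rightarrow> real ^ 'm. (\<forall>i. (\<lambda>r. v r $ i) \<in> borel_measurable (lebesgue_on {0..T})) \<and>
           (\<forall>i. \<forall>r. \<bar>v r $ i\<bar> \<le> 1) \<and>
           (\<lambda>n. integral {0..T} (\<lambda>r. \<Sum>i\<in>UNIV. \<bar>u n r $ i - v r $ i\<bar>)) \<longlonglongrightarrow> 0"
proof -
  let ?M = "lebesgue_on {0..T}"
  note m[measurable]
  have fin: "integrable ?M f \<and> integral {0..T} f = (LINT r|?M. f r)"
    if "f \<in> borel_measurable ?M" "\<And>r. r \<in> {0..T} \<Longrightarrow> \<bar>f r\<bar> \<le> B" for f :: "real \<Rightarrow> real" and B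
  proof -
    have "f absolutely_integrable_on {0..T}"
      using bounded_measurable_integrable[OF that(1), of B 0 T] that
      by (intro measurable_bounded_by_integrable_imp_absolutely_integrable[where g="\<lambda>_. B"]) auto
    then have "integrable ?M f"
      by (simp add: absolutely_integrable_imp_integrable)
    then show ?thesis using lebesgue_integral_eq_integral[of "{0..T}" f] by auto
  qed
  define g where "g n r = (\<Sum>i\<in>UNIV. \<bar>u (Suc n) r $ i - u n r $ i\<bar>)" for n r
  have gm[measurable]: "g n \<in> borel_measurable ?M" for n unfolding g_def[abs_def] by measurable
  have g0: "0 \<le> g n r" for n r unfolding g_def by (intro sum_nonneg) auto
  have gb: "\<bar>g n r\<bar> \<le> (\<Sum>i\<in>(UNIV::'m set). 2)" if r: "r \<in> {0..T}" for n r
  proof -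
    have "g n r \<le> (\<Sum>i\<in>(UNIV::'m set). 2)"
      unfolding g_def
    proof (rule sum_mono)
      show "\<bar>u (Suc n) r $ i - u n r $ i\<bar> \<le> 2" for i using b[OF r, of n i] b[OF r, of "Suc n" i] by linarith
    qed
    then show ?thesis using g0[of n r] by simp
  qed
  have "(\<integral>\<^sup>+ r. (\<Sum>n. ennreal (g n r)) \<partial>?M) = (\<Sum>n. \<integral>\<^sup>+ r. ennreal (g n r) \<partial>?M)"
    by (rule nn_integral_suminf) measurable
  also have "\<dots> = (\<Sum>n. ennreal (integral {0..T} (g n)))"
    using fin[OF gm gb] by (subst nn_integral_eq_integral) (auto simp: g0)
  also have "\<dots> \<le> (\<Sum>n. ennreal (C * (1/2)^n))"
    using c by (intro suminf_le summableI ennreal_leI) (auto simp: g_def[abs_def])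
  also have "\<dots> < top"
  proof -
    have "g 0 integrable_on {0..T}"
      by (rule bounded_measurable_integrable[OF gm]) (use gb in auto)
    then have "0 \<le> integral {0..T} (g 0)" by (rule integral_nonneg) (rule g0)
    also have "\<dots> \<le> C" using c[of 0] by (simp add: g_def[abs_def])
    finally have "0 \<le> C" .
    then have "(\<Sum>n. ennreal (C * (1/2)^n)) = ennreal (\<Sum>n. C * (1/2)^n)"
      by (intro suminf_ennreal2) (auto intro!: summable_mult summable_geometric)
    then show ?thesis by simp
  qed
  finally have "(\<integral>\<^sup>+ r. (\<Sum>n. ennreal (g n r)) \<partial>?M) \<noteq> \<infinity>" by auto
  then have ae: "AE r in ?M. (\<Sum>n. ennreal (g n r)) \<noteq> \<infinity>"
    by (intro nn_integral_PInf_AE) measurable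
  have sm: "AE r in ?M. summable (\<lambda>n. g n r)"
    using ae by eventually_elim (use g0 in \<open>auto intro: summable_suminf_not_top\<close>)
  \<comment> \<open>Clipping secures the bound at every point, also on the null set where the
    sequence may diverge and \<open>lim\<close> is unspecified.\<close>
  define v where "v r = (\<chi> i. max (-1) (min 1 (lim (\<lambda>n. u n r $ i))))" for r
  have vm[measurable]: "(\<lambda>r. v r $ i) \<in> borel_measurable ?M" for i
    unfolding v_def by simp measurable
  have vb: "\<bar>v r $ i\<bar> \<le> 1" for r i unfolding v_def by auto
  have conv: "(\<lambda>n. u n r $ i) \<longlonglongrightarrow> v r $ i" if s: "summable (\<lambda>n. g n r)" and r: "r \<in> {0..T}" for r i
  proof -
    have "summable (\<lambda>n. u (Suc n) r $ i - u n r $ i)"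
    proof (rule summable_comparison_test'[OF s])
      show "norm (u (Suc n) r $ i - u n r $ i) \<le> g n r" for n
        unfolding g_def by (simp add: member_le_sum[of i UNIV "\<lambda>i. \<bar>u (Suc n) r $ i - u n r $ i\<bar>"])
    qed
    from summable_LIMSEQ[OF this] have "convergent (\<lambda>n. u n r $ i - u 0 r $ i)"
      unfolding sum_lessThan_telescope[of "\<lambda>n. u n r $ i"] convergent_def by blast
    then have "convergent (\<lambda>n. u n r $ i)"
      using convergent_add[OF _ convergent_const[of "u 0 r $ i"]] by fastforce
    then have l: "(\<lambda>n. u n r $ i) \<longlonglongrightarrow> lim (\<lambda>n. u n r $ i)" by (simp add: convergent_LIMSEQ_iff)
    have "lim (\<lambda>n. u n r $ i) \<le> 1" using b[OF r, of _ i]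
      by (intro LIMSEQ_le_const2[OF l]) (auto simp: abs_le_iff)
    moreover have "-1 \<le> lim (\<lambda>n. u n r $ i)" using b[OF r, of _ i]
      by (intro LIMSEQ_le_const[OF l]) (auto simp: abs_le_iff minus_le_iff)
    ultimately show ?thesis using l unfolding v_def by simp
  qed
  define h where "h n r = (\<Sum>i\<in>UNIV. \<bar>u n r $ i - v r $ i\<bar>)" for n r
  have hm[measurable]: "h n \<in> borel_measurable ?M" for n unfolding h_def[abs_def] by measurable
  have hb: "\<bar>h n r\<bar> \<le> (\<Sum>i\<in>(UNIV::'m set). 2)" if r: "r \<in> {0..T}" for n r
  proof -
    have "h n r \<le> (\<Sum>i\<in>(UNIV::'m set). 2)"
      unfolding h_def
    proof (rule sum_mono)
      show "\<bar>u n r $ i - v r $ i\<bar> \<le> 2" for i using b[OF r, of n i] vb[of r i] by linarith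
    qed
    moreover have "0 \<le> h n r" unfolding h_def by (intro sum_nonneg) auto
    ultimately show ?thesis by simp
  qed
  have "(\<lambda>n. LINT r|?M. h n r) \<longlonglongrightarrow> (LINT r|?M. (0::real))"
  proof (rule integral_dominated_convergence[where w="\<lambda>_. \<Sum>i\<in>(UNIV::'m set). 2"])
    show "integrable ?M (\<lambda>_. \<Sum>i\<in>(UNIV::'m set). 2 :: real)"
      by (intro conjunct1[OF fin[of _ "\<Sum>i\<in>(UNIV::'m set). 2"]]) auto
    show "AE r in ?M. (\<lambda>n. h n r) \<longlonglongrightarrow> 0"
      using sm AE_space
    proof eventually_elim
      case (elim r)
      have "(\<lambda>n. h n r) \<longlonglongrightarrow> (\<Sum>i\<in>UNIV. \<bar>v r $ i - v r $ i\<bar>)"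
        unfolding h_def by (intro tendsto_intros conv) (use elim in auto)
      then show ?case by simp
    qed
    show "AE r in ?M. norm (h n r) \<le> (\<Sum>i\<in>(UNIV::'m set). 2)" for n
      using AE_space by eventually_elim (use hb in auto)
  qed (measurable)
  then have "(\<lambda>n. integral {0..T} (h n)) \<longlonglongrightarrow> 0" using fin[OF hm hb] by simp
  then show ?thesis using vm vb unfolding h_def[abs_def] by (intro exI[of _ v]) blast
qed

subsection \<open>Maps with Lipschitz partial derivatives\<close>

lemma continuous_if_lipschitz_bound:
  fixes g :: "'a::real_normed_vector \<Rightarrow> 'b::real_normed_vector"
  assumes "\<And>x y. norm (g x - g y) \<le> C * norm (x - y)"
  shows "continuous_on S g"
proof -
  have "\<bar>C\<bar>-lipschitz_on S g"
  proof (rule lipschitz_onI)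
    show "dist (g x) (g y) \<le> \<bar>C\<bar> * dist x y" for x y
      unfolding dist_norm using assms[of x y] by (smt (verit) mult_right_mono norm_ge_zero)
  qed simp
  then show ?thesis by (rule lipschitz_on_continuous_on)
qed

lemma C11_with_partial_has_vector_derivative:
  assumes "C11_with L H"
  shows "((\<lambda>t. H (x + t *\<^sub>R axis j 1)) has_vector_derivative partial_deriv H j (x + t *\<^sub>R axis j 1)) (at t)"
proof -
  let ?g = "\<lambda>s. H ((x + t *\<^sub>R axis j 1) + s *\<^sub>R axis j 1)"
  have "?g differentiable (at 0)" using assms unfolding C11_with_def by blast
  then have "(?g has_vector_derivative partial_deriv H j (x + t *\<^sub>R axis j 1)) (at (t - t))"
    unfolding partial_deriv_def using vector_derivative_works by auto
  moreover have "((\<lambda>s. s - t) has_vector_derivative 1) (at t)"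
    by (auto intro!: derivative_eq_intros)
  ultimately have "(?g \<circ> (\<lambda>s. s - t) has_vector_derivative 1 *\<^sub>R partial_deriv H j (x + t *\<^sub>R axis j 1)) (at t)"
    by (intro vector_diff_chain_at) auto
  moreover have "?g \<circ> (\<lambda>s. s - t) = (\<lambda>s. H (x + s *\<^sub>R axis j 1))"
    by (auto simp: scaleR_left_diff_distrib algebra_simps)
  ultimately show ?thesis by simp
qed

lemma C11_with_axis_remainder:
  assumes "C11_with L H"
  shows "norm (H (x + h *\<^sub>R axis j 1) - H x - h *\<^sub>R partial_deriv H j x) \<le> L * h\<^sup>2"
proof -
  have lip: "norm (partial_deriv H j x - partial_deriv H j y) \<le> L * norm (x - y)" for x y
    using assms unfolding C11_with_def lipschitz_on_def dist_norm by auto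
  have L: "0 \<le> L" using assms unfolding C11_with_def lipschitz_on_def by auto
  have "norm (H (x + h *\<^sub>R axis j 1) - H (x + 0 *\<^sub>R axis j 1) - (h - 0) *\<^sub>R partial_deriv H j (x + 0 *\<^sub>R axis j 1))
      \<le> norm (h - 0) * (L * \<bar>h\<bar>)"
  proof (rule vector_differentiable_bound_linearization
       [where S="closed_segment 0 h" and f="\<lambda>t. H (x + t *\<^sub>R axis j 1)"
          and f'="\<lambda>t. partial_deriv H j (x + t *\<^sub>R axis j 1)" and ?x0.0=0 and a=0 and b=h and B="L * \<bar>h\<bar>"])
    fix t assume t: "t \<in> closed_segment 0 h"
    show "((\<lambda>t. H (x + t *\<^sub>R axis j 1)) has_vector_derivative partial_deriv H j (x + t *\<^sub>R axis j 1))
       (at t within closed_segment 0 h)"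
      by (rule has_vector_derivative_at_within[OF C11_with_partial_has_vector_derivative[OF assms]])
    have "norm (partial_deriv H j (x + t *\<^sub>R axis j 1) - partial_deriv H j x) \<le> L * \<bar>t\<bar>"
      using lip[of "x + t *\<^sub>R axis j 1" x] by simp
    also have "\<dots> \<le> L * \<bar>h\<bar>"
      using t L by (intro mult_left_mono) (auto simp: closed_segment_eq_real_ivl split: if_splits)
    finally show "norm (partial_deriv H j (x + t *\<^sub>R axis j 1) - partial_deriv H j (x + 0 *\<^sub>R axis j 1)) \<le> L * \<bar>h\<bar>"
      by simp
  qed auto
  moreover have "norm (h - 0) * (L * \<bar>h\<bar>) = L * h\<^sup>2"
    by (simp add: power2_eq_square mult.left_commute)
  ultimately show ?thesis by (metis add.right_neutral diff_zero scaleR_zero_left)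
qed

text \<open>The Frechet derivative assembled from the partial ones, since \<open>C11_with\<close>
  speaks of these only. That it is the derivative follows from the quadratic remainder
  below.\<close>

definition total_deriv :: "(real ^ 'n \<Rightarrow> 'b::real_normed_vector) \<Rightarrow> real ^ 'n \<Rightarrow> real ^ 'n \<Rightarrow> 'b" where
  "total_deriv H x v = (\<Sum>j\<in>UNIV. v $ j *\<^sub>R partial_deriv H j x)"

lemma linear_total_deriv: "linear (total_deriv H x)"
  unfolding total_deriv_def[abs_def]
proof (rule linearI)
  show "(\<Sum>j\<in>UNIV. (v + w) $ j *\<^sub>R partial_deriv H j x)
      = (\<Sum>j\<in>UNIV. v $ j *\<^sub>R partial_deriv H j x) + (\<Sum>j\<in>UNIV. w $ j *\<^sub>R partial_deriv H j x)" for v w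
    by (simp only: vector_add_component scaleR_add_left sum.distrib)
  show "(\<Sum>j\<in>UNIV. (c *\<^sub>R v) $ j *\<^sub>R partial_deriv H j x)
      = c *\<^sub>R (\<Sum>j\<in>UNIV. v $ j *\<^sub>R partial_deriv H j x)" for c v
    by (simp only: vector_scaleR_component scaleR_sum_right scaleR_scaleR real_scaleR_def)
qed

lemma C11_with_total_deriv_lipschitz:
  fixes H :: "real ^ 2 \<Rightarrow> 'b::real_normed_vector"
  assumes "C11_with L H"
  shows "norm (total_deriv H x v - total_deriv H y v) \<le> 2 * L * norm (x - y) * norm v"
proof -
  have lip: "norm (partial_deriv H j x - partial_deriv H j y) \<le> L * norm (x - y)" for x y j
    using assms unfolding C11_with_def lipschitz_on_def dist_norm by auto
  have L: "0 \<le> L" using assms unfolding C11_with_def lipschitz_on_def by auto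
  have "norm (v $ j *\<^sub>R (partial_deriv H j x - partial_deriv H j y)) \<le> norm v * (L * norm (x - y))" for j
    unfolding norm_scaleR using component_le_norm_cart[of v j] lip[of j x y]
    by (intro mult_mono) auto
  from norm_triangle_le[OF add_mono[OF this[of 1] this[of 2]]]
  show ?thesis unfolding total_deriv_def UNIV_2 by (simp add: algebra_simps)
qed

text \<open>From \<open>x\<close> to \<open>y\<close> along the two axes: each leg costs a
  one-variable remainder, and moving the second partial derivative from the corner back to
  \<open>x\<close> costs a third, whence the factor 3.\<close>

lemma C11_with_remainder:
  fixes H :: "real ^ 2 \<Rightarrow> 'b::real_normed_vector"
  assumes "C11_with L H"
  shows "norm (H y - H x - total_deriv H x (y - x)) \<le> 3 * L * (norm (y - x))\<^sup>2"
proof -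
  have lip: "norm (partial_deriv H j x - partial_deriv H j y) \<le> L * norm (x - y)" for x y j
    using assms unfolding C11_with_def lipschitz_on_def dist_norm by auto
  have L: "0 \<le> L" using assms unfolding C11_with_def lipschitz_on_def by auto
  define v where "v = y - x"
  define x' where "x' = x + v $ 1 *\<^sub>R axis 1 1"
  have y: "y = x' + v $ 2 *\<^sub>R axis 2 1"
    unfolding x'_def v_def vec_eq_iff forall_2 by (simp add: axis_def)
  have c: "\<bar>v $ j\<bar> \<le> norm v" for j by (rule component_le_norm_cart)
  have c2: "(v $ j)\<^sup>2 \<le> (norm v)\<^sup>2" for j using c[of j] by (metis abs_le_square_iff abs_norm_cancel)
  have 1: "norm (H x' - H x - v $ 1 *\<^sub>R partial_deriv H 1 x) \<le> L * (norm v)\<^sup>2"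
    unfolding x'_def by (rule order_trans[OF C11_with_axis_remainder[OF assms]]) (intro mult_left_mono c2 L)
  have 2: "norm (H y - H x' - v $ 2 *\<^sub>R partial_deriv H 2 x') \<le> L * (norm v)\<^sup>2"
    unfolding y by (rule order_trans[OF C11_with_axis_remainder[OF assms]]) (intro mult_left_mono c2 L)
  have "norm (partial_deriv H 2 x' - partial_deriv H 2 x) \<le> L * norm v"
    by (rule order_trans[OF lip]) (use c[of 1] L in \<open>auto simp: x'_def intro!: mult_left_mono\<close>)
  then have 3: "norm (v $ 2 *\<^sub>R (partial_deriv H 2 x' - partial_deriv H 2 x)) \<le> norm v * (L * norm v)"
    unfolding norm_scaleR using c[of 2] by (intro mult_mono) auto
  have "H y - H x - total_deriv H x v = (H x' - H x - v $ 1 *\<^sub>R partial_deriv H 1 x)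
     + (H y - H x' - v $ 2 *\<^sub>R partial_deriv H 2 x') + v $ 2 *\<^sub>R (partial_deriv H 2 x' - partial_deriv H 2 x)"
    unfolding total_deriv_def UNIV_2 by (simp add: algebra_simps)
  also have "norm \<dots> \<le> L * (norm v)\<^sup>2 + L * (norm v)\<^sup>2 + norm v * (L * norm v)"
    by (intro norm_triangle_mono 1 2 3)
  finally show ?thesis unfolding v_def[symmetric] by (simp add: power2_eq_square algebra_simps)
qed

lemma has_derivative_if_quadratic_remainder:
  fixes H :: "'a::euclidean_space \<Rightarrow> 'b::real_normed_vector"
  assumes D: "linear D" and q: "\<And>y. norm (H y - H x - D (y - x)) \<le> C * (norm (y - x))\<^sup>2"
  shows "(H has_derivative D) (at x)"
proof (rule has_derivativeI_sandwich[of 1 _ _ _ _ "\<lambda>y. C * norm (y - x)"])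
  show "bounded_linear D" using D by (simp add: linear_conv_bounded_linear)
  show "norm (H y - H x - D (y - x)) / norm (y - x) \<le> C * norm (y - x)" if "y \<noteq> x" for y
    using q[of y] that by (simp add: divide_le_eq power2_eq_square mult.assoc)
  have "((\<lambda>y. C * norm (y - x)) \<longlongrightarrow> C * norm (x - x)) (at x)" by (intro tendsto_intros)
  then show "((\<lambda>y. C * norm (y - x)) \<longlongrightarrow> 0) (at x)" by simp
qed auto

subsection \<open>Control-affine systems on a short time interval\<close>

text \<open>Only estimates are assumed, and they are insensitive to the sign of the vector fields,
  so the time-reversed system is another instance. The first smallness condition confines
  trajectories to the unit ball and makes the integral operators contract; the second lets
  \<open>c\<close> absorb every error of order \<open>T\<close>.\<close>

locale control_system =
  fixes F :: "'a::euclidean_space \<Rightarrow> 'a" and DF :: "'a \<Rightarrow> 'a \<Rightarrow> 'a"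
    and G :: "'m::finite \<Rightarrow> 'a \<Rightarrow> 'a" and DG :: "'m \<Rightarrow> 'a \<Rightarrow> 'a \<Rightarrow> 'a"
    and K c T k m :: real
  assumes linF: "linear (DF x)" and linG: "linear (DG i x)"
    and remF: "norm (F y - F x - DF x (y - x)) \<le> K * (norm (y - x))\<^sup>2"
    and remG: "norm (G i y - G i x - DG i x (y - x)) \<le> K * (norm (y - x))\<^sup>2"
    and lipF: "norm (DF x v - DF y v) \<le> K * norm (x - y) * norm v"
    and lipG: "norm (DG i x v - DG i y v) \<le> K * norm (x - y) * norm v"
    and F0: "F 0 = 0" and DG0: "DG i 0 v = 0"
    and DF0: "norm (DF 0 v) \<le> K * norm v" and G0: "norm (G i 0) \<le> K"
    and K: "1 \<le> K" and c: "0 < c"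
    and nondegenerate: "c * norm l \<le> \<bar>l \<bullet> G i 0\<bar> + \<bar>l \<bullet> DF 0 (G i 0)\<bar>"
    and T: "0 < T" "T \<le> 1"
    and m_def: "m = real CARD('m)" and k_def: "k = K * (1 + m)"
    and small: "16 * k * T \<le> 1" "100000 * k ^ 4 * T \<le> c"
begin

lemma k_ge: "K \<le> k" "1 \<le> k" "m \<le> k" "2 \<le> k"
proof -
  have m1: "1 \<le> m" unfolding m_def by (simp add: Suc_leI)
  have "K * 1 \<le> K * (1 + m)" using K m1 by (intro mult_left_mono) auto
  then show 1: "K \<le> k" unfolding k_def by simp
  then show "1 \<le> k" using K by simp
  have "1 * (1 + m) \<le> K * (1 + m)" using K m1 by (intro mult_right_mono) auto
  then have "1 + m \<le> k" unfolding k_def by simp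
  then show "m \<le> k" "2 \<le> k" using m1 by auto
qed

lemma kT: "k * T \<le> 1/16" "0 \<le> k * T"
  using small k_ge T by auto

subsection \<open>The controlled vector field\<close>

definition f :: "'a \<Rightarrow> real ^ 'm \<Rightarrow> 'a" where
  "f x u = F x + (\<Sum>i\<in>UNIV. u $ i *\<^sub>R G i x)"

definition Df :: "'a \<Rightarrow> real ^ 'm \<Rightarrow> 'a \<Rightarrow> 'a" where
  "Df x u v = DF x v + (\<Sum>i\<in>UNIV. u $ i *\<^sub>R DG i x v)"

definition boxed :: "real ^ 'm \<Rightarrow> bool" where
  "boxed u \<longleftrightarrow> (\<forall>i. \<bar>u $ i\<bar> \<le> 1)"

lemma linear_Df: "linear (Df x u)"
  unfolding Df_def[abs_def]
  by (intro linear_compose_add linF linear_compose_sum ballI linear_compose_scale_right linG)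

lemma norm_boxed_sum_le:
  assumes "boxed u" "\<And>i. norm (g i) \<le> b"
  shows "norm (\<Sum>i\<in>UNIV. u $ i *\<^sub>R (g i :: 'a)) \<le> m * b"
proof -
  have "norm (u $ i *\<^sub>R g i) \<le> 1 * b" for i
    unfolding norm_scaleR using assms by (intro mult_mono) (auto simp: boxed_def)
  from sum_norm_le[of UNIV "\<lambda>i. u $ i *\<^sub>R g i" "\<lambda>_. 1 * b", OF this] show ?thesis by (simp add: m_def)
qed

lemma DF_dev: "norm (DF x v - DF 0 v) \<le> K * norm x * norm v"
  using lipF[of x v 0] by simp

lemma DG_bd: "norm (DG i x v) \<le> K * norm x * norm v"
  using lipG[of i x v 0] by (simp add: DG0)

lemma Df_dev:
  assumes "boxed u" shows "norm (Df x u v - DF 0 v) \<le> k * norm x * norm v"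
proof -
  have "norm (Df x u v - DF 0 v) = norm ((DF x v - DF 0 v) + (\<Sum>i\<in>UNIV. u $ i *\<^sub>R DG i x v))"
    unfolding Df_def by (simp add: algebra_simps)
  also have "\<dots> \<le> K * norm x * norm v + m * (K * norm x * norm v)"
    by (intro norm_triangle_mono DF_dev norm_boxed_sum_le[OF assms] DG_bd)
  finally show ?thesis unfolding k_def by (simp add: algebra_simps)
qed

lemma Df_bd:
  assumes "boxed u" "norm x \<le> 1" shows "norm (Df x u v) \<le> 2 * k * norm v"
proof -
  have "norm (Df x u v) = norm ((Df x u v - DF 0 v) + DF 0 v)" by simp
  also have "\<dots> \<le> k * norm x * norm v + K * norm v"
    by (intro norm_triangle_mono DF0 Df_dev assms)
  also have "\<dots> \<le> k * 1 * norm v + k * norm v"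
    using assms k_ge by (intro add_mono mult_mono) auto
  finally show ?thesis by simp
qed

lemma G_dev: "norm (G i x - G i 0) \<le> K * (norm x)\<^sup>2"
  using remG[of i x 0] by (simp add: DG0)

lemma norm_sq_le: "norm x \<le> 1 \<Longrightarrow> (norm x)\<^sup>2 \<le> norm (x::'a)"
  unfolding power2_eq_square using mult_left_le_one_le[of "norm x" "norm x"] by simp

lemma G_bd:
  assumes "norm x \<le> 1" shows "norm (G i x) \<le> 2 * K"
proof -
  have "norm (G i x) = norm ((G i x - G i 0) + G i 0)" by simp
  also have "\<dots> \<le> K * (norm x)\<^sup>2 + K"
    by (intro norm_triangle_mono G_dev G0)
  also have "\<dots> \<le> K * 1 + K"
    using K norm_sq_le[OF assms] assms by (intro add_mono mult_left_mono) auto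
  finally show ?thesis by simp
qed

lemma F_bd:
  assumes "norm x \<le> 1" shows "norm (F x) \<le> 2 * K"
proof -
  have "norm (F x) = norm ((F x - F 0 - DF 0 (x - 0)) + DF 0 x)" by (simp add: F0)
  also have "\<dots> \<le> K * (norm (x - 0))\<^sup>2 + K * norm x"
    by (intro norm_triangle_mono remF DF0)
  also have "\<dots> \<le> K * 1 + K * 1"
    using K norm_sq_le[OF assms] assms by (intro add_mono mult_left_mono) auto
  finally show ?thesis by simp
qed

lemma f_bd:
  assumes "boxed u" "norm x \<le> 1" shows "norm (f x u) \<le> 2 * k"
proof -
  have "norm (f x u) \<le> 2 * K + m * (2 * K)"
    unfolding f_def by (intro norm_triangle_mono F_bd norm_boxed_sum_le G_bd assms)
  then show ?thesis unfolding k_def by (simp add: algebra_simps)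
qed

lemma f_rem:
  assumes "boxed u" shows "norm (f y u - f x u - Df x u (y - x)) \<le> k * (norm (y - x))\<^sup>2"
proof -
  have "f y u - f x u - Df x u (y - x) = (F y - F x - DF x (y - x))
      + (\<Sum>i\<in>UNIV. u $ i *\<^sub>R (G i y - G i x - DG i x (y - x)))"
    unfolding f_def Df_def by (simp add: algebra_simps sum_subtractf sum.distrib)
  also have "norm \<dots> \<le> K * (norm (y - x))\<^sup>2 + m * (K * (norm (y - x))\<^sup>2)"
    by (intro norm_triangle_mono remF norm_boxed_sum_le assms remG)
  finally show ?thesis unfolding k_def by (simp add: algebra_simps)
qed

lemma f_lip:
  assumes "boxed u" "norm x \<le> 1" "norm y \<le> 1"
  shows "norm (f y u - f x u) \<le> 4 * k * norm (y - x)"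
proof -
  have n: "norm (y - x) \<le> 2" using norm_triangle_ineq4[of y x] assms by linarith
  have "norm (f y u - f x u) = norm ((f y u - f x u - Df x u (y - x)) + Df x u (y - x))" by simp
  also have "\<dots> \<le> k * (norm (y - x))\<^sup>2 + 2 * k * norm (y - x)"
    by (intro norm_triangle_mono f_rem Df_bd assms)
  also have "k * (norm (y - x))\<^sup>2 \<le> k * (2 * norm (y - x))"
    unfolding power2_eq_square using k_ge n by (intro mult_left_mono mult_right_mono) auto
  finally show ?thesis by simp
qed

text \<open>As \<open>DG\<close> vanishes at the origin, the Lipschitz constant is proportional to
  the distance from the origin, hence O(T) along trajectories. This gives the factor
  \<open>T\<close> in the mixed term of \<open>pairing_estimate\<close> and in the field part of
  \<open>\<sigma>_increment\<close>.\<close>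

lemma G_lip:
  "norm (G i y - G i x) \<le> 2 * K * (norm x + norm y) * norm (y - x)"
proof -
  have n: "norm (y - x) \<le> norm y + norm x" by (rule norm_triangle_ineq4)
  have "norm (G i y - G i x) = norm ((G i y - G i x - DG i x (y - x)) + DG i x (y - x))" by simp
  also have "\<dots> \<le> K * (norm (y - x))\<^sup>2 + K * norm x * norm (y - x)"
    by (intro norm_triangle_mono remG DG_bd)
  also have "K * (norm (y - x))\<^sup>2 \<le> K * ((norm y + norm x) * norm (y - x))"
    unfolding power2_eq_square using K n by (intro mult_left_mono mult_right_mono) auto
  also have "K * norm x * norm (y - x) \<le> K * ((norm x + norm y) * norm (y - x))"
    unfolding mult.assoc using K by (intro mult_left_mono mult_right_mono) auto
  finally show ?thesis by (simp add: algebra_simps)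
qed

lemma f_ctrl_diff: "f x u - f x w = (\<Sum>i\<in>UNIV. (u $ i - w $ i) *\<^sub>R G i x)"
  unfolding f_def by (simp add: scaleR_left_diff_distrib sum_subtractf)

lemma norm_ctrl_sum_le:
  assumes "\<And>i. norm (g i) \<le> b"
  shows "norm (\<Sum>i\<in>UNIV. (u $ i - w $ i) *\<^sub>R (g i :: 'a)) \<le> b * (\<Sum>i\<in>UNIV. \<bar>u $ i - w $ i\<bar>)"
proof -
  have "norm ((u $ i - w $ i) *\<^sub>R g i) \<le> \<bar>u $ i - w $ i\<bar> * b" for i
    unfolding norm_scaleR using assms by (intro mult_left_mono) auto
  from sum_norm_le[of UNIV "\<lambda>i. (u $ i - w $ i) *\<^sub>R g i" "\<lambda>i. \<bar>u $ i - w $ i\<bar> * b", OF this]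
  show ?thesis by (simp add: sum_distrib_left mult.commute)
qed

lemma f_diff:
  assumes "boxed u" "norm x \<le> 1" "norm y \<le> 1"
  shows "norm (f x u - f y w) \<le> 4 * k * norm (x - y) + 2 * k * (\<Sum>i\<in>UNIV. \<bar>u $ i - w $ i\<bar>)"
proof -
  have "norm (f x u - f y w) = norm ((f x u - f y u) + (f y u - f y w))" by simp
  also have "\<dots> \<le> 4 * k * norm (x - y) + 2 * k * (\<Sum>i\<in>UNIV. \<bar>u $ i - w $ i\<bar>)"
    unfolding f_ctrl_diff
  proof (intro norm_triangle_mono f_lip assms norm_ctrl_sum_le)
    show "norm (G i y) \<le> 2 * k" for i using G_bd[OF assms(3), of i] k_ge by linarith
  qed
  finally show ?thesis .
qed

lemma continuous_F: "continuous_on S F" and continuous_G: "continuous_on S (G i)"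
proof -
  have "(F has_derivative DF x) (at x)" for x
    by (rule has_derivative_if_quadratic_remainder[OF linF remF])
  then show "continuous_on S F"
    by (meson continuous_at_imp_continuous_on has_derivative_continuous)
  have "(G i has_derivative DG i x) (at x)" for x
    by (rule has_derivative_if_quadratic_remainder[OF linG remG])
  then show "continuous_on S (G i)"
    by (meson continuous_at_imp_continuous_on has_derivative_continuous)
qed

lemma continuous_DF: "continuous_on S (\<lambda>x. DF x v)" and continuous_DG: "continuous_on S (\<lambda>x. DG i x v)"
  by (rule continuous_if_lipschitz_bound[where C="K * norm v"],
      use lipF lipG in \<open>simp add: algebra_simps\<close>)+

subsection \<open>Trajectories\<close>

text \<open>The bound holds everywhere on \<open>{0..T}\<close>, which keeps null sets out of the
  estimates; \<open>admissible_box_ctrl\<close> makes the link with admissible controls.\<close>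

definition ctrl :: "(real \<Rightarrow> real ^ 'm) \<Rightarrow> bool" where
  "ctrl u \<longleftrightarrow> (\<forall>i. (\<lambda>r. u r $ i) \<in> borel_measurable (lebesgue_on {0..T})) \<and> (\<forall>r\<in>{0..T}. boxed (u r))"

lemma ctrlD: "ctrl u \<Longrightarrow> (\<lambda>r. u r $ i) \<in> borel_measurable (lebesgue_on {0..T})"
  "ctrl u \<Longrightarrow> r \<in> {0..T} \<Longrightarrow> boxed (u r)" "ctrl u \<Longrightarrow> r \<in> {0..T} \<Longrightarrow> \<bar>u r $ i\<bar> \<le> 1"
  by (auto simp: ctrl_def boxed_def)

definition U :: "real \<Rightarrow> (real \<Rightarrow> real ^ 'm) \<Rightarrow> (real \<Rightarrow> real ^ 'm) \<Rightarrow> real" where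
  "U S u w = integral {0..S} (\<lambda>r. \<Sum>i\<in>UNIV. \<bar>u r $ i - w r $ i\<bar>)"

lemma ctrl_diff_measurable:
  assumes "ctrl u" "ctrl w"
  shows "(\<lambda>r. \<Sum>i\<in>UNIV. \<bar>u r $ i - w r $ i\<bar>) \<in> borel_measurable (lebesgue_on {0..T})"
proof -
  note [measurable] = assms[THEN ctrlD(1)]
  show ?thesis by measurable
qed

lemma ctrl_diff_le:
  assumes "ctrl u" "ctrl w" "r \<in> {0..T}"
  shows "(\<Sum>i\<in>UNIV. \<bar>u r $ i - w r $ i\<bar>) \<le> 2 * m"
proof -
  have "\<bar>u r $ i - w r $ i\<bar> \<le> 2" for i
    using ctrlD(3)[OF assms(1,3), of i] ctrlD(3)[OF assms(2,3), of i] by linarith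
  then have "(\<Sum>i\<in>UNIV. \<bar>u r $ i - w r $ i\<bar>) \<le> (\<Sum>i\<in>(UNIV::'m set). 2)"
    by (intro sum_mono)
  then show ?thesis by (simp add: m_def)
qed

lemma ctrl_diff_integrable:
  assumes "ctrl u" "ctrl w" "0 \<le> s" "t \<le> T"
  shows "(\<lambda>r. \<Sum>i\<in>UNIV. \<bar>u r $ i - w r $ i\<bar>) integrable_on {s..t}"
proof (rule bounded_measurable_integrable[OF ctrl_diff_measurable[OF assms(1,2)] _ assms(3,4)])
  show "norm (\<Sum>i\<in>UNIV. \<bar>u r $ i - w r $ i\<bar>) \<le> 2 * m" if "r \<in> {0..T}" for r
    using ctrl_diff_le[OF assms(1,2) that] by (simp add: sum_nonneg)
qed

lemma U_mono:
  assumes "ctrl u" "ctrl w" "0 \<le> s" "s \<le> t" "t \<le> T"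
  shows "U s u w \<le> U t u w"
  unfolding U_def
proof (rule integral_subset_le)
  show "(\<lambda>r. \<Sum>i\<in>UNIV. \<bar>u r $ i - w r $ i\<bar>) integrable_on {0..s}"
    "(\<lambda>r. \<Sum>i\<in>UNIV. \<bar>u r $ i - w r $ i\<bar>) integrable_on {0..t}"
    using assms by (auto intro: ctrl_diff_integrable)
qed (use assms in \<open>auto simp: sum_nonneg\<close>)

lemma U_nonneg:
  assumes "ctrl u" "ctrl w" "t \<le> T" shows "0 \<le> U t u w"
  unfolding U_def by (intro integral_nonneg ctrl_diff_integrable[OF assms(1,2)] sum_nonneg)
    (use assms in auto)

definition traj :: "real \<Rightarrow> (real \<Rightarrow> real ^ 'm) \<Rightarrow> (real \<Rightarrow> 'a) \<Rightarrow> bool" where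
  "traj S u x \<longleftrightarrow> continuous_on {0..S} x \<and>
     (\<forall>s\<in>{0..S}. ((\<lambda>r. f (x r) (u r)) has_integral x s) {0..s})"

lemma traj_restrict: "traj S u x \<Longrightarrow> S' \<le> S \<Longrightarrow> traj S' u x"
  unfolding traj_def by (auto intro: continuous_on_subset)

lemma traj_0: "traj S u x \<Longrightarrow> 0 \<le> S \<Longrightarrow> x 0 = 0"
  unfolding traj_def using has_integral_unique[of _ "x 0" "{0..0}" 0] has_integral_null_real[of 0 0] by force

lemma traj_has_integral:
  assumes "traj S u x" "0 \<le> s" "s \<le> t" "t \<le> S"
  shows "((\<lambda>r. f (x r) (u r)) has_integral x t - x s) {s..t}"
  by (rule has_integral_Icc_diff) (use assms in \<open>auto simp: traj_def\<close>)

text \<open>Up to a first time of norm 1 the field is bounded by \<open>2 * k\<close>, so the norm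
  at that time is at most \<open>2 * k * T\<close>, which is at most 1/8.\<close>

lemma traj_norm_le_1:
  assumes u: "ctrl u" and x: "traj S u x" and S: "S \<le> T" and s: "s \<in> {0..S}"
  shows "norm (x s) < 1"
proof (rule ccontr)
  assume "\<not> norm (x s) < 1"
  then have ne: "{r \<in> {0..S}. 1 \<le> norm (x r)} \<noteq> {}" using s by auto
  have cx: "continuous_on {0..S} x" using x by (simp add: traj_def)
  have "closed {r \<in> {0..S}. 1 \<le> norm (x r)}"
    using cx by (intro continuous_on_closed_Collect_le continuous_intros) auto
  then have "compact {r \<in> {0..S}. 1 \<le> norm (x r)}"
    unfolding compact_eq_bounded_closed by (auto intro: bounded_subset[OF bounded_closed_interval[of 0 S]])
  from compact_attains_inf[OF this ne] obtain q where q: "q \<in> {0..S}" "1 \<le> norm (x q)"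
    and least: "\<And>r. r \<in> {0..S} \<Longrightarrow> 1 \<le> norm (x r) \<Longrightarrow> q \<le> r" by auto
  have "continuous_on {0..q} (\<lambda>r. norm (x r))"
    using q by (intro continuous_on_norm continuous_on_subset[OF cx]) auto
  moreover have "x 0 = 0" using traj_0[OF x] s by simp
  ultimately obtain p where "0 \<le> p" "p \<le> q" "norm (x p) = 1"
    using IVT'[of "\<lambda>r. norm (x r)" 0 1 q] q by auto
  with least[of p] q have qe: "norm (x q) = 1" by auto
  have "norm (x r) \<le> 1" if "r \<in> {0..q}" for r
    using least[of r] that q qe by force
  then have "norm (x q) \<le> 2 * k * (q - 0)"
    using x u q S by (intro has_integral_norm_bound_const[of "\<lambda>r. f (x r) (u r)"] f_bd ctrlD(2)) (auto simp: traj_def)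
  also have "\<dots> \<le> 2 * k * T" using q S k_ge by (intro mult_left_mono) auto
  finally show False using qe kT by simp
qed

lemma traj_lipschitz:
  assumes "ctrl u" "traj S u x" "S \<le> T" "0 \<le> s" "s \<le> t" "t \<le> S"
  shows "norm (x t - x s) \<le> 2 * k * (t - s)"
proof (rule has_integral_norm_bound_const[OF traj_has_integral[OF assms(2,4,5,6)] assms(5)])
  fix r assume "r \<in> {s..t}"
  then have r: "r \<in> {0..S}" "r \<in> {0..T}" using assms by auto
  show "norm (f (x r) (u r)) \<le> 2 * k"
    by (rule f_bd[OF ctrlD(2)[OF assms(1) r(2)] less_imp_le[OF traj_norm_le_1[OF assms(1,2,3) r(1)]]])
qed

lemma traj_norm_le:
  assumes "ctrl u" "traj S u x" "S \<le> T" "t \<in> {0..S}"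
  shows "norm (x t) \<le> 2 * k * t"
proof -
  have "0 \<le> S" "0 \<le> t" "t \<le> S" using assms(4) by auto
  then show ?thesis
    using traj_lipschitz[OF assms(1,2,3), of 0 t] traj_0[OF assms(2)] by simp
qed

text \<open>Short times replace Gronwall's lemma: the largest distance \<open>Z\<close> is at most
  \<open>4 * k * q * Z + 2 * k * U S u w\<close>, where \<open>4 * k * q\<close> is at most 1/4, so
  \<open>Z\<close> absorbs itself.\<close>

lemma traj_diff:
  assumes u: "ctrl u" and w: "ctrl w" and x: "traj S u x" and y: "traj S w y" and S: "S \<le> T" and t: "t \<in> {0..S}"
  shows "norm (x t - y t) \<le> 4 * k * U S u w"
proof -
  have "continuous_on {0..S} (\<lambda>t. norm (x t - y t))"
    using x y by (auto simp: traj_def intro!: continuous_intros)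
  from continuous_attains_sup[OF compact_Icc _ this] t
  obtain q where q: "q \<in> {0..S}" and max: "\<And>t. t \<in> {0..S} \<Longrightarrow> norm (x t - y t) \<le> norm (x q - y q)"
    by auto
  define Z where "Z = norm (x q - y q)"
  have hi: "((\<lambda>r. f (x r) (u r) - f (y r) (w r)) has_integral (x q - y q)) {0..q}"
    using x y q by (intro has_integral_diff) (auto simp: traj_def)
  have gi: "(\<lambda>r. \<Sum>i\<in>UNIV. \<bar>u r $ i - w r $ i\<bar>) integrable_on {0..q}"
    using q S by (intro ctrl_diff_integrable u w) auto
  have gi': "((\<lambda>r. 4 * k * Z + 2 * k * (\<Sum>i\<in>UNIV. \<bar>u r $ i - w r $ i\<bar>)) has_integral
      (4 * k * Z * q + 2 * k * U q u w)) {0..q}"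
    unfolding U_def using has_integral_const_real[of "4 * k * Z" 0 q] q
    by (intro has_integral_add has_integral_mult_right integrable_integral gi) (auto simp: mult_ac)
  have "norm (integral {0..q} (\<lambda>r. f (x r) (u r) - f (y r) (w r)))
      \<le> integral {0..q} (\<lambda>r. 4 * k * Z + 2 * k * (\<Sum>i\<in>UNIV. \<bar>u r $ i - w r $ i\<bar>))"
  proof (rule integral_norm_bound_integral)
    fix r assume r: "r \<in> {0..q}"
    have "norm (f (x r) (u r) - f (y r) (w r)) \<le> 4 * k * norm (x r - y r) + 2 * k * (\<Sum>i\<in>UNIV. \<bar>u r $ i - w r $ i\<bar>)"
      using r q S by (intro f_diff ctrlD(2)[OF u] less_imp_le traj_norm_le_1[OF u x S] traj_norm_le_1[OF w y S]) auto
    also have "4 * k * norm (x r - y r) \<le> 4 * k * Z"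
      unfolding Z_def using r q k_ge by (intro mult_left_mono max) auto
    finally show "norm (f (x r) (u r) - f (y r) (w r)) \<le> 4 * k * Z + 2 * k * (\<Sum>i\<in>UNIV. \<bar>u r $ i - w r $ i\<bar>)"
      by simp
  qed (use hi gi' in blast)+
  then have "Z \<le> 4 * k * Z * q + 2 * k * U q u w"
    unfolding integral_unique[OF hi] integral_unique[OF gi'] by (simp only: Z_def)
  also have "U q u w \<le> U S u w" using U_mono[OF u w] q S by auto
  also have "4 * k * Z * q = 4 * (k * q) * Z" by simp
  also have "4 * (k * q) * Z \<le> 4 * (1/16) * Z"
  proof (intro mult_right_mono mult_left_mono)
    have "k * q \<le> k * T" using q S k_ge by (intro mult_left_mono) auto
    then show "k * q \<le> 1/16" using kT by simp
  qed (auto simp: Z_def)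
  finally have "Z \<le> 4 * (1/16) * Z + 2 * k * U S u w" using k_ge by simp
  moreover have "0 \<le> k * U S u w" using k_ge U_nonneg[OF u w S] by simp
  ultimately have "Z \<le> 4 * k * U S u w" by simp
  then show ?thesis using max[OF t] unfolding Z_def by simp
qed

lemma f_measurable:
  assumes "ctrl u" "continuous_on {0..T} x"
  shows "(\<lambda>r. f (x r) (u r)) \<in> borel_measurable (lebesgue_on {0..T})"
proof -
  have [measurable]: "(\<lambda>r. F (x r)) \<in> borel_measurable (lebesgue_on {0..T})"
    "(\<lambda>r. G i (x r)) \<in> borel_measurable (lebesgue_on {0..T})" for i
    using assms(2) continuous_F continuous_G
    by (auto intro!: continuous_imp_measurable_on_sets_lebesgue intro: continuous_on_compose2)
  note [measurable] = ctrlD(1)[OF assms(1)]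
  show ?thesis unfolding f_def by measurable
qed

lemma traj_exists:
  assumes u: "ctrl u" shows "\<exists>x. traj T u x"
proof -
  define \<Phi> where "\<Phi> y t = integral {0..t} (\<lambda>r. f (y r) (u r))" for y t
  have hi: "((\<lambda>r. f (y r) (u r)) has_integral integral {s..t} (\<lambda>r. f (y r) (u r))) {s..t}"
    if y: "continuous_on {0..T} y" "y ` {0..T} \<subseteq> cball 0 1" and st: "0 \<le> s" "t \<le> T" for y s t
    by (intro integrable_integral bounded_measurable_integrable[OF f_measurable[OF u y(1)], of "2 * k"] f_bd ctrlD(2) u)
       (use y st in \<open>auto simp: image_subset_iff\<close>)
  have inc: "norm (\<Phi> y t - \<Phi> y s) \<le> 2 * k * (t - s)"
    if y: "continuous_on {0..T} y" "y ` {0..T} \<subseteq> cball 0 1" and st: "0 \<le> s" "s \<le> t" "t \<le> T" for y s t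
  proof -
    have "\<Phi> y s + integral {s..t} (\<lambda>r. f (y r) (u r)) = \<Phi> y t"
      unfolding \<Phi>_def using hi[OF y, of 0 t] st by (intro Henstock_Kurzweil_Integration.integral_combine) auto
    then have e: "\<Phi> y t - \<Phi> y s = integral {s..t} (\<lambda>r. f (y r) (u r))" by (simp add: algebra_simps)
    show ?thesis unfolding e
      by (rule has_integral_norm_bound_const[OF hi[OF y st(1,3)] st(2)], intro f_bd ctrlD(2) u)
        (use y st in \<open>auto simp: image_subset_iff\<close>)
  qed
  have "\<exists>y. continuous_on {0..T} y \<and> y ` {0..T} \<subseteq> cball 0 1 \<and> (\<forall>t\<in>{0..T}. \<Phi> y t = y t)"
  proof (rule uniform_contraction_fixpoint[where ?y0.0="\<lambda>_. 0"])
    fix y :: "real \<Rightarrow> 'a" assume y: "continuous_on {0..T} y" "y ` {0..T} \<subseteq> cball 0 1"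
    have "norm (\<Phi> y t) \<le> 1" if "t \<in> {0..T}" for t
    proof -
      have "norm (\<Phi> y t) \<le> 2 * k * t" using inc[OF y, of 0 t] that by (simp add: \<Phi>_def)
      also have "\<dots> \<le> 2 * k * T" using that k_ge by (intro mult_left_mono) auto
      finally show ?thesis using kT by simp
    qed
    then show "continuous_on {0..T} (\<Phi> y) \<and> \<Phi> y ` {0..T} \<subseteq> cball 0 1"
      using continuous_on_if_increments[of T "\<Phi> y" "2 * k"] inc[OF y] by auto
  next
    fix y z :: "real \<Rightarrow> 'a" and e t
    assume y: "continuous_on {0..T} y" "y ` {0..T} \<subseteq> cball 0 1"
      and z: "continuous_on {0..T} z" "z ` {0..T} \<subseteq> cball 0 1"
      and yz: "\<And>t. t \<in> {0..T} \<Longrightarrow> norm (y t - z t) \<le> e" and t: "t \<in> {0..T}"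
    have "norm (\<Phi> y t - \<Phi> z t) \<le> (4 * k * e) * (t - 0)"
    proof (rule has_integral_norm_bound_const)
      show "((\<lambda>r. f (y r) (u r) - f (z r) (u r)) has_integral \<Phi> y t - \<Phi> z t) {0..t}"
        unfolding \<Phi>_def using t by (intro has_integral_diff hi y z) auto
      fix r assume r: "r \<in> {0..t}"
      have "norm (f (y r) (u r) - f (z r) (u r)) \<le> 4 * k * norm (y r - z r)"
        using r t y z by (intro f_lip ctrlD(2) u) (auto simp: image_subset_iff)
      also have "\<dots> \<le> 4 * k * e" using r t k_ge by (intro mult_left_mono yz) auto
      finally show "norm (f (y r) (u r) - f (z r) (u r)) \<le> 4 * k * e" .
    qed (use t in auto)
    also have "\<dots> = 4 * (k * t) * e" by simp
    also have "\<dots> \<le> 4 * (1/8) * e"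
    proof (intro mult_right_mono mult_left_mono)
      have "k * t \<le> k * T" using t k_ge by (intro mult_left_mono) auto
      then show "k * t \<le> 1/8" using kT by simp
      show "0 \<le> e" using order_trans[OF norm_ge_zero yz[OF t]] .
    qed simp
    finally show "norm (\<Phi> y t - \<Phi> z t) \<le> e / 2" by simp
  qed (use T in auto)
  then obtain y where y: "continuous_on {0..T} y" "y ` {0..T} \<subseteq> cball 0 1"
    and fp: "\<And>t. t \<in> {0..T} \<Longrightarrow> \<Phi> y t = y t" by blast
  have "traj T u y"
    unfolding traj_def
  proof (intro conjI ballI y)
    show "((\<lambda>r. f (y r) (u r)) has_integral y s) {0..s}" if "s \<in> {0..T}" for s
      using hi[OF y, of 0 s] fp[OF that] that by (simp add: \<Phi>_def)
  qed
  then show ?thesis by blast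
qed

text \<open>The solution from the origin; by \<open>traj_unique\<close> the choice is immaterial on
  \<open>{0..T}\<close>.\<close>

definition X :: "(real \<Rightarrow> real ^ 'm) \<Rightarrow> real \<Rightarrow> 'a" where
  "X u = (SOME x. traj T u x)"

lemma traj_X: "ctrl u \<Longrightarrow> traj T u (X u)"
  unfolding X_def by (rule someI_ex[OF traj_exists])

lemma traj_unique:
  assumes u: "ctrl u" and x: "traj S u x" and "S \<le> T" "t \<in> {0..S}"
  shows "x t = X u t"
proof -
  have "norm (x t - X u t) \<le> 4 * k * U S u u"
    by (rule traj_diff[OF u u x traj_restrict[OF traj_X[OF u] assms(3)] assms(3,4)])
  then show ?thesis by (simp add: U_def)
qed

lemma continuous_X: "ctrl u \<Longrightarrow> continuous_on {0..T} (X u)"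
  using traj_X by (auto simp: traj_def)

lemma X_norm_le:
  assumes "ctrl u" "t \<in> {0..T}" shows "norm (X u t) \<le> 2 * k * t" "norm (X u t) \<le> 1"
  by (rule traj_norm_le[OF assms(1) traj_X[OF assms(1)] order_refl assms(2)])
    (rule less_imp_le[OF traj_norm_le_1[OF assms(1) traj_X[OF assms(1)] order_refl assms(2)]])

lemma X_lipschitz:
  assumes "ctrl u" "s \<in> {0..T}" "t \<in> {0..T}"
  shows "norm (X u t - X u s) \<le> 2 * k * \<bar>t - s\<bar>"
proof -
  note l = traj_lipschitz[OF assms(1) traj_X[OF assms(1)] order_refl]
  show ?thesis
  proof (cases "s \<le> t")
    case True then show ?thesis using l[of s t] assms(2,3) by simp
  next
    case False
    then show ?thesis using l[of t s] assms(2,3) by (simp add: norm_minus_commute)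
  qed
qed

lemma X_diff:
  assumes "ctrl u" "ctrl w" "S \<le> T" "t \<in> {0..S}"
  shows "norm (X u t - X w t) \<le> 4 * k * U S u w"
  by (rule traj_diff[OF assms(1,2) traj_restrict[OF traj_X[OF assms(1)] assms(3)]
        traj_restrict[OF traj_X[OF assms(2)] assms(3)] assms(3,4)])

subsection \<open>Adjoint arcs\<close>

text \<open>The adjoint equation in integral form, its minus sign absorbed in the increment
  \<open>l s - l t\<close>. Arcs live on all of \<open>{0..T}\<close>, so that one can be followed
  beyond the time at which its value is prescribed.\<close>

definition adj :: "(real \<Rightarrow> real ^ 'm) \<Rightarrow> (real \<Rightarrow> 'a) \<Rightarrow> bool" where
  "adj u l \<longleftrightarrow> continuous_on {0..T} l \<and>
     (\<forall>s t. 0 \<le> s \<longrightarrow> s \<le> t \<longrightarrow> t \<le> T \<longrightarrow>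
       ((\<lambda>r. adjoint (Df (X u r) (u r)) (l r)) has_integral (l s - l t)) {s..t})"

lemma adjoint_Df_bd:
  assumes "boxed u" "norm x \<le> 1" shows "norm (adjoint (Df x u) v) \<le> 2 * k * norm v"
proof -
  let ?w = "adjoint (Df x u) v"
  have "(norm ?w)\<^sup>2 = Df x u ?w \<bullet> v"
    using adjoint_works[OF linear_Df, of ?w x u v] by (simp add: power2_norm_eq_inner)
  also have "\<dots> \<le> norm (Df x u ?w) * norm v" by (rule norm_cauchy_schwarz)
  also have "\<dots> \<le> (2 * k * norm ?w) * norm v" by (intro mult_right_mono Df_bd assms) auto
  finally have "norm ?w * norm ?w \<le> (2 * k * norm v) * norm ?w" by (simp add: power2_eq_square mult_ac)
  then show ?thesis using k_ge by (cases "norm ?w = 0") auto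
qed

lemma adjoint_measurable:
  assumes u: "ctrl u" and l: "continuous_on {0..T} l"
  shows "(\<lambda>r. adjoint (Df (X u r) (u r)) (l r)) \<in> borel_measurable (lebesgue_on {0..T})"
proof (subst borel_measurable_euclidean_space, rule ballI)
  fix b :: 'a
  note cX = continuous_X[OF u]
  have [measurable]: "(\<lambda>r. l r \<bullet> DF (X u r) b) \<in> borel_measurable (lebesgue_on {0..T})"
    by (intro continuous_imp_measurable_on_sets_lebesgue continuous_on_inner l
        continuous_on_compose2[OF continuous_DF[of UNIV] cX]) auto
  have [measurable]: "(\<lambda>r. l r \<bullet> DG i (X u r) b) \<in> borel_measurable (lebesgue_on {0..T})" for i
    by (intro continuous_imp_measurable_on_sets_lebesgue continuous_on_inner l
        continuous_on_compose2[OF continuous_DG[of UNIV] cX]) auto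
  note [measurable] = ctrlD(1)[OF u]
  have "(\<lambda>r. l r \<bullet> DF (X u r) b + (\<Sum>i\<in>UNIV. u r $ i * (l r \<bullet> DG i (X u r) b)))
      \<in> borel_measurable (lebesgue_on {0..T})" by measurable
  also have "(\<lambda>r. l r \<bullet> DF (X u r) b + (\<Sum>i\<in>UNIV. u r $ i * (l r \<bullet> DG i (X u r) b)))
      = (\<lambda>r. adjoint (Df (X u r) (u r)) (l r) \<bullet> b)"
  proof
    fix r
    have "adjoint (Df (X u r) (u r)) (l r) \<bullet> b = l r \<bullet> Df (X u r) (u r) b"
      using adjoint_works[OF linear_Df, of b] by (metis inner_commute)
    then show "l r \<bullet> DF (X u r) b + (\<Sum>i\<in>UNIV. u r $ i * (l r \<bullet> DG i (X u r) b))
      = adjoint (Df (X u r) (u r)) (l r) \<bullet> b"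
      by (simp add: Df_def inner_add_right inner_sum_right)
  qed
  finally show "(\<lambda>r. adjoint (Df (X u r) (u r)) (l r) \<bullet> b) \<in> borel_measurable (lebesgue_on {0..T})" .
qed

text \<open>Picard iteration anchored at \<open>q\<close>, forwards and backwards at once. The
  equation is linear, so no invariant ball is needed.\<close>

lemma adj_exists:
  assumes u: "ctrl u" and q: "q \<in> {0..T}"
  shows "\<exists>l. adj u l \<and> l q = \<zeta>"
proof -
  define M where "M r v = adjoint (Df (X u r) (u r)) v" for r v
  define I where "I y t = integral {0..t} (\<lambda>r. M r (y r))" for y t
  define \<Phi> where "\<Phi> y t = \<zeta> + I y q - I y t" for y t
  have Mb: "norm (M r v) \<le> 2 * k * norm v" if "r \<in> {0..T}" for r v
    unfolding M_def by (rule adjoint_Df_bd[OF ctrlD(2)[OF u that] X_norm_le(2)[OF u that]])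
  have Ml: "M r (v - w) = M r v - M r w" for r v w
    unfolding M_def by (rule linear_diff[OF adjoint_linear[OF linear_Df]])
  have ex: "\<exists>C. \<forall>r\<in>{0..T}. norm (M r (y r)) \<le> C" if y: "continuous_on {0..T} y" for y
  proof -
    obtain C where C: "\<And>r. r \<in> {0..T} \<Longrightarrow> norm (y r) \<le> C"
      using compact_imp_bounded[OF compact_continuous_image[OF y compact_Icc]] unfolding bounded_iff by blast
    show ?thesis
    proof (intro exI[of _ "2 * k * C"] ballI)
      fix r assume r: "r \<in> {0..T}"
      have "2 * k * norm (y r) \<le> 2 * k * C" using k_ge C[OF r] by (intro mult_left_mono) auto
      then show "norm (M r (y r)) \<le> 2 * k * C" using Mb[OF r, of "y r"] by linarith
    qed
  qed
  have hi: "((\<lambda>r. M r (y r)) has_integral integral {s..t} (\<lambda>r. M r (y r))) {s..t}"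
    if y: "continuous_on {0..T} y" and st: "0 \<le> s" "t \<le> T" for y s t
  proof -
    obtain C where "\<And>r. r \<in> {0..T} \<Longrightarrow> norm (M r (y r)) \<le> C" using ex[OF y] by blast
    then show ?thesis
      using bounded_measurable_integrable[OF adjoint_measurable[OF u y] _ st, of C] unfolding M_def
      by (intro integrable_integral) auto
  qed
  have inc: "((\<lambda>r. M r (y r)) has_integral (I y t - I y s)) {s..t}"
    if y: "continuous_on {0..T} y" and st: "0 \<le> s" "s \<le> t" "t \<le> T" for y s t
  proof -
    have "I y s + integral {s..t} (\<lambda>r. M r (y r)) = I y t"
      unfolding I_def by (rule Henstock_Kurzweil_Integration.integral_combine[OF st(1,2) has_integral_integrable[OF hi[OF y]]])
        (use st in auto)
    then have "integral {s..t} (\<lambda>r. M r (y r)) = I y t - I y s" by (simp add: algebra_simps)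
    then show ?thesis using hi[OF y st(1,3)] by simp
  qed
  have "\<exists>y. continuous_on {0..T} y \<and> y ` {0..T} \<subseteq> UNIV \<and> (\<forall>t\<in>{0..T}. \<Phi> y t = y t)"
  proof (rule uniform_contraction_fixpoint[where ?y0.0="\<lambda>_. 0"])
    fix y :: "real \<Rightarrow> 'a" assume y: "continuous_on {0..T} y"
    obtain C where C: "\<And>r. r \<in> {0..T} \<Longrightarrow> norm (M r (y r)) \<le> C" using ex[OF y] by blast
    have "continuous_on {0..T} (I y)"
    proof (rule continuous_on_if_increments)
      show "norm (I y t - I y s) \<le> C * (t - s)" if "0 \<le> s" "s \<le> t" "t \<le> T" for s t
        by (rule has_integral_norm_bound_const[OF inc[OF y that] that(2)]) (use C that in auto)
    qed
    then show "continuous_on {0..T} (\<Phi> y) \<and> \<Phi> y ` {0..T} \<subseteq> UNIV"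
      unfolding \<Phi>_def by (auto intro!: continuous_intros)
  next
    fix y z :: "real \<Rightarrow> 'a" and e t
    assume y: "continuous_on {0..T} y" and z: "continuous_on {0..T} z"
      and yz: "\<And>t. t \<in> {0..T} \<Longrightarrow> norm (y t - z t) \<le> e" and t: "t \<in> {0..T}"
    have e: "0 \<le> e" using order_trans[OF norm_ge_zero yz[OF t]] .
    have *: "norm (I y s - I z s) \<le> e / 8" if s: "s \<in> {0..T}" for s
    proof -
      have s0: "0 \<le> s" "s \<le> T" using s by auto
      have "norm (I y s - I z s) \<le> (2 * k * e) * (s - 0)"
      proof (rule has_integral_norm_bound_const)
        show "((\<lambda>r. M r (y r) - M r (z r)) has_integral I y s - I z s) {0..s}"
          unfolding I_def using s0 by (intro has_integral_diff hi y z) auto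
        fix r assume r: "r \<in> {0..s}"
        have r': "r \<in> {0..T}" using r s by auto
        have "norm (M r (y r) - M r (z r)) \<le> 2 * k * norm (y r - z r)"
          using Mb[OF r', of "y r - z r"] by (simp only: Ml)
        also have "\<dots> \<le> 2 * k * e" using r' k_ge by (intro mult_left_mono yz) auto
        finally show "norm (M r (y r) - M r (z r)) \<le> 2 * k * e" .
      qed (rule s0)
      also have "\<dots> = 2 * (k * s) * e" by simp
      also have "\<dots> \<le> 2 * (1/16) * e"
      proof (intro mult_right_mono mult_left_mono e)
        have "k * s \<le> k * T" using s0 k_ge by (intro mult_left_mono) auto
        then show "k * s \<le> 1/16" using kT by simp
      qed simp
      finally show ?thesis by simp
    qed
    have "norm (\<Phi> y t - \<Phi> z t) = norm ((I y q - I z q) - (I y t - I z t))"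
      unfolding \<Phi>_def by (simp add: algebra_simps)
    also have "\<dots> \<le> e/8 + e/8"
      by (rule order_trans[OF norm_triangle_ineq4 add_mono[OF *[OF q] *[OF t]]])
    finally show "norm (\<Phi> y t - \<Phi> z t) \<le> e / 2" using e by simp
  qed (use T in auto)
  then obtain y where y: "continuous_on {0..T} y" and fp: "\<And>t. t \<in> {0..T} \<Longrightarrow> \<Phi> y t = y t" by blast
  have "y q = \<zeta>" using fp[OF q] by (simp add: \<Phi>_def)
  moreover have "adj u y"
    unfolding adj_def
  proof (intro conjI y allI impI)
    fix s t assume st: "0 \<le> s" "s \<le> t" "t \<le> T"
    have "y s - y t = I y t - I y s" using fp[of s] fp[of t] st by (simp add: \<Phi>_def algebra_simps)
    then show "((\<lambda>r. adjoint (Df (X u r) (u r)) (y r)) has_integral (y s - y t)) {s..t}"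
      using inc[OF y st] unfolding M_def by simp
  qed
  ultimately show ?thesis by blast
qed

text \<open>The largest norm on the interval differs from the norm at \<open>q\<close> by at most an
  eighth of itself. Sizes at any two times are thus comparable, and estimates may be normalised at
  whichever time is convenient.\<close>

lemma adj_norm_le:
  assumes u: "ctrl u" and l: "adj u l" and q: "q \<in> {0..T}" and s: "s \<in> {0..T}"
  shows "norm (l s) \<le> 2 * norm (l q)"
proof -
  have cl: "continuous_on {0..T} l" using l by (simp add: adj_def)
  have "continuous_on {0..T} (\<lambda>t. norm (l t))" by (intro continuous_intros cl)
  from continuous_attains_sup[OF compact_Icc _ this] s
  obtain p where p: "p \<in> {0..T}" and max: "\<And>t. t \<in> {0..T} \<Longrightarrow> norm (l t) \<le> norm (l p)"
    by auto
  have *: "norm (l b - l a) \<le> norm (l p) / 8" if ab: "0 \<le> a" "a \<le> b" "b \<le> T" for a b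
  proof -
    have "norm (l a - l b) \<le> (2 * k * norm (l p)) * (b - a)"
    proof (rule has_integral_norm_bound_const[OF _ ab(2)])
      show "((\<lambda>r. adjoint (Df (X u r) (u r)) (l r)) has_integral (l a - l b)) {a..b}"
        using l ab by (simp add: adj_def)
      fix r assume "r \<in> {a..b}"
      then have r: "r \<in> {0..T}" using ab by auto
      have "norm (adjoint (Df (X u r) (u r)) (l r)) \<le> 2 * k * norm (l r)"
        by (rule adjoint_Df_bd[OF ctrlD(2)[OF u r] X_norm_le(2)[OF u r]])
      also have "\<dots> \<le> 2 * k * norm (l p)" using k_ge max[OF r] by (intro mult_left_mono) auto
      finally show "norm (adjoint (Df (X u r) (u r)) (l r)) \<le> 2 * k * norm (l p)" .
    qed
    also have "\<dots> = 2 * (k * (b - a)) * norm (l p)" by simp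
    also have "\<dots> \<le> 2 * (1/16) * norm (l p)"
    proof (intro mult_right_mono mult_left_mono)
      have "k * (b - a) \<le> k * T" using ab k_ge by (intro mult_left_mono) auto
      then show "k * (b - a) \<le> 1/16" using kT by simp
    qed auto
    finally show ?thesis by (simp add: norm_minus_commute)
  qed
  have "norm (l p - l q) \<le> norm (l p) / 8"
    using *[of p q] *[of q p] p q by (cases "p \<le> q") (auto simp: norm_minus_commute)
  then have "norm (l p) \<le> 2 * norm (l q)" using norm_triangle_ineq2[of "l p" "l q"] norm_ge_zero[of "l p"] by linarith
  then show ?thesis using max[OF s] by linarith
qed

lemma adjoint_term_bd:
  assumes u: "ctrl u" and l: "adj u l" and q: "q \<in> {0..T}" and r: "r \<in> {0..T}"
  shows "norm (adjoint (Df (X u r) (u r)) (l r)) \<le> 4 * k * norm (l q)"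
proof -
  have "norm (adjoint (Df (X u r) (u r)) (l r)) \<le> 2 * k * norm (l r)"
    by (rule adjoint_Df_bd[OF ctrlD(2)[OF u r] X_norm_le(2)[OF u r]])
  also have "\<dots> \<le> 2 * k * (2 * norm (l q))"
    using k_ge adj_norm_le[OF u l q r] by (intro mult_left_mono) auto
  finally show ?thesis by simp
qed

lemma adj_has_integral:
  assumes "adj u l" "0 \<le> s" "s \<le> t" "t \<le> T"
  shows "((\<lambda>r. - adjoint (Df (X u r) (u r)) (l r)) has_integral (l t - l s)) {s..t}"
proof -
  have "((\<lambda>r. adjoint (Df (X u r) (u r)) (l r)) has_integral (l s - l t)) {s..t}"
    using assms by (simp add: adj_def)
  from has_integral_neg[OF this] show ?thesis by simp
qed

lemma adj_lipschitz:
  assumes u: "ctrl u" and l: "adj u l" and q: "q \<in> {0..T}" and s: "s \<in> {0..T}" and t: "t \<in> {0..T}"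
  shows "norm (l t - l s) \<le> 4 * k * norm (l q) * \<bar>t - s\<bar>"
proof -
  have *: "norm (l b - l a) \<le> 4 * k * norm (l q) * (b - a)" if ab: "0 \<le> a" "a \<le> b" "b \<le> T" for a b
    by (rule has_integral_norm_bound_const[OF adj_has_integral[OF l ab] ab(2)])
      (use adjoint_term_bd[OF u l q] ab in auto)
  show ?thesis
  proof (cases "s \<le> t")
    case True then show ?thesis using *[of s t] s t by simp
  next
    case False
    then show ?thesis using *[of t s] s t by (simp add: norm_minus_commute)
  qed
qed

lemma adj_dev:
  assumes u: "ctrl u" and l: "adj u l" and q: "q \<in> {0..T}" and s: "s \<in> {0..T}"
  shows "norm (l s - l q) \<le> 4 * k * T * norm (l q)"
proof -
  have "norm (l s - l q) \<le> 4 * k * norm (l q) * \<bar>s - q\<bar>" by (rule adj_lipschitz[OF u l q q s])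
  also have "\<dots> \<le> 4 * k * norm (l q) * T" using k_ge q s by (intro mult_left_mono) auto
  finally show ?thesis by (simp add: mult_ac)
qed

definition \<sigma> :: "(real \<Rightarrow> real ^ 'm) \<Rightarrow> (real \<Rightarrow> 'a) \<Rightarrow> 'm \<Rightarrow> real \<Rightarrow> real" where
  "\<sigma> u l i r = l r \<bullet> G i (X u r)"

lemma continuous_\<sigma>:
  assumes "ctrl u" "adj u l" shows "continuous_on {0..T} (\<sigma> u l i)"
proof -
  have "continuous_on {0..T} l" using assms(2) by (simp add: adj_def)
  moreover have "continuous_on {0..T} (\<lambda>r. G i (X u r))"
    by (rule continuous_on_compose2[OF continuous_G[of UNIV] continuous_X[OF assms(1)]]) auto
  ultimately show ?thesis unfolding \<sigma>_def by (intro continuous_intros)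
qed

lemma \<sigma>_measurable:
  assumes "ctrl u" "adj u l" shows "\<sigma> u l i \<in> borel_measurable (lebesgue_on {0..T})"
  using continuous_\<sigma>[OF assms] by (intro continuous_imp_measurable_on_sets_lebesgue) auto

lemma \<sigma>_bd:
  assumes "ctrl u" "adj u l" "q \<in> {0..T}" "r \<in> {0..T}"
  shows "\<bar>\<sigma> u l i r\<bar> \<le> 4 * k * norm (l q)"
proof -
  have "\<bar>\<sigma> u l i r\<bar> \<le> norm (l r) * norm (G i (X u r))" unfolding \<sigma>_def by (rule Cauchy_Schwarz_ineq2)
  also have "\<dots> \<le> (2 * norm (l q)) * (2 * k)"
    using adj_norm_le[OF assms] G_bd[OF X_norm_le(2)[OF assms(1,4)], of i] k_ge by (intro mult_mono) auto
  finally show ?thesis by (simp add: mult_ac)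
qed

subsection \<open>The second order estimate along an adjoint arc\<close>

text \<open>Integration by parts applied to \<open>l\<close> and the difference \<open>z\<close> of
  the trajectories. The remainder of \<open>f\<close> is quadratic in \<open>z\<close> and gains
  \<open>T\<close> by integration over time; the mixed term, control difference times change of
  \<open>G\<close>, gains \<open>T\<close> from \<open>G_lip\<close>. With \<open>z\<close> bounded
  by \<open>4 * k * U \<tau> w u\<close> this yields 96 = 2 (16 + 32).\<close>

lemma pairing_estimate:
  assumes u: "ctrl u" and w: "ctrl w" and l: "adj u l" and \<tau>: "\<tau> \<in> {0..T}"
  shows "\<bar>l \<tau> \<bullet> (X w \<tau> - X u \<tau>) - integral {0..\<tau>} (\<lambda>r. \<Sum>i\<in>UNIV. (w r $ i - u r $ i) * \<sigma> u l i r)\<bar>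
     \<le> 96 * k ^ 3 * T * norm (l \<tau>) * (U \<tau> w u)\<^sup>2"
proof -
  define z where "z r = X w r - X u r" for r
  define Z where "Z = 4 * k * U \<tau> w u"
  define \<Delta> where "\<Delta> r = (\<Sum>i\<in>UNIV. \<bar>w r $ i - u r $ i\<bar>)" for r
  define \<alpha> where "\<alpha> r = - adjoint (Df (X u r) (u r)) (l r)" for r
  define \<beta> where "\<beta> r = f (X w r) (w r) - f (X u r) (u r)" for r
  define S where "S r = (\<Sum>i\<in>UNIV. (w r $ i - u r $ i) * \<sigma> u l i r)" for r
  have U0: "0 \<le> U \<tau> w u" using U_nonneg[OF w u] \<tau> by simp
  have zZ: "norm (z r) \<le> Z" if "r \<in> {0..\<tau>}" for r
    unfolding z_def Z_def using X_diff[OF w u _ that] \<tau> by simp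
  have \<tau>T: "\<tau> \<le> T" using \<tau> by simp
  have cl: "continuous_on {0..T} l" using l by (simp add: adj_def)
  have "((\<lambda>r. \<alpha> r \<bullet> z r + l r \<bullet> \<beta> r) has_integral (l \<tau> \<bullet> z \<tau> - l 0 \<bullet> z 0)) {0..\<tau>}"
  proof (rule has_integral_inner_product_rule[where C="4 * k + 4 * k * norm (l \<tau>)", OF \<tau>])
    show "(\<alpha> has_integral l t - l s) {s..t}" if "0 \<le> s" "s \<le> t" "t \<le> T" for s t
      unfolding \<alpha>_def by (rule adj_has_integral[OF l that])
    show "(\<beta> has_integral z t - z s) {s..t}" if "0 \<le> s" "s \<le> t" "t \<le> T" for s t
      using has_integral_diff[OF traj_has_integral[OF traj_X[OF w] that] traj_has_integral[OF traj_X[OF u] that]]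
      unfolding \<beta>_def z_def by (simp add: algebra_simps)
    show "\<alpha> \<in> borel_measurable (lebesgue_on {0..T})"
      unfolding \<alpha>_def by (intro borel_measurable_uminus adjoint_measurable u cl)
    show "\<beta> \<in> borel_measurable (lebesgue_on {0..T})"
      unfolding \<beta>_def by (intro borel_measurable_diff f_measurable u w continuous_X)
    fix t assume t: "t \<in> {0..T}"
    have "norm (\<alpha> t) \<le> 4 * k * norm (l \<tau>)" unfolding \<alpha>_def using adjoint_term_bd[OF u l \<tau> t] by simp
    then show "norm (\<alpha> t) \<le> 4 * k + 4 * k * norm (l \<tau>)" using k_ge by simp
    have "norm (\<beta> t) \<le> 2 * k + 2 * k"
      unfolding \<beta>_def
      by (rule order_trans[OF norm_triangle_ineq4 add_mono])
        (intro f_bd ctrlD(2)[OF w t] ctrlD(2)[OF u t] X_norm_le(2)[OF w t] X_norm_le(2)[OF u t])+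
    moreover have "0 \<le> 4 * k * norm (l \<tau>)" using k_ge by (intro mult_nonneg_nonneg) auto
    ultimately show "norm (\<beta> t) \<le> 4 * k + 4 * k * norm (l \<tau>)" by simp
  qed
  moreover have "z 0 = 0"
    unfolding z_def using traj_0[OF traj_X[OF w]] traj_0[OF traj_X[OF u]] T by simp
  ultimately have h1: "((\<lambda>r. \<alpha> r \<bullet> z r + l r \<bullet> \<beta> r) has_integral (l \<tau> \<bullet> z \<tau>)) {0..\<tau>}" by simp
  have Sm: "S \<in> borel_measurable (lebesgue_on {0..T})"
  proof -
    note [measurable] = ctrlD(1)[OF u] ctrlD(1)[OF w] \<sigma>_measurable[OF u l]
    show ?thesis unfolding S_def by measurable
  qed
  have Sb: "norm (S r) \<le> 4 * k * norm (l \<tau>) * (2 * m)" if r: "r \<in> {0..T}" for r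
  proof -
    have "norm (S r) \<le> (\<Sum>i\<in>UNIV. \<bar>w r $ i - u r $ i\<bar> * (4 * k * norm (l \<tau>)))"
      unfolding S_def by (rule sum_norm_le)
        (use \<sigma>_bd[OF u l \<tau> r] in \<open>auto simp: abs_mult intro!: mult_left_mono\<close>)
    also have "\<dots> = 4 * k * norm (l \<tau>) * (\<Sum>i\<in>UNIV. \<bar>w r $ i - u r $ i\<bar>)"
      unfolding sum_distrib_right[symmetric] by (rule mult.commute)
    also have "\<dots> \<le> 4 * k * norm (l \<tau>) * (2 * m)"
      using k_ge ctrl_diff_le[OF w u r] by (intro mult_left_mono) auto
    finally show ?thesis .
  qed
  have Si: "S integrable_on {0..\<tau>}"
    by (rule bounded_measurable_integrable[OF Sm Sb order_refl \<tau>T])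
  have \<Delta>i: "(\<Delta> has_integral U \<tau> w u) {0..\<tau>}"
    unfolding U_def \<Delta>_def by (intro integrable_integral ctrl_diff_integrable[OF w u] order_refl \<tau>T)
  have h2: "((\<lambda>r. \<alpha> r \<bullet> z r + l r \<bullet> \<beta> r - S r) has_integral (l \<tau> \<bullet> z \<tau> - integral {0..\<tau>} S)) {0..\<tau>}"
    by (rule has_integral_diff[OF h1 integrable_integral[OF Si]])
  define E where "E r = 2 * norm (l \<tau>) * (k * Z\<^sup>2 + 8 * k\<^sup>2 * T * Z * \<Delta> r)" for r
  have Ei: "(E has_integral 2 * norm (l \<tau>) * (k * Z\<^sup>2 * \<tau> + 8 * k\<^sup>2 * T * Z * U \<tau> w u)) {0..\<tau>}"
    unfolding E_def using has_integral_const_real[of "k * Z\<^sup>2" 0 \<tau>] \<tau>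
    by (intro has_integral_mult_right has_integral_add \<Delta>i) (auto simp: mult_ac)
  have "norm (integral {0..\<tau>} (\<lambda>r. \<alpha> r \<bullet> z r + l r \<bullet> \<beta> r - S r)) \<le> integral {0..\<tau>} E"
  proof (rule integral_norm_bound_integral[OF has_integral_integrable[OF h2] has_integral_integrable[OF Ei]])
    fix r assume r: "r \<in> {0..\<tau>}"
    then have rT: "r \<in> {0..T}" using \<tau> by auto
    note bu = ctrlD(2)[OF u rT]
    have Xr: "norm (X v r) \<le> 2 * k * T" if v: "ctrl v" for v
    proof -
      have "2 * k * r \<le> 2 * k * T" using rT k_ge by (intro mult_left_mono) auto
      then show ?thesis using X_norm_le(1)[OF v rT] by linarith
    qed
    define R1 where "R1 = f (X w r) (u r) - f (X u r) (u r) - Df (X u r) (u r) (X w r - X u r)"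
    define R2 where "R2 = (\<Sum>i\<in>UNIV. (w r $ i - u r $ i) *\<^sub>R (G i (X w r) - G i (X u r)))"
    have a: "\<alpha> r \<bullet> z r = - (l r \<bullet> Df (X u r) (u r) (z r))"
      unfolding \<alpha>_def using adjoint_works[OF linear_Df, of "z r" "X u r" "u r" "l r"] by (simp add: inner_commute)
    have b: "\<beta> r = (f (X w r) (u r) - f (X u r) (u r)) + (\<Sum>i\<in>UNIV. (w r $ i - u r $ i) *\<^sub>R G i (X w r))"
      unfolding \<beta>_def f_ctrl_diff[symmetric] by simp
    have s: "S r = l r \<bullet> (\<Sum>i\<in>UNIV. (w r $ i - u r $ i) *\<^sub>R G i (X u r))"
      unfolding S_def \<sigma>_def by (simp add: inner_sum_right)
    \<comment> \<open>The adjoint equation cancels the part of \<open>\<beta>\<close> linear in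
      \<open>z\<close>, and \<open>S\<close> the control difference acting along \<open>X u\<close>;
      only second order terms survive.\<close>
    have e: "\<alpha> r \<bullet> z r + l r \<bullet> \<beta> r - S r = l r \<bullet> (R1 + R2)"
      unfolding a b s R1_def R2_def z_def[symmetric]
      by (simp add: inner_add_right inner_diff_right scaleR_diff_right sum_subtractf)
    have "norm R1 \<le> k * (norm (z r))\<^sup>2" unfolding R1_def z_def by (rule f_rem[OF bu])
    also have "\<dots> \<le> k * Z\<^sup>2" using k_ge zZ[OF r] by (intro mult_left_mono power_mono) auto
    finally have R1: "norm R1 \<le> k * Z\<^sup>2" .
    have "norm R2 \<le> (8 * k\<^sup>2 * T * Z) * \<Delta> r"
      unfolding R2_def \<Delta>_def
    proof (rule norm_ctrl_sum_le)
      fix i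
      have "norm (G i (X w r) - G i (X u r)) \<le> 2 * K * (norm (X u r) + norm (X w r)) * norm (X w r - X u r)"
        by (rule G_lip)
      also have "\<dots> \<le> (2 * k) * (2 * k * T + 2 * k * T) * Z"
        using Xr[OF u] Xr[OF w] zZ[OF r] k_ge K T unfolding z_def
        by (intro mult_mono add_mono) auto
      finally show "norm (G i (X w r) - G i (X u r)) \<le> 8 * k\<^sup>2 * T * Z"
        by (simp add: power2_eq_square algebra_simps)
    qed
    with R1 have R: "norm (R1 + R2) \<le> k * Z\<^sup>2 + 8 * k\<^sup>2 * T * Z * \<Delta> r" by (rule norm_triangle_mono)
    have "\<bar>l r \<bullet> (R1 + R2)\<bar> \<le> norm (l r) * norm (R1 + R2)" by (rule Cauchy_Schwarz_ineq2)
    also have "\<dots> \<le> (2 * norm (l \<tau>)) * (k * Z\<^sup>2 + 8 * k\<^sup>2 * T * Z * \<Delta> r)"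
      using adj_norm_le[OF u l \<tau> rT] R by (intro mult_mono) auto
    finally show "norm (\<alpha> r \<bullet> z r + l r \<bullet> \<beta> r - S r) \<le> E r"
      unfolding e E_def real_norm_def .
  qed
  then have "\<bar>l \<tau> \<bullet> z \<tau> - integral {0..\<tau>} S\<bar> \<le> 2 * norm (l \<tau>) * (k * Z\<^sup>2 * \<tau> + 8 * k\<^sup>2 * T * Z * U \<tau> w u)"
    unfolding integral_unique[OF h2] integral_unique[OF Ei] real_norm_def .
  also have "\<dots> \<le> 2 * norm (l \<tau>) * (k * Z\<^sup>2 * T + 8 * k\<^sup>2 * T * Z * U \<tau> w u)"
    using \<tau>T k_ge by (intro mult_left_mono add_right_mono) auto
  also have "\<dots> = 96 * k ^ 3 * T * norm (l \<tau>) * (U \<tau> w u)\<^sup>2"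
    unfolding Z_def by (simp add: power2_eq_square power3_eq_cube algebra_simps)
  finally show ?thesis unfolding S_def z_def .
qed

subsection \<open>The switching functions\<close>

lemma \<sigma>_dev:
  assumes u: "ctrl u" and l: "adj u l" and q: "q \<in> {0..T}" and s: "s \<in> {0..T}"
  shows "\<bar>\<sigma> u l i s - l q \<bullet> G i 0\<bar> \<le> 10 * k\<^sup>2 * T * norm (l q)"
proof -
  have Xs: "norm (X u s) \<le> 2 * k * T"
  proof -
    have "2 * k * s \<le> 2 * k * T" using s k_ge by (intro mult_left_mono) auto
    then show ?thesis using X_norm_le(1)[OF u s] by linarith
  qed
  have Gd: "norm (G i (X u s) - G i 0) \<le> k * (2 * k * T)"
  proof -
    have "norm (G i (X u s) - G i 0) \<le> K * norm (X u s)"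
      using order_trans[OF G_dev mult_left_mono[OF norm_sq_le[OF X_norm_le(2)[OF u s]]]] K by simp
    also have "\<dots> \<le> k * (2 * k * T)" using Xs k_ge by (intro mult_mono) auto
    finally show ?thesis .
  qed
  have "\<sigma> u l i s - l q \<bullet> G i 0 = (l s - l q) \<bullet> G i (X u s) + l q \<bullet> (G i (X u s) - G i 0)"
    unfolding \<sigma>_def by (simp add: inner_diff_left inner_diff_right)
  also have "\<bar>\<dots>\<bar> \<le> (4 * k * T * norm (l q)) * (2 * k) + norm (l q) * (k * (2 * k * T))"
  proof (rule order_trans[OF abs_triangle_ineq add_mono])
    show "\<bar>(l s - l q) \<bullet> G i (X u s)\<bar> \<le> (4 * k * T * norm (l q)) * (2 * k)"
      by (rule order_trans[OF Cauchy_Schwarz_ineq2 mult_mono[OF adj_dev[OF u l q s]]])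
        (use G_bd[OF X_norm_le(2)[OF u s], of i] k_ge T in auto)
    show "\<bar>l q \<bullet> (G i (X u s) - G i 0)\<bar> \<le> norm (l q) * (k * (2 * k * T))"
      by (rule order_trans[OF Cauchy_Schwarz_ineq2 mult_left_mono[OF Gd]]) simp
  qed
  finally show ?thesis by (simp add: power2_eq_square algebra_simps)
qed

text \<open>Whatever the control, the slope is \<open>- (l q \<bullet> DF 0 (G i 0))\<close> up to
  O(T |l q|), because the control enters it only through terms that vanish at the origin. Increments
  are used since the slope itself is merely measurable.\<close>

lemma \<sigma>_increment:
  assumes u: "ctrl u" and l: "adj u l" and q: "q \<in> {0..T}" and st: "0 \<le> s" "s \<le> t" "t \<le> T"
  shows "\<bar>\<sigma> u l i t - \<sigma> u l i s + (t - s) * (l q \<bullet> DF 0 (G i 0))\<bar> \<le> 64 * k ^ 3 * T * norm (l q) * (t - s)"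
proof -
  have s: "s \<in> {0..T}" and t: "t \<in> {0..T}" using st by auto
  have XT: "norm (X u r) \<le> 2 * k * T" if r: "r \<in> {0..T}" for r
  proof -
    have "2 * k * r \<le> 2 * k * T" using r k_ge by (intro mult_left_mono) auto
    then show ?thesis using X_norm_le(1)[OF u r] by linarith
  qed
  \<comment> \<open>Freezing the field at time \<open>t\<close> splits the increment into the change
    of \<open>l\<close> against a fixed vector, given by the adjoint equation, and the change of the
    field along the trajectory, given by \<open>G_lip\<close>.\<close>
  define g where "g = G i (X u t)"
  have gb: "norm g \<le> 2 * k"
    unfolding g_def using G_bd[OF X_norm_le(2)[OF u t], of i] k_ge by linarith
  have Gd: "norm (g - G i 0) \<le> k * (2 * k * T)"
  proof -
    have "norm (g - G i 0) \<le> K * norm (X u t)"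
      unfolding g_def using order_trans[OF G_dev mult_left_mono[OF norm_sq_le[OF X_norm_le(2)[OF u t]]]] K by simp
    also have "\<dots> \<le> k * (2 * k * T)" using XT[OF t] k_ge by (intro mult_mono) auto
    finally show ?thesis .
  qed
  have "(((\<lambda>x. x \<bullet> g) \<circ> (\<lambda>r. - adjoint (Df (X u r) (u r)) (l r))) has_integral (l t - l s) \<bullet> g) {s..t}"
    by (rule has_integral_linear[OF adj_has_integral[OF l st] bounded_linear_inner_left])
  from has_integral_add[OF this has_integral_const_real[of "l q \<bullet> DF 0 (G i 0)" s t]]
  have "((\<lambda>r. - (l r \<bullet> Df (X u r) (u r) g) + l q \<bullet> DF 0 (G i 0)) has_integral
      (l t - l s) \<bullet> g + (t - s) * (l q \<bullet> DF 0 (G i 0))) {s..t}"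
    using st(2) by (simp add: o_def adjoint_clauses[OF linear_Df])
  then have "norm ((l t - l s) \<bullet> g + (t - s) * (l q \<bullet> DF 0 (G i 0))) \<le> (22 * k ^ 3 * T * norm (l q)) * (t - s)"
  proof (rule has_integral_norm_bound_const[OF _ st(2)])
    fix r assume "r \<in> {s..t}"
    then have r: "r \<in> {0..T}" using st by auto
    note bu = ctrlD(2)[OF u r]
    have e: "- (l r \<bullet> Df (X u r) (u r) g) + l q \<bullet> DF 0 (G i 0)
      = - ((l r - l q) \<bullet> Df (X u r) (u r) g) - l q \<bullet> (Df (X u r) (u r) g - DF 0 g) - l q \<bullet> DF 0 (g - G i 0)"
      by (simp add: inner_diff_left inner_diff_right linear_diff[OF linF])
    have 1: "\<bar>(l r - l q) \<bullet> Df (X u r) (u r) g\<bar> \<le> (4 * k * T * norm (l q)) * (2 * k * (2 * k))"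
    proof (rule order_trans[OF Cauchy_Schwarz_ineq2 mult_mono[OF adj_dev[OF u l q r]]])
      show "norm (Df (X u r) (u r) g) \<le> 2 * k * (2 * k)"
        by (rule order_trans[OF Df_bd[OF bu X_norm_le(2)[OF u r]] mult_left_mono[OF gb]]) (use k_ge in auto)
    qed (use k_ge T in auto)
    have 2: "\<bar>l q \<bullet> (Df (X u r) (u r) g - DF 0 g)\<bar> \<le> norm (l q) * (k * (2 * k * T) * (2 * k))"
    proof (rule order_trans[OF Cauchy_Schwarz_ineq2 mult_left_mono])
      have "k * norm (X u r) * norm g \<le> k * (2 * k * T) * (2 * k)"
        using XT[OF r] gb k_ge T by (intro mult_mono mult_left_mono mult_nonneg_nonneg) auto
      then show "norm (Df (X u r) (u r) g - DF 0 g) \<le> k * (2 * k * T) * (2 * k)"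
        using Df_dev[OF bu, of "X u r" g] by linarith
    qed simp
    have 3: "\<bar>l q \<bullet> DF 0 (g - G i 0)\<bar> \<le> norm (l q) * (k * (k * (2 * k * T)))"
    proof (rule order_trans[OF Cauchy_Schwarz_ineq2 mult_left_mono])
      have "K * norm (g - G i 0) \<le> k * (k * (2 * k * T))"
        using Gd k_ge K by (intro mult_mono) auto
      then show "norm (DF 0 (g - G i 0)) \<le> k * (k * (2 * k * T))"
        using DF0[of "g - G i 0"] by linarith
    qed simp
    have "(4 * k * T * norm (l q)) * (2 * k * (2 * k)) + norm (l q) * (k * (2 * k * T) * (2 * k))
        + norm (l q) * (k * (k * (2 * k * T))) = 22 * k ^ 3 * T * norm (l q)"
      by (simp add: power3_eq_cube)
    then show "norm (- (l r \<bullet> Df (X u r) (u r) g) + l q \<bullet> DF 0 (G i 0)) \<le> 22 * k ^ 3 * T * norm (l q)"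
      unfolding e real_norm_def using 1 2 3 by linarith
  qed
  then have 1: "\<bar>(l t - l s) \<bullet> g + (t - s) * (l q \<bullet> DF 0 (G i 0))\<bar> \<le> 22 * k ^ 3 * T * norm (l q) * (t - s)"
    by simp
  have 2: "\<bar>l s \<bullet> (g - G i (X u s))\<bar> \<le> (2 * norm (l q)) * (16 * k ^ 3 * T * (t - s))"
  proof (rule order_trans[OF Cauchy_Schwarz_ineq2 mult_mono[OF adj_norm_le[OF u l q s]]])
    have "norm (g - G i (X u s)) \<le> 2 * K * (norm (X u s) + norm (X u t)) * norm (X u t - X u s)"
      unfolding g_def by (rule G_lip)
    also have "\<dots> \<le> 2 * k * (2 * k * T + 2 * k * T) * (2 * k * (t - s))"
      using XT[OF s] XT[OF t] X_lipschitz[OF u s t] k_ge T st K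
      by (intro mult_mono mult_left_mono add_mono mult_nonneg_nonneg add_nonneg_nonneg) auto
    also have "\<dots> = 16 * k ^ 3 * T * (t - s)" by (simp add: power3_eq_cube algebra_simps)
    finally show "norm (g - G i (X u s)) \<le> 16 * k ^ 3 * T * (t - s)" .
  qed auto
  have e: "\<sigma> u l i t - \<sigma> u l i s = (l t - l s) \<bullet> g + l s \<bullet> (g - G i (X u s))"
    unfolding \<sigma>_def g_def by (simp add: inner_diff_left inner_diff_right)
  have "\<bar>\<sigma> u l i t - \<sigma> u l i s + (t - s) * (l q \<bullet> DF 0 (G i 0))\<bar>
      \<le> 22 * k ^ 3 * T * norm (l q) * (t - s) + (2 * norm (l q)) * (16 * k ^ 3 * T * (t - s))"
    unfolding e using 1 2 by linarith
  also have "\<dots> \<le> 64 * k ^ 3 * T * norm (l q) * (t - s)"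
    using k_ge T st by (simp add: algebra_simps mult_left_mono mult_right_mono)
  finally show ?thesis .
qed

lemma small_bounds: "64 * k ^ 3 * T \<le> c / 4" "10 * k\<^sup>2 * T \<le> c / 4" "96 * k ^ 3 * T \<le> c / (512 * m)"
proof -
  have m: "1 \<le> m" unfolding m_def by (simp add: Suc_leI)
  have k3: "k ^ 3 \<le> k ^ 4" "k\<^sup>2 \<le> k ^ 4" using k_ge by (auto intro: power_increasing)
  have "256 * k ^ 3 * T \<le> 100000 * k ^ 4 * T" using k3 T k_ge by (intro mult_right_mono mult_mono) auto
  then show "64 * k ^ 3 * T \<le> c / 4" using small by linarith
  have "40 * k\<^sup>2 * T \<le> 100000 * k ^ 4 * T" using k3 T k_ge by (intro mult_right_mono mult_mono) auto
  then show "10 * k\<^sup>2 * T \<le> c / 4" using small by linarith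
  have "(96 * 512) * (k ^ 3 * m) * T \<le> 100000 * (k ^ 3 * k) * T"
    using k_ge T m by (intro mult_right_mono mult_mono mult_left_mono mult_nonneg_nonneg) auto
  then have "(96 * k ^ 3 * T) * (512 * m) \<le> c" using small by (simp add: power4_eq_xxxx power3_eq_cube mult_ac)
  then show "96 * k ^ 3 * T \<le> c / (512 * m)" using m by (simp add: pos_le_divide_eq)
qed

text \<open>By \<open>nondegenerate\<close> the value or the slope at the origin is at least half of
  \<open>c * norm (l q)\<close>, and the errors of order \<open>T\<close> cost at most half of that.
  The direction of monotonicity is explicit because \<open>optimal_extension\<close> selects a
  control by it.\<close>

lemma \<sigma>_cases:
  assumes u: "ctrl u" and l: "adj u l" and q: "q \<in> {0..T}"
  shows "(\<forall>t\<in>{0..T}. c / 4 * norm (l q) \<le> \<bar>\<sigma> u l i t\<bar>) \<or>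
    (\<forall>s t. 0 \<le> s \<longrightarrow> s \<le> t \<longrightarrow> t \<le> T \<longrightarrow> c / 4 * norm (l q) * (t - s)
       \<le> (if 0 \<le> l q \<bullet> DF 0 (G i 0) then -1 else 1) * (\<sigma> u l i t - \<sigma> u l i s))"
proof -
  define n where "n = norm (l q)"
  consider "c / 2 * n \<le> \<bar>l q \<bullet> G i 0\<bar>" | "c / 2 * n \<le> \<bar>l q \<bullet> DF 0 (G i 0)\<bar>"
    using nondegenerate[of "l q" i] unfolding n_def by fastforce
  then show ?thesis
  proof cases
    case 1
    have "c / 4 * n \<le> \<bar>\<sigma> u l i t\<bar>" if "t \<in> {0..T}" for t
    proof -
      have "\<bar>\<sigma> u l i t - l q \<bullet> G i 0\<bar> \<le> 10 * k\<^sup>2 * T * n" unfolding n_def by (rule \<sigma>_dev[OF u l q that])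
      also have "\<dots> \<le> c / 4 * n" using small_bounds(2) by (intro mult_right_mono) (auto simp: n_def)
      finally show ?thesis using 1 by linarith
    qed
    then show ?thesis unfolding n_def by blast
  next
    case 2
    define p where "p = l q \<bullet> DF 0 (G i 0)"
    have *: "\<bar>\<sigma> u l i t - \<sigma> u l i s + (t - s) * p\<bar> \<le> c / 4 * n * (t - s)" if "0 \<le> s" "s \<le> t" "t \<le> T" for s t
    proof -
      have "\<bar>\<sigma> u l i t - \<sigma> u l i s + (t - s) * p\<bar> \<le> 64 * k ^ 3 * T * n * (t - s)"
        unfolding p_def n_def by (rule \<sigma>_increment[OF u l q that])
      also have "\<dots> \<le> c / 4 * n * (t - s)" using small_bounds(1) that by (intro mult_right_mono) (auto simp: n_def)
      finally show ?thesis .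
    qed
    define e :: real where "e = (if 0 \<le> p then -1 else 1)"
    have ep: "e * p = - \<bar>p\<bar>" "\<bar>e\<bar> = 1" unfolding e_def by auto
    have "c / 4 * n * (t - s) \<le> e * (\<sigma> u l i t - \<sigma> u l i s)" if st: "0 \<le> s" "s \<le> t" "t \<le> T" for s t
    proof -
      have "\<bar>e * (\<sigma> u l i t - \<sigma> u l i s + (t - s) * p)\<bar> \<le> c / 4 * n * (t - s)"
        using *[OF st] by (simp add: abs_mult ep)
      moreover have "e * (\<sigma> u l i t - \<sigma> u l i s + (t - s) * p) = e * (\<sigma> u l i t - \<sigma> u l i s) - (t - s) * \<bar>p\<bar>"
        using ep(1) by (simp add: distrib_left mult.left_commute[of e "t - s"])
      moreover have "(t - s) * (c / 2 * n) \<le> (t - s) * \<bar>p\<bar>"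
        using 2 st by (intro mult_left_mono) (auto simp: p_def)
      moreover have "c / 4 * n * (t - s) + c / 4 * n * (t - s) = (t - s) * (c / 2 * n)" by simp
      ultimately show ?thesis by linarith
    qed
    then show ?thesis unfolding n_def e_def p_def by blast
  qed
qed

text \<open>For a switching function bounded away from zero the estimate is linear in the mass of
  \<open>w\<close>, and becomes quadratic since this mass is at most 2. For a monotone one it
  reduces to \<open>integral_weighted_distance_ge\<close>; the factors 1/8 and 1/16 give
  128.\<close>

lemma switching_estimate:
  assumes u: "ctrl u" and l: "adj u l" and \<tau>: "\<tau> \<in> {0..T}"
    and w: "w \<in> borel_measurable (lebesgue_on {0..T})" and wb: "\<And>t. t \<in> {0..T} \<Longrightarrow> 0 \<le> w t \<and> w t \<le> 2"
  shows "c / 128 * norm (l \<tau>) * (integral {0..\<tau>} w)\<^sup>2 \<le> integral {0..\<tau>} (\<lambda>t. \<bar>\<sigma> u l i t\<bar> * w t)"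
proof -
  define n where "n = norm (l \<tau>)"
  have n: "0 \<le> n" "0 \<le> c * n" using c by (auto simp: n_def)
  define W where "W = integral {0..\<tau>} w"
  have sub: "{0..\<tau>} \<subseteq> {0..T}" using \<tau> by auto
  have wi: "w integrable_on {0..\<tau>}"
    by (rule bounded_measurable_integrable[OF w, of 2]) (use wb \<tau> in auto)
  have W0: "0 \<le> W" unfolding W_def using wb sub by (intro integral_nonneg wi) auto
  have W2: "W \<le> 2 * \<tau>"
    unfolding W_def using has_integral_le[OF integrable_integral[OF wi] has_integral_const_real[of 2 0 \<tau>]] wb \<tau> by auto
  note [measurable] = w \<sigma>_measurable[OF u l]
  have pm: "(\<lambda>t. \<bar>\<sigma> u l i t\<bar> * w t) \<in> borel_measurable (lebesgue_on {0..T})" by measurable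
  have pi: "(\<lambda>t. \<bar>\<sigma> u l i t\<bar> * w t) integrable_on {0..\<tau>}"
  proof (rule bounded_measurable_integrable[OF pm])
    show "norm (\<bar>\<sigma> u l i t\<bar> * w t) \<le> (4 * k * norm (l \<tau>)) * 2" if "t \<in> {0..T}" for t
      unfolding real_norm_def abs_mult using \<sigma>_bd[OF u l \<tau> that] wb[OF that] k_ge by (intro mult_mono) auto
  qed (use \<tau> in auto)
  from \<sigma>_cases[OF u l \<tau>, of i] show ?thesis
  proof
    assume *: "\<forall>t\<in>{0..T}. c / 4 * norm (l \<tau>) \<le> \<bar>\<sigma> u l i t\<bar>"
    have "integral {0..\<tau>} (\<lambda>t. c / 4 * n * w t) \<le> integral {0..\<tau>} (\<lambda>t. \<bar>\<sigma> u l i t\<bar> * w t)"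
    proof (rule integral_le[OF integrable_on_mult_right[OF wi] pi])
      show "c / 4 * n * w t \<le> \<bar>\<sigma> u l i t\<bar> * w t" if "t \<in> {0..\<tau>}" for t
        using that sub wb * by (intro mult_right_mono) (auto simp: n_def)
    qed
    then have "c / 4 * n * W \<le> integral {0..\<tau>} (\<lambda>t. \<bar>\<sigma> u l i t\<bar> * w t)" by (simp add: W_def)
    moreover have "c / 128 * n * W\<^sup>2 \<le> c / 4 * n * W"
    proof -
      have "W * W \<le> 2 * W" using W0 W2 T \<tau> by (intro mult_right_mono) auto
      then have "(c * n / 128) * (W * W) \<le> (c * n / 128) * (2 * W)" using n by (intro mult_left_mono) auto
      also have "\<dots> \<le> (c * n / 4) * W" using mult_nonneg_nonneg[OF n(2) W0] by (simp add: mult_ac)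
      finally show ?thesis by (simp add: power2_eq_square)
    qed
    ultimately show ?thesis unfolding n_def W_def by linarith
  next
    define e :: real where "e = (if 0 \<le> l \<tau> \<bullet> DF 0 (G i 0) then -1 else 1)"
    assume "\<forall>s t. 0 \<le> s \<longrightarrow> s \<le> t \<longrightarrow> t \<le> T \<longrightarrow> c / 4 * norm (l \<tau>) * (t - s)
       \<le> (if 0 \<le> l \<tau> \<bullet> DF 0 (G i 0) then -1 else 1) * (\<sigma> u l i t - \<sigma> u l i s)"
    then have inc: "\<forall>s t. 0 \<le> s \<longrightarrow> s \<le> t \<longrightarrow> t \<le> T \<longrightarrow> c / 4 * norm (l \<tau>) * (t - s) \<le> e * (\<sigma> u l i t - \<sigma> u l i s)"
      unfolding e_def .
    have inc': "c / 4 * n * \<bar>t - s\<bar> \<le> \<bar>\<sigma> u l i t - \<sigma> u l i s\<bar>" if "s \<in> {0..T}" "t \<in> {0..T}" for s t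
    proof -
      have "c / 4 * n * (b - a) \<le> \<bar>\<sigma> u l i b - \<sigma> u l i a\<bar>" if "0 \<le> a" "a \<le> b" "b \<le> T" for a b
      proof -
        have "e * (\<sigma> u l i b - \<sigma> u l i a) \<le> \<bar>\<sigma> u l i b - \<sigma> u l i a\<bar>" by (auto simp: e_def)
        then show ?thesis using inc[rule_format, OF that] unfolding n_def by linarith
      qed
      from this[of s t] this[of t s] that show ?thesis
        by (cases "s \<le> t") (auto simp: abs_minus_commute)
    qed
    have "continuous_on {0..\<tau>} (\<lambda>t. \<bar>\<sigma> u l i t\<bar>)"
      using continuous_on_subset[OF continuous_\<sigma>[OF u l] sub] by (intro continuous_intros)
    \<comment> \<open>A minimiser \<open>s\<close> of the absolute value replaces a zero: the
      increment from \<open>s\<close> to \<open>t\<close> is at most twice the absolute value at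
      \<open>t\<close>, so growth away from \<open>s\<close> follows whether or not the sign
      changes.\<close>
    from continuous_attains_inf[OF compact_Icc _ this] \<tau>
    obtain s where s: "s \<in> {0..\<tau>}" and min: "\<And>t. t \<in> {0..\<tau>} \<Longrightarrow> \<bar>\<sigma> u l i s\<bar> \<le> \<bar>\<sigma> u l i t\<bar>" by auto
    have low: "c / 8 * n * \<bar>t - s\<bar> \<le> \<bar>\<sigma> u l i t\<bar>" if "t \<in> {0..\<tau>}" for t
    proof -
      have "c / 4 * n * \<bar>t - s\<bar> \<le> \<bar>\<sigma> u l i t - \<sigma> u l i s\<bar>" using inc' that s sub by blast
      then show ?thesis using min[OF that] by linarith
    qed
    have dm: "(\<lambda>t. \<bar>t - s\<bar> * w t) \<in> borel_measurable (lebesgue_on {0..T})"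
      by (intro borel_measurable_times w continuous_imp_measurable_on_sets_lebesgue continuous_intros) auto
    have di: "(\<lambda>t. \<bar>t - s\<bar> * w t) integrable_on {0..\<tau>}"
    proof (rule bounded_measurable_integrable[OF dm])
      show "norm (\<bar>t - s\<bar> * w t) \<le> T * 2" if "t \<in> {0..T}" for t
        unfolding real_norm_def abs_mult using that s sub wb[OF that] by (intro mult_mono) auto
    qed (use \<tau> in auto)
    have "(c / 8 * n) * (W\<^sup>2 / 16) \<le> (c / 8 * n) * integral {0..\<tau>} (\<lambda>t. \<bar>t - s\<bar> * w t)"
      unfolding W_def using integral_weighted_distance_ge[OF \<tau> w, of s] wb sub n
      by (intro mult_left_mono) auto
    also have "\<dots> = integral {0..\<tau>} (\<lambda>t. (c / 8 * n) * (\<bar>t - s\<bar> * w t))" by simp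
    also have "\<dots> \<le> integral {0..\<tau>} (\<lambda>t. \<bar>\<sigma> u l i t\<bar> * w t)"
    proof (rule integral_le[OF integrable_on_mult_right[OF di] pi])
      show "c / 8 * n * (\<bar>t - s\<bar> * w t) \<le> \<bar>\<sigma> u l i t\<bar> * w t" if "t \<in> {0..\<tau>}" for t
        unfolding mult.assoc[symmetric] using low[OF that] wb that sub by (intro mult_right_mono) auto
    qed
    finally show ?thesis unfolding n_def W_def by simp
  qed
qed

subsection \<open>The defect in the maximum condition\<close>

text \<open>A maximiser of \<open>l r \<bullet> f (X u r) w\<close> over the cube. At zeros of a
  switching function the value is a convention, but it stays at a vertex: every component has
  absolute value 1 everywhere.\<close>

definition bang :: "(real \<Rightarrow> real ^ 'm) \<Rightarrow> (real \<Rightarrow> 'a) \<Rightarrow> real \<Rightarrow> real ^ 'm" where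
  "bang u l r = (\<chi> i. if 0 \<le> \<sigma> u l i r then 1 else - 1)"

lemma ctrl_bang:
  assumes "ctrl u" "adj u l" shows "ctrl (bang u l)"
proof -
  note [measurable] = \<sigma>_measurable[OF assms]
  show ?thesis unfolding ctrl_def boxed_def bang_def by simp
qed

lemma \<sigma>_bang:
  assumes "\<bar>x\<bar> \<le> 1" shows "\<bar>\<sigma> u l i r\<bar> * \<bar>bang u l r $ i - x\<bar> = \<bar>\<sigma> u l i r\<bar> - \<sigma> u l i r * x"
  using assms by (simp add: bang_def algebra_simps)

text \<open>By \<open>\<sigma>_bang\<close> this integrates, for values in the cube, the loss of
  \<open>w\<close> against the maximising control; it is zero when \<open>w\<close> satisfies the
  maximum condition. The switching functions are those of \<open>u\<close> even when
  \<open>w\<close> is another control.\<close>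

definition defect :: "(real \<Rightarrow> real ^ 'm) \<Rightarrow> (real \<Rightarrow> 'a) \<Rightarrow> real \<Rightarrow> (real \<Rightarrow> real ^ 'm) \<Rightarrow> real" where
  "defect u l \<tau> w = (\<Sum>i\<in>UNIV. integral {0..\<tau>} (\<lambda>r. \<bar>\<sigma> u l i r\<bar> * \<bar>bang u l r $ i - w r $ i\<bar>))"

lemma defect_integrand:
  assumes u: "ctrl u" and l: "adj u l" and w: "ctrl w"
  shows "(\<lambda>r. \<bar>bang u l r $ i - w r $ i\<bar>) \<in> borel_measurable (lebesgue_on {0..T})"
    "\<And>r. r \<in> {0..T} \<Longrightarrow> \<bar>bang u l r $ i - w r $ i\<bar> \<le> 2"
    "0 \<le> s \<Longrightarrow> t \<le> T \<Longrightarrow> (\<lambda>r. \<bar>\<sigma> u l i r\<bar> * \<bar>bang u l r $ i - w r $ i\<bar>) integrable_on {s..t}"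
proof -
  note [measurable] = \<sigma>_measurable[OF u l] ctrlD(1)[OF w] ctrlD(1)[OF ctrl_bang[OF u l]]
  show "(\<lambda>r. \<bar>bang u l r $ i - w r $ i\<bar>) \<in> borel_measurable (lebesgue_on {0..T})" by measurable
  show b: "\<bar>bang u l r $ i - w r $ i\<bar> \<le> 2" if "r \<in> {0..T}" for r
    using ctrlD(3)[OF w that, of i] ctrlD(3)[OF ctrl_bang[OF u l] that, of i] by linarith
  assume st: "0 \<le> s" "t \<le> T"
  show "(\<lambda>r. \<bar>\<sigma> u l i r\<bar> * \<bar>bang u l r $ i - w r $ i\<bar>) integrable_on {s..t}"
  proof (rule bounded_measurable_integrable[OF _ _ st])
    show "(\<lambda>r. \<bar>\<sigma> u l i r\<bar> * \<bar>bang u l r $ i - w r $ i\<bar>) \<in> borel_measurable (lebesgue_on {0..T})" by measurable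
    fix r assume r: "r \<in> {0..T}"
    have T0: "T \<in> {0..T}" using T by simp
    show "norm (\<bar>\<sigma> u l i r\<bar> * \<bar>bang u l r $ i - w r $ i\<bar>) \<le> (4 * k * norm (l T)) * 2"
      unfolding real_norm_def abs_mult abs_abs
      using \<sigma>_bd[OF u l T0 r] b[OF r] k_ge by (intro mult_mono) auto
  qed
qed

lemma defect_nonneg:
  assumes "ctrl u" "adj u l" "ctrl w" "\<tau> \<le> T" shows "0 \<le> defect u l \<tau> w"
  unfolding defect_def using assms by (intro sum_nonneg integral_nonneg defect_integrand(3)) auto

lemma defect_ge:
  assumes u: "ctrl u" and l: "adj u l" and w: "ctrl w" and \<tau>: "\<tau> \<in> {0..T}"
  shows "c / 128 * norm (l \<tau>) * (\<Sum>i\<in>UNIV. (integral {0..\<tau>} (\<lambda>r. \<bar>bang u l r $ i - w r $ i\<bar>))\<^sup>2) \<le> defect u l \<tau> w"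
  unfolding defect_def sum_distrib_left
  by (intro sum_mono switching_estimate[OF u l \<tau>])
    (use defect_integrand[OF u l w] in auto)

lemma U_triangle:
  assumes u: "ctrl u" and w: "ctrl w" and v: "ctrl v" and \<tau>: "\<tau> \<le> T"
  shows "U \<tau> w u \<le> (\<Sum>i\<in>UNIV. integral {0..\<tau>} (\<lambda>r. \<bar>v r $ i - w r $ i\<bar>) + integral {0..\<tau>} (\<lambda>r. \<bar>v r $ i - u r $ i\<bar>))"
proof -
  have i: "(\<lambda>r. \<bar>v r $ i - w r $ i\<bar>) integrable_on {0..\<tau>}" if "ctrl v" "ctrl w" for v w i
  proof (rule bounded_measurable_integrable[OF _ _ order_refl \<tau>])
    note [measurable] = ctrlD(1)[OF that(1)] ctrlD(1)[OF that(2)]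
    show "(\<lambda>r. \<bar>v r $ i - w r $ i\<bar>) \<in> borel_measurable (lebesgue_on {0..T})" by measurable
    show "norm \<bar>v r $ i - w r $ i\<bar> \<le> 2" if r: "r \<in> {0..T}" for r
      using ctrlD(3)[OF \<open>ctrl v\<close> r, of i] ctrlD(3)[OF \<open>ctrl w\<close> r, of i] by simp
  qed
  have "U \<tau> w u = (\<Sum>i\<in>UNIV. integral {0..\<tau>} (\<lambda>r. \<bar>w r $ i - u r $ i\<bar>))"
    unfolding U_def by (rule integral_sum) (use i[OF w u] in auto)
  also have "\<dots> \<le> (\<Sum>i\<in>UNIV. integral {0..\<tau>} (\<lambda>r. \<bar>v r $ i - w r $ i\<bar>) + integral {0..\<tau>} (\<lambda>r. \<bar>v r $ i - u r $ i\<bar>))"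
  proof (rule sum_mono)
    fix j
    have "integral {0..\<tau>} (\<lambda>r. \<bar>w r $ j - u r $ j\<bar>)
      \<le> integral {0..\<tau>} (\<lambda>r. \<bar>v r $ j - w r $ j\<bar> + \<bar>v r $ j - u r $ j\<bar>)"
      by (intro integral_le i integrable_add u v w) linarith
    also have "\<dots> = integral {0..\<tau>} (\<lambda>r. \<bar>v r $ j - w r $ j\<bar>) + integral {0..\<tau>} (\<lambda>r. \<bar>v r $ j - u r $ j\<bar>)"
      by (intro Henstock_Kurzweil_Integration.integral_add i u v w)
    finally show "integral {0..\<tau>} (\<lambda>r. \<bar>w r $ j - u r $ j\<bar>)
      \<le> integral {0..\<tau>} (\<lambda>r. \<bar>v r $ j - w r $ j\<bar>) + integral {0..\<tau>} (\<lambda>r. \<bar>v r $ j - u r $ j\<bar>)" .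
  qed
  finally show ?thesis .
qed

text \<open>The triangle inequality through \<open>bang u l\<close> bounds the distance of
  \<open>w\<close> and \<open>u\<close> by two distances whose squares the defects dominate.
  Squaring costs 2 for each pair and \<open>m\<close> for the sum over the inputs.\<close>

lemma U_sq_le_defects:
  assumes u: "ctrl u" and l: "adj u l" and w: "ctrl w" and \<tau>: "\<tau> \<in> {0..T}"
  shows "c / (256 * m) * norm (l \<tau>) * (U \<tau> w u)\<^sup>2 \<le> defect u l \<tau> w + defect u l \<tau> u"
proof -
  define a where "a i = integral {0..\<tau>} (\<lambda>r. \<bar>bang u l r $ i - w r $ i\<bar>)" for i
  define b where "b i = integral {0..\<tau>} (\<lambda>r. \<bar>bang u l r $ i - u r $ i\<bar>)" for i
  have \<tau>T: "\<tau> \<le> T" using \<tau> by simp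
  have m: "1 \<le> m" unfolding m_def by (simp add: Suc_leI)
  have "(U \<tau> w u)\<^sup>2 \<le> (\<Sum>i\<in>UNIV. a i + b i)\<^sup>2"
    unfolding a_def b_def
    by (rule power_mono[OF U_triangle[OF u w ctrl_bang[OF u l] \<tau>T] U_nonneg[OF w u \<tau>T]])
  also have "\<dots> \<le> (\<Sum>i\<in>UNIV. (a i + b i)\<^sup>2) * m"
    unfolding m_def by (rule sum_squared_le_sum_of_squares)
  also have "\<dots> \<le> (\<Sum>i\<in>UNIV. 2 * (a i)\<^sup>2 + 2 * (b i)\<^sup>2) * m"
  proof (intro mult_right_mono sum_mono)
    show "(a i + b i)\<^sup>2 \<le> 2 * (a i)\<^sup>2 + 2 * (b i)\<^sup>2" for i
      using sum_squares_bound[of "a i" "b i"] by (simp add: power2_sum)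
  qed (use m in auto)
  finally have *: "(U \<tau> w u)\<^sup>2 \<le> 2 * m * ((\<Sum>i\<in>UNIV. (a i)\<^sup>2) + (\<Sum>i\<in>UNIV. (b i)\<^sup>2))"
    by (simp add: sum.distrib sum_distrib_left[symmetric] mult_ac)
  have "c / (256 * m) * norm (l \<tau>) * (U \<tau> w u)\<^sup>2
      \<le> c / (256 * m) * norm (l \<tau>) * (2 * m * ((\<Sum>i\<in>UNIV. (a i)\<^sup>2) + (\<Sum>i\<in>UNIV. (b i)\<^sup>2)))"
    using c m by (intro mult_left_mono *) auto
  also have "\<dots> = c / 128 * norm (l \<tau>) * (\<Sum>i\<in>UNIV. (a i)\<^sup>2) + c / 128 * norm (l \<tau>) * (\<Sum>i\<in>UNIV. (b i)\<^sup>2)"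
    using m by (simp add: field_simps)
  also have "\<dots> \<le> defect u l \<tau> w + defect u l \<tau> u"
    unfolding a_def b_def by (intro add_mono defect_ge u l w \<tau>)
  finally show ?thesis .
qed

lemma integral_pairing_eq_defects:
  assumes u: "ctrl u" and l: "adj u l" and w: "ctrl w" and \<tau>: "\<tau> \<in> {0..T}"
  shows "integral {0..\<tau>} (\<lambda>r. \<Sum>i\<in>UNIV. (w r $ i - u r $ i) * \<sigma> u l i r) = defect u l \<tau> u - defect u l \<tau> w"
proof -
  have "integral {0..\<tau>} (\<lambda>r. \<Sum>i\<in>UNIV. (w r $ i - u r $ i) * \<sigma> u l i r)
    = integral {0..\<tau>} (\<lambda>r. \<Sum>i\<in>UNIV. \<bar>\<sigma> u l i r\<bar> * \<bar>bang u l r $ i - u r $ i\<bar> - \<bar>\<sigma> u l i r\<bar> * \<bar>bang u l r $ i - w r $ i\<bar>)"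
  proof (intro integral_cong sum.cong refl)
    fix r i assume "r \<in> {0..\<tau>}"
    then have r: "r \<in> {0..T}" using \<tau> by auto
    show "(w r $ i - u r $ i) * \<sigma> u l i r
      = \<bar>\<sigma> u l i r\<bar> * \<bar>bang u l r $ i - u r $ i\<bar> - \<bar>\<sigma> u l i r\<bar> * \<bar>bang u l r $ i - w r $ i\<bar>"
      unfolding \<sigma>_bang[OF ctrlD(3)[OF u r]] \<sigma>_bang[OF ctrlD(3)[OF w r]] by (simp add: algebra_simps)
  qed
  also have "\<dots> = (\<Sum>i\<in>UNIV. integral {0..\<tau>} (\<lambda>r. \<bar>\<sigma> u l i r\<bar> * \<bar>bang u l r $ i - u r $ i\<bar> - \<bar>\<sigma> u l i r\<bar> * \<bar>bang u l r $ i - w r $ i\<bar>))"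
    by (intro integral_sum integrable_diff defect_integrand(3) u l w) (use \<tau> in auto)
  also have "\<dots> = (\<Sum>i\<in>UNIV. integral {0..\<tau>} (\<lambda>r. \<bar>\<sigma> u l i r\<bar> * \<bar>bang u l r $ i - u r $ i\<bar>)
       - integral {0..\<tau>} (\<lambda>r. \<bar>\<sigma> u l i r\<bar> * \<bar>bang u l r $ i - w r $ i\<bar>))"
    by (intro sum.cong refl Henstock_Kurzweil_Integration.integral_diff defect_integrand(3) u l w) (use \<tau> in auto)
  finally show ?thesis unfolding defect_def by (simp add: sum_subtractf)
qed

definition \<gamma> :: real where "\<gamma> = c / (512 * m)"

lemma \<gamma>_pos: "0 < \<gamma>"
proof -
  have "0 < m" unfolding m_def by simp
  then show ?thesis unfolding \<gamma>_def using c by simp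
qed

text \<open>\<open>\<gamma>\<close> is half the constant of \<open>U_sq_le_defects\<close>. One half
  pays for the second order error of \<open>pairing_estimate\<close>, by the smallness of
  \<open>T\<close>; the other half remains. The defect of \<open>w\<close> cancels and that of
  \<open>u\<close> doubles.\<close>

theorem strict_maximum_inequality:
  assumes u: "ctrl u" and l: "adj u l" and w: "ctrl w" and \<tau>: "\<tau> \<in> {0..T}"
  shows "l \<tau> \<bullet> (X w \<tau> - X u \<tau>) \<le> 2 * defect u l \<tau> u - \<gamma> * norm (l \<tau>) * (U \<tau> w u)\<^sup>2"
proof -
  define Q where "Q = norm (l \<tau>) * (U \<tau> w u)\<^sup>2"
  have "96 * k ^ 3 * T * norm (l \<tau>) * (U \<tau> w u)\<^sup>2 = 96 * k ^ 3 * T * Q" by (simp add: Q_def)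
  also have "\<dots> \<le> \<gamma> * Q"
    using small_bounds(3) by (intro mult_right_mono) (auto simp: Q_def \<gamma>_def)
  finally have "l \<tau> \<bullet> (X w \<tau> - X u \<tau>) \<le> defect u l \<tau> u - defect u l \<tau> w + \<gamma> * Q"
    using pairing_estimate[OF u w l \<tau>] unfolding integral_pairing_eq_defects[OF u l w \<tau>] by linarith
  moreover have "\<gamma> * Q + \<gamma> * Q \<le> defect u l \<tau> w + defect u l \<tau> u"
    using U_sq_le_defects[OF u l w \<tau>] by (simp add: Q_def \<gamma>_def)
  moreover have "\<gamma> * norm (l \<tau>) * (U \<tau> w u)\<^sup>2 = \<gamma> * Q" by (simp add: Q_def)
  ultimately show ?thesis by linarith
qed

text \<open>Moving \<open>u\<close> by the fraction \<epsilon> towards the maximising control gains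
  \<epsilon> times the defect to first order. The proximal bound and the pairing error are
  O(\<epsilon>^2), and the endpoint is asked to lie within \<epsilon>^2 of \<open>p\<close> so that
  it spoils nothing. Division by \<epsilon> concludes.\<close>

lemma defect_le_if_proximal:
  assumes u: "ctrl u" and l: "adj u l" and \<tau>: "\<tau> \<in> {0..T}"
    and C: "0 \<le> C" and prox: "\<And>w. ctrl w \<Longrightarrow> l \<tau> \<bullet> (X w \<tau> - p) \<le> C * (norm (X w \<tau> - p))\<^sup>2"
    and \<epsilon>: "0 < \<epsilon>" "\<epsilon> \<le> 1" and close: "norm (X u \<tau> - p) \<le> \<epsilon>\<^sup>2"
  shows "defect u l \<tau> u \<le> \<epsilon> * (384 * k ^ 3 * T * m\<^sup>2 * norm (l \<tau>) + C * (8 * k * m + 1)\<^sup>2 + norm (l \<tau>))"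
proof -
  define v where "v = bang u l"
  have v: "ctrl v" unfolding v_def by (rule ctrl_bang[OF u l])
  define w where "w r = u r + \<epsilon> *\<^sub>R (v r - u r)" for r
  have wi: "w r $ i = (1 - \<epsilon>) * u r $ i + \<epsilon> * v r $ i" for r i
    unfolding w_def by (simp add: algebra_simps)
  have wu: "w r $ i - u r $ i = \<epsilon> * (v r $ i - u r $ i)" for r i
    unfolding w_def by simp
  have w: "ctrl w"
    unfolding ctrl_def boxed_def
  proof (intro conjI allI ballI)
    note [measurable] = ctrlD(1)[OF u] ctrlD(1)[OF v]
    show "(\<lambda>r. w r $ i) \<in> borel_measurable (lebesgue_on {0..T})" for i
      unfolding wi by measurable
    fix r i assume r: "r \<in> {0..T}"
    have "\<bar>(1 - \<epsilon>) * u r $ i + \<epsilon> * v r $ i\<bar> \<le> (1 - \<epsilon>) * 1 + \<epsilon> * 1"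
      using ctrlD(3)[OF u r, of i] ctrlD(3)[OF v r, of i] \<epsilon>
      by (intro order_trans[OF abs_triangle_ineq] add_mono) (auto simp: abs_mult intro!: mult_left_le)
    then show "\<bar>w r $ i\<bar> \<le> 1" unfolding wi by simp
  qed
  have "integral {0..\<tau>} (\<lambda>r. \<Sum>i\<in>UNIV. (w r $ i - u r $ i) * \<sigma> u l i r)
     = integral {0..\<tau>} (\<lambda>r. \<epsilon> * (\<Sum>i\<in>UNIV. (v r $ i - u r $ i) * \<sigma> u l i r))"
    unfolding wu by (simp add: sum_distrib_left mult.assoc)
  also have "\<dots> = \<epsilon> * (defect u l \<tau> u - defect u l \<tau> v)"
    by (simp add: integral_pairing_eq_defects[OF u l v \<tau>])
  also have "defect u l \<tau> v = 0" unfolding defect_def v_def by simp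
  finally have I: "integral {0..\<tau>} (\<lambda>r. \<Sum>i\<in>UNIV. (w r $ i - u r $ i) * \<sigma> u l i r) = \<epsilon> * defect u l \<tau> u" by simp
  have m: "1 \<le> m" unfolding m_def by (simp add: Suc_leI)
  have \<tau>T: "\<tau> \<le> T" using \<tau> by simp
  have U0: "0 \<le> U \<tau> w u" by (rule U_nonneg[OF w u \<tau>T])
  have "U \<tau> w u = integral {0..\<tau>} (\<lambda>r. \<epsilon> * (\<Sum>i\<in>UNIV. \<bar>v r $ i - u r $ i\<bar>))"
    unfolding U_def wu using \<epsilon> by (simp add: abs_mult sum_distrib_left)
  also have "\<dots> = \<epsilon> * U \<tau> v u" unfolding U_def by simp
  also have "U \<tau> v u \<le> 2 * m * (\<tau> - 0)"
  proof -
    have "norm (U \<tau> v u) \<le> 2 * m * (\<tau> - 0)"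
      unfolding U_def
      by (rule has_integral_norm_bound_const[OF integrable_integral[OF ctrl_diff_integrable[OF v u order_refl \<tau>T]]])
        (use ctrl_diff_le[OF v u] \<tau> in \<open>auto simp: sum_nonneg\<close>)
    then show ?thesis by simp
  qed
  also have "2 * m * (\<tau> - 0) \<le> 2 * m * 1" using \<tau> T m by (intro mult_left_mono) auto
  finally have Ue: "U \<tau> w u \<le> \<epsilon> * (2 * m)" using \<epsilon> by simp
  have d: "norm (X w \<tau> - p) \<le> (8 * k * m + 1) * \<epsilon>"
  proof -
    have "norm (X w \<tau> - p) = norm ((X w \<tau> - X u \<tau>) + (X u \<tau> - p))" by simp
    also have "\<dots> \<le> 4 * k * U \<tau> w u + \<epsilon>\<^sup>2"
      using \<tau> by (intro norm_triangle_mono close X_diff w u) auto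
    also have "4 * k * U \<tau> w u \<le> 4 * k * (\<epsilon> * (2 * m))" using Ue k_ge by (intro mult_left_mono) auto
    also have "\<epsilon>\<^sup>2 \<le> \<epsilon>" using \<epsilon> by (simp add: power2_eq_square mult_left_le)
    finally show ?thesis by (simp add: algebra_simps)
  qed
  have "l \<tau> \<bullet> (X w \<tau> - X u \<tau>) = l \<tau> \<bullet> (X w \<tau> - p) + l \<tau> \<bullet> (p - X u \<tau>)"
    by (simp add: inner_diff_right)
  also have "\<dots> \<le> C * ((8 * k * m + 1) * \<epsilon>)\<^sup>2 + norm (l \<tau>) * \<epsilon>\<^sup>2"
  proof (rule add_mono)
    show "l \<tau> \<bullet> (X w \<tau> - p) \<le> C * ((8 * k * m + 1) * \<epsilon>)\<^sup>2"
      by (rule order_trans[OF prox[OF w] mult_left_mono[OF power_mono[OF d] C]]) simp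
    show "l \<tau> \<bullet> (p - X u \<tau>) \<le> norm (l \<tau>) * \<epsilon>\<^sup>2"
      by (rule order_trans[OF norm_cauchy_schwarz mult_left_mono]) (use close in \<open>auto simp: norm_minus_commute\<close>)
  qed
  finally have 1: "l \<tau> \<bullet> (X w \<tau> - X u \<tau>) \<le> C * ((8 * k * m + 1) * \<epsilon>)\<^sup>2 + norm (l \<tau>) * \<epsilon>\<^sup>2" .
  have "96 * k ^ 3 * T * norm (l \<tau>) * (U \<tau> w u)\<^sup>2 \<le> 96 * k ^ 3 * T * norm (l \<tau>) * (\<epsilon> * (2 * m))\<^sup>2"
    using k_ge T by (intro mult_left_mono power_mono[OF Ue U0] mult_nonneg_nonneg) auto
  with 1 pairing_estimate[OF u w l \<tau>]
  have "\<epsilon> * defect u l \<tau> u \<le> C * ((8 * k * m + 1) * \<epsilon>)\<^sup>2 + norm (l \<tau>) * \<epsilon>\<^sup>2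
      + 96 * k ^ 3 * T * norm (l \<tau>) * (\<epsilon> * (2 * m))\<^sup>2"
    unfolding I by linarith
  also have "\<dots> = \<epsilon> * (\<epsilon> * (384 * k ^ 3 * T * m\<^sup>2 * norm (l \<tau>) + C * (8 * k * m + 1)\<^sup>2 + norm (l \<tau>)))"
    unfolding power_mult_distrib by (simp add: power2_eq_square[of \<epsilon>] distrib_left)
  finally show ?thesis using \<epsilon>(1) by (simp only: mult_le_cancel_left_pos)
qed

subsection \<open>Reachable sets\<close>

definition R :: "real \<Rightarrow> 'a set" where
  "R \<tau> = {X u \<tau> |u. ctrl u}"

lemma XR: "ctrl u \<Longrightarrow> X u \<tau> \<in> R \<tau>"
  unfolding R_def by blast

lemma closure_R_approx:
  assumes "x \<in> closure (R \<tau>)" "0 < e"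
  obtains u where "ctrl u" "norm (X u \<tau> - x) < e"
proof -
  obtain y where "y \<in> R \<tau>" "dist y x < e" using assms unfolding closure_approachable by blast
  then show thesis using that unfolding R_def dist_norm by blast
qed

text \<open>The point \<open>p\<close> is only approximated by endpoints. Each approximating control
  has its own adjoint arc, but all take the value \<zeta> at \<tau>, so the inequality passes to the
  limit as the defects vanish. The factor \<open>16 * k\<^sup>2\<close> converts L1 distance of
  controls into distance of endpoints.\<close>

theorem proximal_normal_strict:
  assumes \<tau>: "\<tau> \<in> {0..T}" and p: "p \<in> closure (R \<tau>)" and x: "x \<in> R \<tau>" and C: "0 \<le> C"
    and prox: "\<And>y. y \<in> R \<tau> \<Longrightarrow> \<zeta> \<bullet> (y - p) \<le> C * (norm (y - p))\<^sup>2"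
  shows "\<zeta> \<bullet> (x - p) \<le> - (\<gamma> / (16 * k\<^sup>2)) * norm \<zeta> * (norm (x - p))\<^sup>2"
proof -
  obtain w where w: "ctrl w" and xw: "x = X w \<tau>" using x unfolding R_def by blast
  define Q where "Q = 384 * k ^ 3 * T * m\<^sup>2 * norm \<zeta> + C * (8 * k * m + 1)\<^sup>2 + norm \<zeta>"
  have \<tau>T: "\<tau> \<le> T" using \<tau> by simp
  have "\<exists>y. norm (y - p) \<le> inverse (real (Suc n)) \<and>
      \<zeta> \<bullet> (x - y) \<le> 2 * (inverse (real (Suc n)) * Q) - (\<gamma> / (16 * k\<^sup>2)) * norm \<zeta> * (norm (x - y))\<^sup>2" for n
  proof -
    define \<epsilon> where "\<epsilon> = inverse (real (Suc n))"
    have \<epsilon>: "0 < \<epsilon>" "\<epsilon> \<le> 1" unfolding \<epsilon>_def by (auto simp: field_simps)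
    obtain u where u: "ctrl u" and close: "norm (X u \<tau> - p) < \<epsilon>\<^sup>2"
      using closure_R_approx[OF p, of "\<epsilon>\<^sup>2"] \<epsilon> by auto
    obtain l where l: "adj u l" "l \<tau> = \<zeta>" using adj_exists[OF u \<tau>] by blast
    have d: "defect u l \<tau> u \<le> \<epsilon> * Q"
      using defect_le_if_proximal[OF u l(1) \<tau> C _ \<epsilon> less_imp_le[OF close]] prox XR
      unfolding l(2) Q_def by blast
    have "norm (X w \<tau> - X u \<tau>) \<le> 4 * k * U \<tau> w u" using X_diff[OF w u \<tau>T] \<tau> by simp
    then have "(norm (x - X u \<tau>))\<^sup>2 \<le> (4 * k * U \<tau> w u)\<^sup>2" unfolding xw by (intro power_mono) auto
    then have "(norm (x - X u \<tau>))\<^sup>2 / (16 * k\<^sup>2) \<le> (U \<tau> w u)\<^sup>2"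
      using k_ge by (simp add: pos_divide_le_eq power_mult_distrib mult_ac)
    then have "\<gamma> * norm \<zeta> * ((norm (x - X u \<tau>))\<^sup>2 / (16 * k\<^sup>2)) \<le> \<gamma> * norm \<zeta> * (U \<tau> w u)\<^sup>2"
      using \<gamma>_pos by (intro mult_left_mono) auto
    moreover have "\<zeta> \<bullet> (x - X u \<tau>) \<le> 2 * defect u l \<tau> u - \<gamma> * norm \<zeta> * (U \<tau> w u)\<^sup>2"
      using strict_maximum_inequality[OF u l(1) w \<tau>] unfolding l(2) xw .
    ultimately have "\<zeta> \<bullet> (x - X u \<tau>) \<le> 2 * (\<epsilon> * Q) - (\<gamma> / (16 * k\<^sup>2)) * norm \<zeta> * (norm (x - X u \<tau>))\<^sup>2"
      using d by simp
    moreover have "norm (X u \<tau> - p) \<le> \<epsilon>"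
      using close \<epsilon> by (smt (verit) power2_eq_square mult_left_le)
    ultimately show ?thesis unfolding \<epsilon>_def by blast
  qed
  then obtain y where y: "\<And>n. norm (y n - p) \<le> inverse (real (Suc n))"
    and le: "\<And>n. \<zeta> \<bullet> (x - y n) \<le> 2 * (inverse (real (Suc n)) * Q) - (\<gamma> / (16 * k\<^sup>2)) * norm \<zeta> * (norm (x - y n))\<^sup>2"
    by (metis (no_types, lifting))
  have "(\<lambda>n. y n - p) \<longlonglongrightarrow> 0"
    by (rule Lim_null_comparison[OF always_eventually LIMSEQ_inverse_real_of_nat]) (use y in auto)
  then have yp: "y \<longlonglongrightarrow> p" by (simp add: LIM_zero_iff)
  have "(\<lambda>n. \<zeta> \<bullet> (x - y n)) \<longlonglongrightarrow> \<zeta> \<bullet> (x - p)" by (intro tendsto_intros yp)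
  moreover have "(\<lambda>n. 2 * (inverse (real (Suc n)) * Q) - (\<gamma> / (16 * k\<^sup>2)) * norm \<zeta> * (norm (x - y n))\<^sup>2)
     \<longlonglongrightarrow> 2 * (0 * Q) - (\<gamma> / (16 * k\<^sup>2)) * norm \<zeta> * (norm (x - p))\<^sup>2"
    by (intro tendsto_intros yp LIMSEQ_inverse_real_of_nat)
  ultimately have "\<zeta> \<bullet> (x - p) \<le> 2 * (0 * Q) - (\<gamma> / (16 * k\<^sup>2)) * norm \<zeta> * (norm (x - p))\<^sup>2"
    by (rule LIMSEQ_le) (use le in blast)
  then show ?thesis by simp
qed

subsection \<open>Modifying controls\<close>

lemma ctrl_splice:
  assumes "ctrl u" "ctrl w" shows "ctrl (\<lambda>r. if r < s then u r else w r)"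
proof -
  have [measurable]: "(\<lambda>r. r) \<in> borel_measurable (lebesgue_on {0..T})"
    by (intro continuous_imp_measurable_on_sets_lebesgue continuous_intros) auto
  note [measurable] = ctrlD(1)[OF assms(1)] ctrlD(1)[OF assms(2)]
  have "(\<lambda>r. if r < s then u r $ i else w r $ i) \<in> borel_measurable (lebesgue_on {0..T})" for i
    by (rule measurable_If) measurable
  moreover have "(if r < s then u r else w r) $ i = (if r < s then u r $ i else w r $ i)" for r i by simp
  ultimately show ?thesis using assms unfolding ctrl_def by simp
qed

lemma ctrl_const: "boxed e \<Longrightarrow> ctrl (\<lambda>_. e)"
  unfolding ctrl_def by simp

lemma U_eq_if_agree:
  assumes "\<And>r. r \<in> {0..<s} \<Longrightarrow> u r = v r"
  shows "U s w u = U s w v"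
  unfolding U_def
proof (rule integral_spike[of "{s}"])
  fix r assume "r \<in> {0..s} - {s}"
  then have "u r = v r" by (intro assms) auto
  then show "(\<Sum>i\<in>UNIV. \<bar>w r $ i - v r $ i\<bar>) = (\<Sum>i\<in>UNIV. \<bar>w r $ i - u r $ i\<bar>)" by simp
qed simp

lemma U_eq_0_if_agree:
  assumes "\<And>r. r \<in> {0..<s} \<Longrightarrow> u r = v r"
  shows "U s u v = 0"
proof -
  have "U s u v = U s u u" by (rule U_eq_if_agree[OF assms[symmetric]])
  then show ?thesis by (simp add: U_def)
qed

lemma X_eq_if_agree:
  assumes "ctrl u" "ctrl v" "s \<in> {0..T}" "\<And>r. r \<in> {0..<s} \<Longrightarrow> u r = v r"
  shows "X u s = X v s"
proof -
  have "norm (X u s - X v s) \<le> 4 * k * U s u v" by (rule X_diff[OF assms(1,2)]) (use assms(3) in auto)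
  also have "U s u v = 0" by (rule U_eq_0_if_agree[OF assms(4)])
  finally show ?thesis by simp
qed

lemma U_extend:
  assumes w: "ctrl w" and u: "ctrl u" and st: "0 \<le> s" "s \<le> t" "t \<le> T"
  shows "U t w u \<le> U s w u + 2 * m * (t - s)"
proof -
  have i: "(\<lambda>r. \<Sum>i\<in>UNIV. \<bar>w r $ i - u r $ i\<bar>) integrable_on {a..b}" if "0 \<le> a" "b \<le> T" for a b
    by (rule ctrl_diff_integrable[OF w u that])
  have "U s w u + integral {s..t} (\<lambda>r. \<Sum>i\<in>UNIV. \<bar>w r $ i - u r $ i\<bar>) = U t w u"
    unfolding U_def by (rule Henstock_Kurzweil_Integration.integral_combine[OF st(1,2) i]) (use st in auto)
  moreover have "norm (integral {s..t} (\<lambda>r. \<Sum>i\<in>UNIV. \<bar>w r $ i - u r $ i\<bar>)) \<le> 2 * m * (t - s)"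
    by (rule has_integral_norm_bound_const[OF integrable_integral[OF i] st(2)])
      (use st ctrl_diff_le[OF w u] in \<open>auto simp: sum_nonneg\<close>)
  ultimately show ?thesis by simp
qed

subsection \<open>Endpoints of minimal time\<close>

text \<open>The direction from the projection \<open>q\<close> to \<open>p\<close> is a proximal
  normal to the closure of \<open>R r\<close> at \<open>q\<close>, so a control ending close to
  \<open>q\<close> has small defect with respect to it.\<close>

lemma almost_extremal_near:
  assumes s: "s \<in> {0..T}" and r: "0 \<le> r" "r < s" and p: "p \<in> closure (R s)" and np: "p \<notin> closure (R r)"
    and \<epsilon>: "0 < \<epsilon>"
  shows "\<exists>u \<zeta>. ctrl u \<and> (\<forall>t\<ge>r. u t = 0) \<and> norm \<zeta> = 1 \<and> norm (X u r - p) \<le> 2 * k * (s - r) + \<epsilon> \<and>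
     (\<forall>w. ctrl w \<longrightarrow> \<zeta> \<bullet> (X w r - X u r) \<le> 2 * \<epsilon> - \<gamma> * (U r w u)\<^sup>2)"
proof -
  have rT: "r \<in> {0..T}" using r s by auto
  have c0: "ctrl (\<lambda>_. 0)" by (rule ctrl_const) (simp add: boxed_def)
  have ne: "closure (R r) \<noteq> {}" using XR[OF c0, of r] closure_subset by blast
  define q where "q = closest_point (closure (R r)) p"
  have q: "q \<in> closure (R r)" unfolding q_def by (rule closest_point_in_set[OF closed_closure ne])
  have near: "norm (p - q) \<le> norm (p - y)" if "y \<in> closure (R r)" for y
    using closest_point_le[OF closed_closure that, of p] unfolding q_def dist_norm .
  have d: "0 < norm (p - q)" using q np by auto
  define \<zeta> where "\<zeta> = (p - q) /\<^sub>R norm (p - q)"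
  have \<zeta>: "norm \<zeta> = 1" unfolding \<zeta>_def using d by simp
  \<comment> \<open>The constant that results from expanding the square of the inequality
    \<open>norm (p - q) \<le> norm (p - y)\<close>.\<close>
  define C where "C = 1 / (2 * norm (p - q))"
  have C: "0 \<le> C" unfolding C_def using d by simp
  have prox: "\<zeta> \<bullet> (y - q) \<le> C * (norm (y - q))\<^sup>2" if "y \<in> R r" for y
  proof -
    have "(norm (p - q))\<^sup>2 \<le> (norm (p - y))\<^sup>2" using near[of y] that closure_subset by (intro power_mono) auto
    also have "p - y = (p - q) - (y - q)" by simp
    also have "(norm \<dots>)\<^sup>2 = (norm (p - q))\<^sup>2 - 2 * ((p - q) \<bullet> (y - q)) + (norm (y - q))\<^sup>2"
      unfolding power2_norm_eq_inner inner_diff_left inner_diff_right by (simp add: inner_commute)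
    finally have "(p - q) \<bullet> (y - q) \<le> (norm (y - q))\<^sup>2 / 2" by simp
    then have "((p - q) \<bullet> (y - q)) / norm (p - q) \<le> ((norm (y - q))\<^sup>2 / 2) / norm (p - q)"
      using d by (intro divide_right_mono) auto
    moreover have "\<zeta> \<bullet> (y - q) = ((p - q) \<bullet> (y - q)) / norm (p - q)"
      unfolding \<zeta>_def inner_scaleR_left by (rule divide_inverse_commute[symmetric])
    moreover have "C * (norm (y - q))\<^sup>2 = ((norm (y - q))\<^sup>2 / 2) / norm (p - q)"
      unfolding C_def by simp
    ultimately show ?thesis by simp
  qed
  \<comment> \<open>A trajectory that comes close to \<open>p\<close> at time \<open>s\<close> was
    within its speed bound of \<open>p\<close> at time \<open>r\<close>.\<close>
  have pq: "norm (p - q) \<le> 2 * k * (s - r)"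
  proof (rule field_le_epsilon)
    fix e :: real assume "0 < e"
    then obtain u where u: "ctrl u" and e: "norm (X u s - p) < e" using closure_R_approx[OF p] by blast
    have "norm (p - q) \<le> norm (p - X u r)"
      using near XR[OF u, of r] closure_subset by blast
    also have "\<dots> = norm ((X u s - X u r) - (X u s - p))" by simp
    also have "\<dots> \<le> 2 * k * \<bar>s - r\<bar> + e"
      by (rule order_trans[OF norm_triangle_ineq4 add_mono[OF X_lipschitz[OF u rT s] less_imp_le[OF e]]])
    finally show "norm (p - q) \<le> 2 * k * (s - r) + e" using r by simp
  qed
  define Q where "Q = 384 * k ^ 3 * T * m\<^sup>2 * norm \<zeta> + C * (8 * k * m + 1)\<^sup>2 + norm \<zeta>"
  have Q: "1 \<le> Q" unfolding Q_def \<zeta> using k_ge T C by (simp add: mult_nonneg_nonneg)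
  \<comment> \<open>\<open>C\<close>, and with it \<open>Q\<close>, is unbounded as \<open>q\<close>
    approaches \<open>p\<close>; the accuracy is therefore chosen after the projection.\<close>
  define e where "e = min 1 (\<epsilon> / Q)"
  have e: "0 < e" "e \<le> 1" unfolding e_def using \<epsilon> Q by auto
  have eQ: "e * Q \<le> \<epsilon>"
  proof -
    have "e * Q \<le> (\<epsilon> / Q) * Q" unfolding e_def using Q by (intro mult_right_mono) auto
    then show ?thesis using Q by simp
  qed
  have ee: "e\<^sup>2 \<le> \<epsilon>"
  proof -
    have "e\<^sup>2 \<le> e * 1" unfolding power2_eq_square using e by (intro mult_left_mono) auto
    also have "\<dots> \<le> e * Q" using e Q by (intro mult_left_mono) auto
    finally show ?thesis using eQ by simp
  qed
  obtain u where u: "ctrl u" and close: "norm (X u r - q) < e\<^sup>2"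
    using closure_R_approx[OF q, of "e\<^sup>2"] e by auto
  obtain l where l: "adj u l" "l r = \<zeta>" using adj_exists[OF u rT] by blast
  have "defect u l r u \<le> e * Q"
    using defect_le_if_proximal[OF u l(1) rT C _ e less_imp_le[OF close]] prox XR
    unfolding l(2) Q_def by blast
  then have ineq: "\<zeta> \<bullet> (X w r - X u r) \<le> 2 * \<epsilon> - \<gamma> * (U r w u)\<^sup>2" if "ctrl w" for w
    using strict_maximum_inequality[OF u l(1) that rT] eQ unfolding l(2) \<zeta> by simp
  \<comment> \<open>Switching the control off after \<open>r\<close> affects neither the endpoint
    nor distances on \<open>{0..r}\<close>, and makes controls built for different \<open>r\<close>
    agree at late times.\<close>
  define v where "v t = (if t < r then u t else 0)" for t
  have v: "ctrl v" unfolding v_def by (rule ctrl_splice[OF u c0])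
  have vu: "X v r = X u r" by (rule X_eq_if_agree[OF v u rT]) (simp add: v_def)
  have Uv: "U r w v = U r w u" for w by (rule U_eq_if_agree) (simp add: v_def)
  have "norm (X u r - p) = norm ((X u r - q) - (p - q))" by simp
  also have "\<dots> \<le> \<epsilon> + 2 * k * (s - r)"
    by (rule order_trans[OF norm_triangle_ineq4 add_mono[OF order_trans[OF less_imp_le[OF close] ee] pq]])
  finally have "norm (X v r - p) \<le> 2 * k * (s - r) + \<epsilon>" unfolding vu by simp
  then show ?thesis
    using v \<zeta> ineq unfolding vu[symmetric] Uv[symmetric] by (intro exI[of _ v] exI[of _ \<zeta>]) (auto simp: v_def)
qed

lemma U_eq_if_agree_later:
  assumes w: "ctrl w" and u: "ctrl u" and s: "s \<in> {0..T}" and e: "\<And>r. s \<le> r \<Longrightarrow> w r = u r"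
  shows "U T w u = U s w u"
proof -
  have "U s w u + integral {s..T} (\<lambda>r. \<Sum>i\<in>UNIV. \<bar>w r $ i - u r $ i\<bar>) = U T w u"
    unfolding U_def
    by (rule Henstock_Kurzweil_Integration.integral_combine[OF _ _ ctrl_diff_integrable[OF w u]]) (use s in auto)
  moreover have "integral {s..T} (\<lambda>r. \<Sum>i\<in>UNIV. \<bar>w r $ i - u r $ i\<bar>) = integral {s..T} (\<lambda>r. 0)"
    by (rule integral_cong) (use e in auto)
  ultimately show ?thesis by simp
qed

text \<open>The rate 1/4 is chosen because the inequality bounds squares of L1 distances: the
  distances themselves then decay like (1/2)^n and are summable.\<close>

lemma almost_extremal_sequence:
  assumes s: "0 < s" "s \<le> T" and p: "p \<in> closure (R s)" and np: "\<And>r. 0 \<le> r \<Longrightarrow> r < s \<Longrightarrow> p \<notin> closure (R r)"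
  shows "\<exists>r u \<zeta>. \<forall>n. 0 \<le> r n \<and> r n < s \<and> r n \<le> r (Suc n) \<and> s - r n \<le> (1/4) ^ n \<and> ctrl (u n) \<and> (\<forall>t\<ge>r n. u n t = 0)
     \<and> norm (\<zeta> n) = 1 \<and> norm (X (u n) (r n) - p) \<le> 3 * k * (1/4) ^ n
     \<and> (\<forall>w. ctrl w \<longrightarrow> \<zeta> n \<bullet> (X w (r n) - X (u n) (r n)) \<le> 2 * (1/4) ^ n - \<gamma> * (U (r n) w (u n))\<^sup>2)"
proof -
  define r where "r n = s - s * (1/4) ^ Suc n" for n :: nat
  have q: "(1/4::real) ^ Suc n < 1" "(1/4::real) ^ Suc n \<le> (1/4) ^ n" "0 < (1/4::real) ^ n" for n
    using power_le_one[of "1/4::real" n] by auto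
  have r: "0 \<le> r n" "r n < s" "r n \<le> r (Suc n)" "s - r n \<le> (1/4) ^ n" for n
  proof -
    show "0 \<le> r n" unfolding r_def using q(1)[of n] s by (simp add: mult_left_le)
    show "r n < s" unfolding r_def using s by simp
    show "r n \<le> r (Suc n)" unfolding r_def using q(2)[of "Suc n"] s by (intro diff_left_mono mult_left_mono) auto
    have "s * (1/4) ^ Suc n \<le> 1 * (1/4) ^ n" using q(2)[of n] s T by (intro mult_mono) auto
    then show "s - r n \<le> (1/4) ^ n" unfolding r_def by simp
  qed
  have sT: "s \<in> {0..T}" using s by auto
  have "\<exists>u \<zeta>. ctrl u \<and> (\<forall>t\<ge>r n. u t = 0) \<and> norm \<zeta> = 1 \<and> norm (X u (r n) - p) \<le> 2 * k * (s - r n) + (1/4) ^ n \<and>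
     (\<forall>w. ctrl w \<longrightarrow> \<zeta> \<bullet> (X w (r n) - X u (r n)) \<le> 2 * (1/4) ^ n - \<gamma> * (U (r n) w u)\<^sup>2)" for n
    by (rule almost_extremal_near[OF sT r(1,2) p np[OF r(1,2)] q(3)])
  then obtain u \<zeta> where u: "\<And>n. ctrl (u n)" "\<And>n t. r n \<le> t \<Longrightarrow> u n t = 0" "\<And>n. norm (\<zeta> n) = 1"
      "\<And>n. norm (X (u n) (r n) - p) \<le> 2 * k * (s - r n) + (1/4) ^ n"
      "\<And>n w. ctrl w \<Longrightarrow> \<zeta> n \<bullet> (X w (r n) - X (u n) (r n)) \<le> 2 * (1/4) ^ n - \<gamma> * (U (r n) w (u n))\<^sup>2"
    by metis
  have "norm (X (u n) (r n) - p) \<le> 3 * k * (1/4) ^ n" for n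
  proof -
    have "2 * k * (s - r n) \<le> 2 * k * (1/4) ^ n" using r(4) k_ge by (intro mult_left_mono) auto
    moreover have "1 * (1/4) ^ n \<le> k * (1/4) ^ n" using k_ge by (intro mult_right_mono) auto
    moreover have "2 * k * (1/4) ^ n + k * (1/4) ^ n = 3 * k * (1/4) ^ n" by simp
    ultimately show ?thesis using u(4)[of n] by linarith
  qed
  then show ?thesis using r u by blast
qed

text \<open>Strong convergence of the controls lets endpoints pass to the limit despite the
  nonlinear dynamics. The limit control reaches \<open>p\<close> itself, although \<open>p\<close>
  was only assumed to lie in the closure.\<close>

lemma extremal_endpoint:
  assumes s: "0 < s" "s \<le> T" and p: "p \<in> closure (R s)" and np: "\<And>r. 0 \<le> r \<Longrightarrow> r < s \<Longrightarrow> p \<notin> closure (R r)"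
  shows "\<exists>u \<zeta>. ctrl u \<and> X u s = p \<and> norm \<zeta> = 1 \<and> (\<forall>w. ctrl w \<longrightarrow> \<zeta> \<bullet> (X w s - p) \<le> 0)"
proof -
  obtain r u \<zeta> where all: "\<forall>n. 0 \<le> r n \<and> r n < s \<and> r n \<le> r (Suc n) \<and> s - r n \<le> (1/4) ^ n \<and> ctrl (u n) \<and> (\<forall>t\<ge>r n. u n t = 0)
     \<and> norm (\<zeta> n) = 1 \<and> norm (X (u n) (r n) - p) \<le> 3 * k * (1/4) ^ n
     \<and> (\<forall>w. ctrl w \<longrightarrow> \<zeta> n \<bullet> (X w (r n) - X (u n) (r n)) \<le> 2 * (1/4) ^ n - \<gamma> * (U (r n) w (u n))\<^sup>2)"
    using almost_extremal_sequence[OF s p np] by blast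
  define a where "a n = (1/4::real) ^ n" for n :: nat
  have r: "0 \<le> r n" "r n < s" "r n \<le> r (Suc n)" "s - r n \<le> a n" "r n \<in> {0..T}" for n
  proof -
    show "0 \<le> r n" "r n < s" "r n \<le> r (Suc n)" "s - r n \<le> a n" using all unfolding a_def by auto
    then show "r n \<in> {0..T}" using s by simp
  qed
  have u: "ctrl (u n)" and u0: "r n \<le> t \<Longrightarrow> u n t = 0" and \<zeta>: "norm (\<zeta> n) = 1"
    and near: "norm (X (u n) (r n) - p) \<le> 3 * k * a n" for n t
    using all unfolding a_def by auto
  have ineq: "\<zeta> n \<bullet> (X w (r n) - X (u n) (r n)) \<le> 2 * a n - \<gamma> * (U (r n) w (u n))\<^sup>2" if "ctrl w" for n w
    using all that unfolding a_def by blast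
  have a: "0 < a n" "a (Suc n) \<le> a n" for n unfolding a_def by auto
  have a0: "a \<longlonglongrightarrow> 0" unfolding a_def by (rule LIMSEQ_realpow_zero) auto
  define B where "B = sqrt (10 * k / \<gamma>)"
  have B: "0 \<le> B" "B\<^sup>2 = 10 * k / \<gamma>" unfolding B_def using k_ge \<gamma>_pos by auto
  have m1: "1 \<le> m" unfolding m_def by (simp add: Suc_leI)
  \<comment> \<open>The inequality for \<open>u n\<close> is tested with its successor. Both
    endpoints are near \<open>p\<close>, so its left side is at least
    \<open>- (8 * k * a n)\<close>, which leaves no room for a large distance.\<close>
  have cauchy: "U T (u (Suc n)) (u n) \<le> (B + 2 * m) * (1/2) ^ n" for n
  proof -
    define V where "V = U (r n) (u (Suc n)) (u n)"
    have rSn: "\<bar>r n - r (Suc n)\<bar> \<le> a n" using r(3,4)[of n] r(2)[of "Suc n"] by simp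
    have "X (u (Suc n)) (r n) - X (u n) (r n)
        = (X (u (Suc n)) (r n) - X (u (Suc n)) (r (Suc n))) + (X (u (Suc n)) (r (Suc n)) - p) - (X (u n) (r n) - p)"
      by simp
    also have "norm \<dots> \<le> (2 * k * \<bar>r n - r (Suc n)\<bar> + 3 * k * a (Suc n)) + 3 * k * a n"
      by (rule order_trans[OF norm_triangle_ineq4 add_mono[OF norm_triangle_mono[OF X_lipschitz[OF u r(5) r(5)] near] near]])
    also have "\<dots> \<le> (2 * k * a n + 3 * k * a n) + 3 * k * a n"
      using rSn a(2)[of n] k_ge by (intro add_mono mult_left_mono) auto
    finally have "norm (X (u (Suc n)) (r n) - X (u n) (r n)) \<le> 8 * k * a n" by simp
    then have "- (8 * k * a n) \<le> \<zeta> n \<bullet> (X (u (Suc n)) (r n) - X (u n) (r n))"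
      using Cauchy_Schwarz_ineq2[of "\<zeta> n" "X (u (Suc n)) (r n) - X (u n) (r n)"] \<zeta>[of n] by simp
    then have "\<gamma> * V\<^sup>2 \<le> 2 * a n + 8 * k * a n"
      using ineq[OF u[of "Suc n"], of n] unfolding V_def by linarith
    also have "\<dots> \<le> 2 * k * a n + 8 * k * a n" using k_ge a(1)[of n] by (intro add_right_mono mult_right_mono) auto
    finally have "V\<^sup>2 \<le> (10 * k / \<gamma>) * a n" using \<gamma>_pos by (simp add: field_simps)
    also have "\<dots> = (B * (1/2) ^ n)\<^sup>2"
    proof -
      have "((1/2::real) ^ n)\<^sup>2 = a n" unfolding a_def power_mult[symmetric] mult.commute[of n 2] by (simp add: power_mult power2_eq_square)
      then show ?thesis by (simp only: power_mult_distrib B(2))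
    qed
    finally have V: "V \<le> B * (1/2) ^ n" by (rule power2_le_imp_le) (use B in auto)
    have "U T (u (Suc n)) (u n) = U (r (Suc n)) (u (Suc n)) (u n)"
    proof (rule U_eq_if_agree_later[OF u u r(5)])
      fix t assume t: "r (Suc n) \<le> t"
      then have "r n \<le> t" using r(3)[of n] by simp
      then show "u (Suc n) t = u n t" using u0[OF t] u0[of n t] by simp
    qed
    also have "\<dots> \<le> V + 2 * m * (r (Suc n) - r n)"
      unfolding V_def by (rule U_extend[OF u u]) (use r in auto)
    also have "2 * m * (r (Suc n) - r n) \<le> 2 * m * (1/2) ^ n"
    proof (rule mult_left_mono)
      have "a n \<le> (1/2) ^ n" unfolding a_def by (intro power_mono) auto
      then show "r (Suc n) - r n \<le> (1/2) ^ n" using rSn by linarith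
    qed (use m1 in auto)
    finally show ?thesis using V by (simp add: distrib_right)
  qed
  have "\<exists>v :: real \<Rightarrow> real ^ 'm. (\<forall>i. (\<lambda>r. v r $ i) \<in> borel_measurable (lebesgue_on {0..T})) \<and>
           (\<forall>i. \<forall>r. \<bar>v r $ i\<bar> \<le> 1) \<and>
           (\<lambda>n. integral {0..T} (\<lambda>r. \<Sum>i\<in>UNIV. \<bar>u n r $ i - v r $ i\<bar>)) \<longlonglongrightarrow> 0"
    by (rule L1_limit_of_fast_cauchy[OF ctrlD(1)[OF u] ctrlD(3)[OF u] cauchy[unfolded U_def]])
  then obtain v :: "real \<Rightarrow> real ^ 'm" where v: "ctrl v" and lim: "(\<lambda>n. U T (u n) v) \<longlonglongrightarrow> 0"
    unfolding ctrl_def boxed_def U_def by blast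
  have sT: "s \<in> {0..T}" using s by auto
  have rs: "\<bar>r n - s\<bar> \<le> a n" for n using r(2,4)[of n] by simp
  have Xr: "(\<lambda>n. X w (r n)) \<longlonglongrightarrow> X w s" if w: "ctrl w" for w
  proof -
    have "(\<lambda>n. X w (r n) - X w s) \<longlonglongrightarrow> 0"
    proof (rule Lim_null_comparison[OF always_eventually])
      show "\<forall>n. norm (X w (r n) - X w s) \<le> 2 * k * a n"
      proof
        fix n
        have "2 * k * \<bar>r n - s\<bar> \<le> 2 * k * a n" using rs k_ge by (intro mult_left_mono) auto
        then show "norm (X w (r n) - X w s) \<le> 2 * k * a n" using X_lipschitz[OF w sT r(5)] by (rule order_trans[rotated])
      qed
      show "(\<lambda>n. 2 * k * a n) \<longlonglongrightarrow> 0" using tendsto_mult_left[OF a0, of "2 * k"] by simp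
    qed
    then show ?thesis by (simp add: LIM_zero_iff)
  qed
  have Xu: "(\<lambda>n. X (u n) (r n)) \<longlonglongrightarrow> p"
  proof -
    have "(\<lambda>n. X (u n) (r n) - p) \<longlonglongrightarrow> 0"
    proof (rule Lim_null_comparison[OF always_eventually])
      show "\<forall>n. norm (X (u n) (r n) - p) \<le> 3 * k * a n" using near by blast
      show "(\<lambda>n. 3 * k * a n) \<longlonglongrightarrow> 0" using tendsto_mult_left[OF a0, of "3 * k"] by simp
    qed
    then show ?thesis by (simp add: LIM_zero_iff)
  qed
  have vp: "X v s = p"
  proof -
    have "(\<lambda>n. X (u n) (r n) - X v (r n)) \<longlonglongrightarrow> 0"
    proof (rule Lim_null_comparison[OF always_eventually])
      show "\<forall>n. norm (X (u n) (r n) - X v (r n)) \<le> 4 * k * U T (u n) v"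
        using X_diff[OF u v order_refl r(5)] by blast
      show "(\<lambda>n. 4 * k * U T (u n) v) \<longlonglongrightarrow> 0" using tendsto_mult_left[OF lim, of "4 * k"] by simp
    qed
    from tendsto_add[OF this Xr[OF v]] have "(\<lambda>n. X (u n) (r n)) \<longlonglongrightarrow> X v s" by simp
    then show ?thesis using Xu LIMSEQ_unique by blast
  qed
  \<comment> \<open>The normals need only converge along a subsequence: their limit is independent
    of the test control, and the quadratic term is simply dropped.\<close>
  have "\<forall>n. \<zeta> n \<in> sphere 0 1" using \<zeta> by simp
  then obtain z \<phi> where z: "z \<in> sphere 0 1" and \<phi>: "strict_mono (\<phi> :: nat \<Rightarrow> nat)" and \<zeta>z: "(\<zeta> \<circ> \<phi>) \<longlonglongrightarrow> z"
    using compact_sphere[of "0::'a" 1] unfolding compact_def by blast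
  have "z \<bullet> (X w s - p) \<le> 0" if w: "ctrl w" for w
  proof (rule LIMSEQ_le)
    show "(\<lambda>n. (\<zeta> \<circ> \<phi>) n \<bullet> (((\<lambda>n. X w (r n)) \<circ> \<phi>) n - ((\<lambda>n. X (u n) (r n)) \<circ> \<phi>) n)) \<longlonglongrightarrow> z \<bullet> (X w s - p)"
      by (intro tendsto_intros \<zeta>z LIMSEQ_subseq_LIMSEQ[OF Xr[OF w] \<phi>] LIMSEQ_subseq_LIMSEQ[OF Xu \<phi>])
    show "(\<lambda>n. 2 * (a \<circ> \<phi>) n) \<longlonglongrightarrow> 0"
      using tendsto_mult_left[OF LIMSEQ_subseq_LIMSEQ[OF a0 \<phi>], of 2] by simp
    have "\<zeta> n \<bullet> (X w (r n) - X (u n) (r n)) \<le> 2 * a n" for n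
      using ineq[OF w, of n] mult_nonneg_nonneg[OF less_imp_le[OF \<gamma>_pos] zero_le_power2[of "U (r n) w (u n)"]] by linarith
    then show "\<exists>N. \<forall>n\<ge>N. (\<zeta> \<circ> \<phi>) n \<bullet> (((\<lambda>n. X w (r n)) \<circ> \<phi>) n - ((\<lambda>n. X (u n) (r n)) \<circ> \<phi>) n) \<le> 2 * (a \<circ> \<phi>) n"
      by simp
  qed
  then show ?thesis using v vp z by (intro exI[of _ v] exI[of _ z]) auto
qed

text \<open>The least time is taken over the closures, where the infimum is attained by Lipschitz
  dependence on time. As the limit control reaches \<open>p\<close> exactly at that time, it is the
  least time for the reachable sets as well.\<close>

lemma minimal_time_endpoint:
  assumes p: "p \<noteq> 0" "p \<in> R \<tau>" and \<tau>: "\<tau> \<in> {0..T}"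
  shows "\<exists>s u \<zeta>. 0 < s \<and> s \<le> \<tau> \<and> ctrl u \<and> X u s = p \<and> norm \<zeta> = 1 \<and>
    (\<forall>r. 0 \<le> r \<longrightarrow> r < s \<longrightarrow> p \<notin> R r) \<and> (\<forall>w. ctrl w \<longrightarrow> \<zeta> \<bullet> (X w s - p) \<le> 0)"
proof -
  define S where "S = {s \<in> {0..T}. p \<in> closure (R s)}"
  have \<tau>S: "\<tau> \<in> S" unfolding S_def using \<tau> p closure_subset by blast
  have bdd: "bdd_below S" unfolding S_def by (rule bdd_belowI[of _ 0]) auto
  define s where "s = Inf S"
  have s\<tau>: "s \<le> \<tau>" unfolding s_def by (rule cInf_lower[OF \<tau>S bdd])
  \<comment> \<open>The speed bound \<open>2 * k\<close> keeps the infimum away from 0.\<close>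
  have low: "norm p / (2 * k) \<le> t" if "t \<in> S" for t
  proof -
    have t: "t \<in> {0..T}" "p \<in> closure (R t)" using that by (auto simp: S_def)
    have "R t \<subseteq> cball 0 (2 * k * t)" using X_norm_le(1)[OF _ t(1)] by (auto simp: R_def)
    then have "closure (R t) \<subseteq> cball 0 (2 * k * t)" by (rule closure_minimal) simp
    then have "norm p \<le> 2 * k * t" using t(2) by auto
    then show ?thesis using k_ge by (simp add: pos_divide_le_eq mult_ac)
  qed
  have "norm p / (2 * k) \<le> s" unfolding s_def using \<tau>S low by (intro cInf_greatest) auto
  moreover have "0 < norm p / (2 * k)" using p k_ge by simp
  ultimately have s0: "0 < s" by linarith
  have sT: "s \<le> T" using s\<tau> \<tau> by simp
  have np: "p \<notin> closure (R r)" if "0 \<le> r" "r < s" for r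
  proof
    assume "p \<in> closure (R r)"
    then have "r \<in> S" unfolding S_def using that sT by simp
    then have "s \<le> r" unfolding s_def by (rule cInf_lower[OF _ bdd])
    then show False using that by simp
  qed
  have "p \<in> closure (R s)"
    unfolding closure_approachable
  proof (intro allI impI)
    fix e :: real assume e: "0 < e"
    have "s < s + e / (4 * k)" using e k_ge by simp
    then obtain t where t: "t \<in> S" "t < s + e / (4 * k)"
      unfolding s_def using cInf_lessD[of S] \<tau>S by blast
    have ts: "s \<le> t" unfolding s_def by (rule cInf_lower[OF t(1) bdd])
    have tT: "t \<in> {0..T}" "p \<in> closure (R t)" using t(1) by (auto simp: S_def)
    obtain u where u: "ctrl u" and c: "norm (X u t - p) < e / 2"
      using closure_R_approx[OF tT(2), of "e / 2"] e by auto
    have "norm (X u s - X u t) \<le> 2 * k * \<bar>s - t\<bar>"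
      by (rule X_lipschitz[OF u tT(1)]) (use s0 sT in auto)
    also have "\<dots> \<le> 2 * k * (e / (4 * k))" using ts t(2) k_ge by (intro mult_left_mono) auto
    also have "\<dots> = e / 2" using k_ge by simp
    finally have "dist (X u s) p < e" using c norm_triangle_ineq[of "X u s - X u t" "X u t - p"] unfolding dist_norm by simp
    then show "\<exists>y\<in>R s. dist y p < e" using XR[OF u] by blast
  qed
  from extremal_endpoint[OF s0 sT this np] np s\<tau> s0 closure_subset show ?thesis by blast
qed

text \<open>The extended control has zero defect up to \<open>t\<close>. If another control has the
  same endpoint, the strict inequality forces zero L1 distance, and then its own defect is zero too;
  so it coincides with the bang-bang control almost everywhere and cannot vanish on an initial
  interval.\<close>

lemma optimal_extension:
  assumes s: "0 < s" "s < T" and u: "ctrl u" and p: "X u s = p" and \<zeta>: "norm \<zeta> = 1"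
    and ext: "\<And>w. ctrl w \<Longrightarrow> \<zeta> \<bullet> (X w s - p) \<le> 0"
  shows "\<exists>t v. s < t \<and> t < T \<and> ctrl v \<and> X v s = p \<and>
    (\<forall>w d. ctrl w \<longrightarrow> 0 < d \<longrightarrow> d \<le> t \<longrightarrow> (\<forall>r\<in>{0..<d}. w r = 0) \<longrightarrow> X w t \<noteq> X v t)"
proof -
  \<comment> \<open>Where a switching function vanishes at \<open>s\<close>, its sign right after \<open>s\<close> is that of its slope,
    which is close to \<open>- \<zeta> \<bullet> DF 0 (G i 0)\<close>.\<close>
  define e :: "real ^ 'm" where "e = (\<chi> i. if \<zeta> \<bullet> G i p = 0 then (if 0 \<le> \<zeta> \<bullet> DF 0 (G i 0) then -1 else 1)
      else sgn (\<zeta> \<bullet> G i p))"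
  have "boxed e" unfolding boxed_def e_def by (simp add: sgn_if)
  then have ce: "ctrl (\<lambda>_. e)" by (rule ctrl_const)
  define v where "v r = (if r < s then u r else e)" for r
  have v: "ctrl v" unfolding v_def by (rule ctrl_splice[OF u ce])
  have sT: "s \<in> {0..T}" using s by auto
  have vp: "X v s = p" unfolding p[symmetric] by (rule X_eq_if_agree[OF v u sT]) (simp add: v_def)
  \<comment> \<open>The arc runs past \<open>s\<close> along the extended control, so the maximum
    condition on both sides of \<open>s\<close> is tested with the same switching functions.\<close>
  obtain l where l: "adj v l" "l s = \<zeta>" using adj_exists[OF v sT] by blast
  \<comment> \<open>The hypothesis is a proximal inequality with constant 0 at an attained point, so
    the estimate of the defect holds for every \<epsilon> in (0,1].\<close>
  have d0: "defect v l s v = 0"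
  proof -
    define Q where "Q = 384 * k ^ 3 * T * m\<^sup>2 * norm (l s) + 0 * (8 * k * m + 1)\<^sup>2 + norm (l s)"
    have le: "defect v l s v \<le> \<epsilon> * Q" if "0 < \<epsilon>" "\<epsilon> \<le> 1" for \<epsilon>
      unfolding Q_def using ext unfolding l(2)[symmetric] vp[symmetric]
      by (intro defect_le_if_proximal[OF v l(1) sT _ _ that, where p="X v s"]) auto
    have "(\<lambda>n. inverse (real (Suc n)) * Q) \<longlonglongrightarrow> 0 * Q"
      by (intro tendsto_intros LIMSEQ_inverse_real_of_nat)
    then have "defect v l s v \<le> 0 * Q"
    proof (rule LIMSEQ_le_const)
      have "defect v l s v \<le> inverse (real (Suc n)) * Q" for n
        by (rule le) (auto intro: le_imp_inverse_le[of 1, simplified])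
      then show "\<exists>N. \<forall>n\<ge>N. defect v l s v \<le> inverse (real (Suc n)) * Q" by blast
    qed
    then show ?thesis using defect_nonneg[OF v l(1) v] sT by fastforce
  qed
  have "\<forall>\<^sub>F t in at_right s. t < T \<and> 0 \<le> e $ i * \<sigma> v l i t" for i
  proof -
    have \<sigma>s: "\<sigma> v l i s = \<zeta> \<bullet> G i p" unfolding \<sigma>_def l(2) vp ..
    have T': "\<forall>\<^sub>F t in at_right s. t < T" using s(2) by (rule eventually_at_right_less[THEN eventually_mono, rotated] | auto simp: eventually_at_right)+
    have "\<forall>\<^sub>F t in at_right s. 0 \<le> e $ i * \<sigma> v l i t"
    proof (cases "\<zeta> \<bullet> G i p = 0")
      case False
      have "(\<sigma> v l i \<longlongrightarrow> \<sigma> v l i s) (at s within {0..T})"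
        using continuous_\<sigma>[OF v l(1), of i] sT unfolding continuous_on by blast
      then have "(\<sigma> v l i \<longlongrightarrow> \<sigma> v l i s) (at s)"
        using s by (simp add: at_within_Icc_at)
      then have "(\<sigma> v l i \<longlongrightarrow> \<sigma> v l i s) (at_right s)"
        by (rule tendsto_mono[OF at_le[OF subset_UNIV]])
      then have lim: "((\<lambda>t. e $ i * \<sigma> v l i t) \<longlongrightarrow> e $ i * \<sigma> v l i s) (at_right s)"
        by (rule tendsto_mult_left)
      have "0 < e $ i * \<sigma> v l i s"
        unfolding e_def \<sigma>s using False by (simp add: sgn_if)
      from order_tendstoD(1)[OF lim this] show ?thesis by (rule eventually_mono) simp
    next
      case True
      have "\<not> (\<forall>t\<in>{0..T}. c / 4 * norm (l s) \<le> \<bar>\<sigma> v l i t\<bar>)"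
        using sT c \<zeta> True by (auto simp: \<sigma>s l(2) intro!: bexI[of _ s])
      with \<sigma>_cases[OF v l(1) sT, of i]
      have inc: "\<And>t. s \<le> t \<Longrightarrow> t \<le> T \<Longrightarrow> c / 4 * norm (l s) * (t - s)
         \<le> (if 0 \<le> l s \<bullet> DF 0 (G i 0) then -1 else 1) * (\<sigma> v l i t - \<sigma> v l i s)"
        using s by auto
      from T' eventually_at_right_less[of s] show ?thesis
      proof eventually_elim
        case (elim t)
        have "0 \<le> c / 4 * norm (l s) * (t - s)" using c elim by simp
        then show ?case using inc[of t] elim True unfolding e_def \<sigma>s by (simp add: l(2))
      qed
    qed
    with T' show ?thesis by eventually_elim simp
  qed
  then have "\<forall>\<^sub>F t in at_right s. \<forall>i. t < T \<and> 0 \<le> e $ i * \<sigma> v l i t" by (intro eventually_all_finite)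
  then obtain b where b: "s < b" "\<And>t i. s < t \<Longrightarrow> t < b \<Longrightarrow> t < T \<and> 0 \<le> e $ i * \<sigma> v l i t"
    unfolding eventually_at_right_field by blast
  define t where "t = (s + b) / 2"
  have t: "s < t" "t < b" unfolding t_def using b(1) by auto
  have "t < T" using b(2)[OF t] by blast
  then have tT: "t < T" "t \<in> {0..T}" using s t by auto
  have z: "\<bar>\<sigma> v l i r\<bar> * \<bar>bang v l r $ i - v r $ i\<bar> = 0" if r: "r \<in> {s..t} - {s}" for r i
  proof -
    have "0 \<le> e $ i * \<sigma> v l i r" using b(2)[of r i] r t by auto
    moreover have "e $ i = 1 \<or> e $ i = -1" unfolding e_def by (auto simp: sgn_if)
    moreover have "v r = e" unfolding v_def using r by auto
    ultimately show ?thesis unfolding bang_def by auto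
  qed
  have dt: "defect v l t v = 0"
  proof -
    have "integral {0..t} (\<lambda>r. \<bar>\<sigma> v l i r\<bar> * \<bar>bang v l r $ i - v r $ i\<bar>)
        = integral {0..s} (\<lambda>r. \<bar>\<sigma> v l i r\<bar> * \<bar>bang v l r $ i - v r $ i\<bar>)" for i
    proof -
      have "integral {0..s} (\<lambda>r. \<bar>\<sigma> v l i r\<bar> * \<bar>bang v l r $ i - v r $ i\<bar>)
          + integral {s..t} (\<lambda>r. \<bar>\<sigma> v l i r\<bar> * \<bar>bang v l r $ i - v r $ i\<bar>)
          = integral {0..t} (\<lambda>r. \<bar>\<sigma> v l i r\<bar> * \<bar>bang v l r $ i - v r $ i\<bar>)"
        by (rule Henstock_Kurzweil_Integration.integral_combine[OF _ _ defect_integrand(3)[OF v l(1) v]])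
          (use s t tT in auto)
      moreover have "integral {s..t} (\<lambda>r. \<bar>\<sigma> v l i r\<bar> * \<bar>bang v l r $ i - v r $ i\<bar>) = integral {s..t} (\<lambda>r. 0)"
        by (rule integral_spike[of "{s}"]) (use z[of _ i] in auto)
      ultimately show ?thesis by simp
    qed
    then show ?thesis using d0 unfolding defect_def by simp
  qed
  have lt: "0 < norm (l t)" using adj_norm_le[OF v l(1) tT(2) sT] \<zeta> unfolding l(2) by linarith
  have "X w t \<noteq> X v t" if w: "ctrl w" and d: "0 < d" "d \<le> t" and w0: "\<And>r. r \<in> {0..<d} \<Longrightarrow> w r = 0" for w d
  proof
    assume eq: "X w t = X v t"
    have "\<gamma> * norm (l t) * (U t w v)\<^sup>2 \<le> 0"
      using strict_maximum_inequality[OF v l(1) w tT(2)] unfolding eq dt by simp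
    then have U0: "U t w v = 0" using \<gamma>_pos lt by (simp add: mult_le_0_iff)
    have dw: "defect v l t w = 0"
      using pairing_estimate[OF v w l(1) tT(2)]
      unfolding integral_pairing_eq_defects[OF v l(1) w tT(2)] eq U0 dt by simp
    \<comment> \<open>Any single input leads to the contradiction.\<close>
    obtain i :: 'm where True by blast
    define g where "g j = (integral {0..t} (\<lambda>r. \<bar>bang v l r $ j - w r $ j\<bar>))\<^sup>2" for j
    have "c / 128 * norm (l t) * (\<Sum>j\<in>UNIV. g j) \<le> 0"
      using defect_ge[OF v l(1) w tT(2)] unfolding dw g_def .
    then have "(\<Sum>j\<in>UNIV. g j) \<le> 0" using c lt by (simp add: mult_le_0_iff)
    moreover have "g i \<le> (\<Sum>j\<in>UNIV. g j)" by (rule member_le_sum) (auto simp: g_def)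
    moreover have "0 \<le> g i" by (simp add: g_def)
    ultimately have "g i = 0" by linarith
    then have I0: "integral {0..t} (\<lambda>r. \<bar>bang v l r $ i - w r $ i\<bar>) = 0" by (simp add: g_def)
    have bi: "(\<lambda>r. \<bar>bang v l r $ i - w r $ i\<bar>) integrable_on {a..b}" if "0 \<le> a" "b \<le> T" for a b
      by (rule bounded_measurable_integrable[OF defect_integrand(1)[OF v l(1) w] _ that])
        (use defect_integrand(2)[OF v l(1) w] in auto)
    \<comment> \<open>On \<open>{0..<d}\<close> the distance of \<open>bang v l\<close> from the
      value 0 is exactly 1.\<close>
    have "d = integral {0..d} (\<lambda>r. 1)" using d by simp
    also have "\<dots> = integral {0..d} (\<lambda>r. \<bar>bang v l r $ i - w r $ i\<bar>)"
      by (rule integral_spike[of "{d}"]) (use w0 in \<open>auto simp: bang_def\<close>)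
    also have "\<dots> \<le> integral {0..t} (\<lambda>r. \<bar>bang v l r $ i - w r $ i\<bar>)"
      by (rule integral_subset_le) (use bi d tT in auto)
    finally show False using I0 d by simp
  qed
  then show ?thesis using t(1) tT(1) v vp by blast
qed

subsection \<open>Admissible controls and time reversal\<close>

text \<open>Living on the whole line, these controls may be reflected about any time, and they are
  admissible without exceptional null sets.\<close>

definition box_ctrl :: "(real \<Rightarrow> real ^ 'm) \<Rightarrow> bool" where
  "box_ctrl v \<longleftrightarrow> (\<forall>i. (\<lambda>r. v r $ i) \<in> borel_measurable lebesgue) \<and> (\<forall>r. boxed (v r))"

lemma box_ctrl_imp_ctrl: "box_ctrl v \<Longrightarrow> ctrl v"
  unfolding box_ctrl_def ctrl_def by (auto intro: measurable_restrict_space1)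

lemma box_ctrl_imp_admissible: "box_ctrl v \<Longrightarrow> admissible v"
  unfolding box_ctrl_def admissible_def boxed_def borel_measurable_vec_iff
  by (auto intro: measurable_restrict_space1 simp: abs_le_iff minus_le_iff)

lemma box_ctrl_restrict:
  assumes "ctrl w" shows "box_ctrl (\<lambda>r. if r \<in> {0..T} then w r else 0)"
  unfolding box_ctrl_def
proof (intro conjI allI)
  fix i
  have "(\<lambda>r. if r \<in> {0..T} then w r $ i else 0) \<in> borel_measurable lebesgue"
    by (rule borel_measurable_if_I[OF ctrlD(1)[OF assms]]) auto
  moreover have "(\<lambda>r. if r \<in> {0..T} then w r $ i else 0) = (\<lambda>r. (if r \<in> {0..T} then w r else 0) $ i)"
    by auto
  ultimately show "(\<lambda>r. (if r \<in> {0..T} then w r else 0) $ i) \<in> borel_measurable lebesgue" by (simp only:)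
  show "boxed (if r \<in> {0..T} then w r else 0)" for r
    using ctrlD(2)[OF assms, of r] by (auto simp: boxed_def)
qed

text \<open>Clipping to the cube and extension by 0 to negative times change the control on
  \<open>{0..}\<close> only on a null set, which no integral sees.\<close>

lemma admissible_box_ctrl:
  assumes "admissible u"
  shows "\<exists>v N. box_ctrl v \<and> negligible N \<and> (\<forall>r\<in>{0..} - N. v r = u r)"
proof -
  have um: "(\<lambda>r. u r $ i) \<in> borel_measurable (lebesgue_on {0..})" for i
    using assms unfolding admissible_def borel_measurable_vec_iff by blast
  have "AE t in lebesgue_on {0..}. \<forall>i. u t $ i \<in> {-1..1}"
    using assms unfolding admissible_def by blast
  then have "AE t in lebesgue. t \<in> {0..} \<longrightarrow> (\<forall>i. u t $ i \<in> {-1..1})"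
    by (subst (asm) AE_restrict_space_iff) auto
  then obtain N where N: "{t. \<not> (t \<in> {0..} \<longrightarrow> (\<forall>i. u t $ i \<in> {-1..1}))} \<subseteq> N" "N \<in> null_sets lebesgue"
    unfolding eventually_ae_filter by auto
  define v where "v r = (\<chi> i. max (-1) (min 1 (if r \<in> {0..} then u r $ i else 0)))" for r
  have "box_ctrl v"
    unfolding box_ctrl_def
  proof (intro conjI allI)
    fix i
    have [measurable]: "(\<lambda>r. if r \<in> {0..} then u r $ i else 0) \<in> borel_measurable lebesgue"
      by (rule borel_measurable_if_I[OF um]) auto
    show "(\<lambda>r. v r $ i) \<in> borel_measurable lebesgue" unfolding v_def vec_lambda_beta by measurable
    show "boxed (v r)" for r unfolding boxed_def v_def by auto
  qed
  moreover have "v r = u r" if r: "r \<in> {0..} - N" for r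
  proof -
    have "u r $ i \<in> {-1..1}" for i using N(1) r by blast
    then have "max (-1) (min 1 (u r $ i)) = u r $ i" for i by (simp add: max_def min_def eq_iff)
    then show ?thesis using r unfolding v_def vec_eq_iff by simp
  qed
  ultimately show ?thesis using N(2) by (auto simp: negligible_iff_null_sets)
qed

lemma admissible_replace:
  assumes "admissible u"
    and h: "\<And>s. s \<in> {0..t} \<Longrightarrow> ((\<lambda>r. g (y r) (u r)) has_integral h s) {0..s}"
  shows "\<exists>v. box_ctrl v \<and> (\<forall>s\<in>{0..t}. ((\<lambda>r. g (y r) (v r)) has_integral h s) {0..s})"
proof -
  obtain v N where v: "box_ctrl v" "negligible N" "\<And>r. r \<in> {0..} - N \<Longrightarrow> v r = u r"
    using admissible_box_ctrl[OF assms(1)] by blast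
  have "((\<lambda>r. g (y r) (v r)) has_integral h s) {0..s}" if "s \<in> {0..t}" for s
    by (rule has_integral_spike[OF v(2) _ h[OF that]]) (use v(3) in auto)
  then show ?thesis using v(1) by blast
qed

lemma box_ctrl_reverse:
  assumes "box_ctrl v" shows "box_ctrl (\<lambda>r. v (t - r))"
proof -
  have "(\<lambda>x. t + (\<Sum>j\<in>Basis. (-1 * (x \<bullet> j)) *\<^sub>R j)) \<in> lebesgue \<rightarrow>\<^sub>M (lebesgue :: real measure)"
    by (rule lebesgue_affine_measurable) auto
  then have "(\<lambda>r. t - r) \<in> lebesgue \<rightarrow>\<^sub>M lebesgue" by simp
  then show ?thesis using assms unfolding box_ctrl_def by (auto intro: measurable_compose)
qed

text \<open>A trajectory reaching the origin at time \<open>t\<close> may rest there until \<open>t1\<close>; run backwards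
  from \<open>t1\<close> it becomes a trajectory of the present system that starts by resting at the origin.\<close>

lemma reverse_to_origin:
  assumes v: "box_ctrl v" and y: "continuous_on {0..t} y" "y t = 0" and t: "0 \<le> t" "t \<le> t1" "t1 \<le> T"
    and h: "\<And>s. s \<in> {0..t} \<Longrightarrow> ((\<lambda>r. - f (y r) (v r)) has_integral y s - x) {0..s}"
  shows "\<exists>w. ctrl w \<and> X w t1 = x \<and> (\<forall>r\<in>{0..<t1 - t}. w r = 0)"
proof -
  have y0: "y 0 = x"
    using has_integral_unique[OF h[of 0] has_integral_null_real[of 0 0]] t(1) by simp
  define y1 where "y1 r = (if r \<le> t then y r else 0)" for r
  define v1 where "v1 r = (if r \<le> t then v r else 0)" for r
  have v1: "box_ctrl v1"
    unfolding box_ctrl_def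
  proof (intro conjI allI)
    fix i
    have "(\<lambda>r. v r $ i) \<in> borel_measurable (lebesgue_on {..t})"
      using v unfolding box_ctrl_def by (auto intro: measurable_restrict_space1)
    then have "(\<lambda>r. if r \<in> {..t} then v r $ i else 0) \<in> borel_measurable lebesgue"
      by (rule borel_measurable_if_I) auto
    moreover have "(\<lambda>r. if r \<in> {..t} then v r $ i else 0) = (\<lambda>r. v1 r $ i)"
      unfolding v1_def by auto
    ultimately show "(\<lambda>r. v1 r $ i) \<in> borel_measurable lebesgue" by (simp only:)
    show "boxed (v1 r)" for r using v unfolding box_ctrl_def boxed_def v1_def by auto
  qed
  have f0: "f 0 0 = 0" unfolding f_def by (simp add: F0)
  have z: "((\<lambda>r. - f (y1 r) (v1 r)) has_integral 0) {a..t1}" if "t \<le> a" for a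
  proof (rule has_integral_spike[of "{t}" _ _ "\<lambda>_. 0"])
    fix r assume "r \<in> {a..t1} - {t}"
    then show "- f (y1 r) (v1 r) = 0" using that f0 by (auto simp: y1_def v1_def)
  qed auto
  have H: "((\<lambda>r. - f (y1 r) (v1 r)) has_integral - y1 a) {a..t1}" if a: "a \<in> {0..t1}" for a
  proof (cases "t \<le> a")
    case True
    then have "y1 a = 0" using y(2) by (auto simp: y1_def)
    then show ?thesis using z[OF True] by simp
  next
    case False
    then have at: "0 \<le> a" "a \<le> t" using a by auto
    have "((\<lambda>r. - f (y r) (v r)) has_integral (y t - x) - (y a - x)) {a..t}"
      by (rule has_integral_Icc_diff[OF h h]) (use at t in auto)
    then have "((\<lambda>r. - f (y1 r) (v1 r)) has_integral (y t - x) - (y a - x)) {a..t}"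
      by (rule has_integral_eq[rotated]) (auto simp: y1_def v1_def)
    from has_integral_combine[OF at(2) t(2) this z[OF order_refl]]
    show ?thesis using y(2) at by (simp add: y1_def)
  qed
  define w where "w r = v1 (t1 - r)" for r
  define zz where "zz r = y1 (t1 - r)" for r
  have w: "ctrl w" unfolding w_def by (intro box_ctrl_imp_ctrl box_ctrl_reverse v1)
  have "continuous_on {0..t1} y1"
  proof -
    have "continuous_on ({0..t} \<union> {t..t1}) (\<lambda>r. if r \<le> t then y r else 0)"
      by (rule continuous_on_cases) (use y in auto)
    moreover have "{0..t} \<union> {t..t1} = {0..t1}" using t by auto
    ultimately show ?thesis unfolding y1_def by simp
  qed
  then have "continuous_on {0..t1} zz"
    unfolding zz_def by (rule continuous_on_compose2) (auto intro!: continuous_intros)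
  moreover have "((\<lambda>r. f (zz r) (w r)) has_integral zz s) {0..s}" if s: "s \<in> {0..t1}" for s
  proof -
    have "((\<lambda>r. - f (y1 (t1 - r)) (v1 (t1 - r))) has_integral - y1 (t1 - s)) {0..s}"
      by (rule has_integral_reverse[of "\<lambda>r. - f (y1 r) (v1 r)"]) (use H[of "t1 - s"] s in auto)
    from has_integral_neg[OF this] show ?thesis unfolding w_def zz_def by simp
  qed
  ultimately have "traj t1 w zz" unfolding traj_def by blast
  from traj_unique[OF w this t(3), of t1] have "X w t1 = zz t1" using t by simp
  also have "\<dots> = x" unfolding zz_def y1_def using t y0 by simp
  finally have "X w t1 = x" .
  moreover have "\<forall>r\<in>{0..<t1 - t}. w r = 0" unfolding w_def v1_def by auto
  ultimately show ?thesis using w by blast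
qed

lemma reverse_from_origin:
  assumes w: "ctrl w" and t1: "t1 \<in> {0..T}"
  shows "\<exists>v. admissible v \<and> continuous_on {0..t1} (\<lambda>r. X w (t1 - r)) \<and>
    (\<forall>s\<in>{0..t1}. ((\<lambda>r. - f (X w (t1 - r)) (v r)) has_integral X w (t1 - s) - X w t1) {0..s})"
proof -
  \<comment> \<open>Outside \<open>{0..T}\<close> nothing is known of \<open>w\<close>, not even
    measurability; the truncation makes its reflection admissible.\<close>
  define w' where "w' r = (if r \<in> {0..T} then w r else 0)" for r
  define v where "v r = w' (t1 - r)" for r
  have "admissible v"
    unfolding v_def w'_def by (intro box_ctrl_imp_admissible box_ctrl_reverse[OF box_ctrl_restrict[OF w]])
  moreover have "continuous_on {0..t1} (\<lambda>r. X w (t1 - r))"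
    by (rule continuous_on_compose2[OF continuous_X[OF w]]) (use t1 in \<open>auto intro!: continuous_intros\<close>)
  moreover have "((\<lambda>r. - f (X w (t1 - r)) (v r)) has_integral X w (t1 - s) - X w t1) {0..s}" if s: "s \<in> {0..t1}" for s
  proof -
    have "((\<lambda>r. f (X w r) (w r)) has_integral X w t1 - X w (t1 - s)) {t1 - s..t1}"
      by (rule traj_has_integral[OF traj_X[OF w]]) (use s t1 in auto)
    then have "((\<lambda>r. f (X w r) (w' r)) has_integral X w t1 - X w (t1 - s)) {t1 - s..t1}"
      by (rule has_integral_eq[rotated]) (use s t1 in \<open>auto simp: w'_def\<close>)
    from has_integral_neg[OF has_integral_reverse[OF this]] show ?thesis unfolding v_def by simp
  qed
  ultimately show ?thesis by blast
qed

text \<open>Reversing time negates all fields. The two signs in \<open>- DF x (- G i x)\<close>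
  cancel, so the rank condition survives with the same constants.\<close>

lemma control_system_uminus:
  "control_system (\<lambda>x. - F x) (\<lambda>x v. - DF x v) (\<lambda>i x. - G i x) (\<lambda>i x v. - DG i x v) K c T k m"
proof (rule control_system.intro)
  show "linear (\<lambda>v. - DF x v)" "linear (\<lambda>v. - DG i x v)" for x i
    by (intro linear_compose_neg linF linG)+
  show "norm (- F y - - F x - - DF x (y - x)) \<le> K * (norm (y - x))\<^sup>2" for x y
    using remF[of y x] norm_minus_cancel[of "F y - F x - DF x (y - x)"] by (simp add: algebra_simps)
  show "norm (- G i y - - G i x - - DG i x (y - x)) \<le> K * (norm (y - x))\<^sup>2" for i x y
    using remG[of i y x] norm_minus_cancel[of "G i y - G i x - DG i x (y - x)"] by (simp add: algebra_simps)
  show "norm (- DF x v - - DF y v) \<le> K * norm (x - y) * norm v" for x y v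
    using lipF[of x v y] by (simp add: norm_minus_commute)
  show "norm (- DG i x v - - DG i y v) \<le> K * norm (x - y) * norm v" for i x y v
    using lipG[of i x v y] by (simp add: norm_minus_commute)
  show "c * norm l \<le> \<bar>l \<bullet> - G i 0\<bar> + \<bar>l \<bullet> - DF 0 (- G i 0)\<bar>" for l i
    using nondegenerate[of l i] linear_neg[OF linF[of 0], of "G i 0"] by simp
qed (use F0 DG0 DF0 G0 K c T m_def k_def small in auto)

end

section \<open>Minimum times, and the given data as an instance of the estimates\<close>

lemma min_time_eqI:
  assumes s: "0 \<le> s" and st: "\<exists>u y. admissible u \<and> trajectory F G x u s y \<and> y s = 0"
    and none: "\<And>t u y. 0 \<le> t \<Longrightarrow> t < s \<Longrightarrow> admissible u \<Longrightarrow> trajectory F G x u t y \<Longrightarrow> y t \<noteq> 0"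
  shows "min_time F G x = ereal s"
proof (rule antisym)
  obtain u y where u: "admissible u" "trajectory F G x u s y" "y s = 0" using st by blast
  have "min_time F G x \<le> Inf {ereal t |t. 0 \<le> t \<and> (\<exists>y. trajectory F G x u t y \<and> y t = 0)}"
    unfolding min_time_def by (rule INF_lower) (use u in simp)
  also have "\<dots> \<le> ereal s" by (rule Inf_lower) (use u s in blast)
  finally show "min_time F G x \<le> ereal s" .
  show "ereal s \<le> min_time F G x"
    unfolding min_time_def
  proof (intro INF_greatest Inf_greatest)
    fix u e assume u: "u \<in> {u. admissible u}" and e: "e \<in> {ereal t |t. 0 \<le> t \<and> (\<exists>y. trajectory F G x u t y \<and> y t = 0)}"
    then obtain t y where "e = ereal t" "0 \<le> t" "trajectory F G x u t y" "y t = 0" by blast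
    then show "ereal s \<le> e" using none[of t u y] u by force
  qed
qed

lemma min_time_less_obtain:
  assumes "min_time F G x < ereal T"
  obtains u t y where "admissible u" "0 \<le> t" "t < T" "trajectory F G x u t y" "y t = 0"
proof -
  obtain u where u: "admissible u" "Inf {ereal t |t. 0 \<le> t \<and> (\<exists>y. trajectory F G x u t y \<and> y t = 0)} < ereal T"
    using assms unfolding min_time_def INF_less_iff by blast
  then obtain e where "e \<in> {ereal t |t. 0 \<le> t \<and> (\<exists>y. trajectory F G x u t y \<and> y t = 0)}" "e < ereal T"
    unfolding Inf_less_iff by blast
  then obtain t y where "ereal t < ereal T" "0 \<le> t" "trajectory F G x u t y" "y t = 0" by blast
  then show thesis using that[OF u(1)] by simp
qed

text \<open>The two pairings of \<open>l\<close> are the coordinates of its image under the matrix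
  with rows \<open>b\<close> and \<open>d\<close>, which is injective by full rank and hence bounded
  below.\<close>

lemma rank_2_coercive:
  fixes b d :: "real ^ 2"
  assumes "rank (transpose (vector [b, d]) :: real ^ 2 ^ 2) = 2"
  shows "\<exists>c>0. \<forall>l. c * norm l \<le> \<bar>l \<bullet> b\<bar> + \<bar>l \<bullet> d\<bar>"
proof -
  let ?N = "vector [b, d] :: real ^ 2 ^ 2"
  have "rank ?N = CARD(2)" using assms by (simp add: rank_transpose)
  then have "inj ((*v) ?N)" by (simp only: full_rank_injective)
  then obtain c where c: "c > 0" "\<And>l. c * norm l \<le> norm (?N *v l)"
    using linear_inj_bounded_below_pos[OF matrix_vector_mul_linear] by blast
  have "norm (?N *v l) \<le> \<bar>l \<bullet> b\<bar> + \<bar>l \<bullet> d\<bar>" for l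
    using norm_le_l1_cart[of "?N *v l"]
    by (simp add: UNIV_2 matrix_vector_mul_component inner_commute)
  then show ?thesis using c by (meson order_trans)
qed

lemma linear_column: "linear (\<lambda>M :: real ^ 'm ^ 'n. column i M)"
  by (rule linearI) (auto simp: column_def vec_eq_iff)

lemma norm_column_le: "norm (column i M) \<le> norm (M :: real ^ 'm ^ 'n)"
  by (rule norm_le_componentwise_cart) (simp add: column_def component_le_norm_cart)

text \<open>Uniqueness of derivatives identifies \<open>total_deriv\<close> at the origin with the
  prescribed data, so the constants refer to \<open>A\<close> and \<open>G 0\<close> only.\<close>

lemma control_system_C11:
  fixes F :: "real ^ 2 \<Rightarrow> real ^ 2" and G :: "real ^ 2 \<Rightarrow> real ^ 'm ^ 2"
  assumes F: "C11_with L F" "F 0 = 0" "(F has_derivative (\<lambda>v. A *v v)) (at 0)"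
    and G: "C11_with L G" "(G has_derivative (\<lambda>v. 0)) (at 0)"
    and K: "1 \<le> K" "3 * L \<le> K" "onorm ((*v) A) \<le> K" "\<And>i. norm (column i (G 0)) \<le> K"
    and c: "0 < c" "\<And>i l. c * norm l \<le> \<bar>l \<bullet> column i (G 0)\<bar> + \<bar>l \<bullet> (A *v column i (G 0))\<bar>"
    and T: "0 < T" "T \<le> 1" and k: "m = real CARD('m)" "k = K * (1 + m)"
    and small: "16 * k * T \<le> 1" "100000 * k ^ 4 * T \<le> c"
  shows "control_system F (total_deriv F) (\<lambda>i x. column i (G x)) (\<lambda>i x v. column i (total_deriv G x v)) K c T k m"
proof -
  have L: "0 \<le> L" using F(1) unfolding C11_with_def lipschitz_on_def by auto
  have dF: "total_deriv F 0 = (\<lambda>v. A *v v)"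
    by (rule has_derivative_unique[OF has_derivative_if_quadratic_remainder[OF linear_total_deriv C11_with_remainder[OF F(1)]] F(3)])
  have dG: "total_deriv G 0 = (\<lambda>v. 0)"
    by (rule has_derivative_unique[OF has_derivative_if_quadratic_remainder[OF linear_total_deriv C11_with_remainder[OF G(1)]] G(2)])
  have rem: "3 * L * (norm v)\<^sup>2 \<le> K * (norm v)\<^sup>2" for v :: "real ^ 2"
    using K(2) by (intro mult_right_mono) auto
  have lip: "2 * L * norm v * norm w \<le> K * norm v * norm w" for v w :: "real ^ 2"
    using K(2) L by (intro mult_right_mono) auto
  have col: "column i (M - N - P) = column i M - column i N - column i P" for i :: 'm and M N P :: "real ^ 'm ^ 2"
    by (simp add: linear_diff[OF linear_column])
  show ?thesis
  proof (rule control_system.intro)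
    show "linear (\<lambda>v. total_deriv F x v)" for x by (rule linear_total_deriv)
    show "linear (\<lambda>v. column i (total_deriv G x v))" for i x
      using linear_compose[OF linear_total_deriv linear_column] by (simp add: o_def)
    show "norm (F y - F x - total_deriv F x (y - x)) \<le> K * (norm (y - x))\<^sup>2" for x y
      by (rule order_trans[OF C11_with_remainder[OF F(1)] rem])
    show "norm (column i (G y) - column i (G x) - column i (total_deriv G x (y - x))) \<le> K * (norm (y - x))\<^sup>2" for i x y
      unfolding col[symmetric] by (rule order_trans[OF norm_column_le order_trans[OF C11_with_remainder[OF G(1)] rem]])
    show "norm (total_deriv F x v - total_deriv F y v) \<le> K * norm (x - y) * norm v" for x y v
      by (rule order_trans[OF C11_with_total_deriv_lipschitz[OF F(1)] lip])
    show "norm (column i (total_deriv G x v) - column i (total_deriv G y v)) \<le> K * norm (x - y) * norm v" for i x y v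
      unfolding linear_diff[OF linear_column, symmetric]
      by (rule order_trans[OF norm_column_le order_trans[OF C11_with_total_deriv_lipschitz[OF G(1)] lip]])
    show "column i (total_deriv G 0 v) = 0" for i v
      unfolding dG by (rule linear_0[OF linear_column])
    show "norm (total_deriv F 0 v) \<le> K * norm v" for v
      unfolding dF by (rule order_trans[OF onorm[OF matrix_vector_mul_bounded_linear] mult_right_mono[OF K(3)]]) simp
    show "c * norm l \<le> \<bar>l \<bullet> column i (G 0)\<bar> + \<bar>l \<bullet> total_deriv F 0 (column i (G 0))\<bar>" for l i
      unfolding dF by (rule c(2))
  qed (use F(2) K c(1) T k small in auto)
qed

section \<open>Transfer to reachable sets, minimum times and optimal points\<close>

locale control_system_cart = control_system F DF G DG K c T k m
  for F :: "real ^ 'n \<Rightarrow> real ^ 'n" and DF and G :: "'m::finite \<Rightarrow> real ^ 'n \<Rightarrow> real ^ 'n" and DG K c T k m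
begin

lemma reachable_eq_R:
  assumes f: "\<And>x u. f x u = F' x + G' x *v u" and \<tau>: "\<tau> \<in> {0..T}"
  shows "reachable F' G' \<tau> = R \<tau>"
proof (intro equalityI subsetI)
  fix z assume "z \<in> reachable F' G' \<tau>"
  then obtain y u where z: "z = y \<tau>" and u: "admissible u" and y: "trajectory F' G' 0 u \<tau> y"
    unfolding reachable_def by blast
  have "((\<lambda>r. f (y r) (u r)) has_integral y s) {0..s}" if "s \<in> {0..\<tau>}" for s
    using y that unfolding trajectory_def f by simp
  from admissible_replace[OF u, where g=f and y=y and h=y, OF this] obtain v where v: "box_ctrl v"
    "\<And>s. s \<in> {0..\<tau>} \<Longrightarrow> ((\<lambda>r. f (y r) (v r)) has_integral y s) {0..s}" by blast
  have "traj \<tau> v y" using v(2) y unfolding traj_def trajectory_def by blast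
  then have "z = X v \<tau>" unfolding z
    by (rule traj_unique[OF box_ctrl_imp_ctrl[OF v(1)]]) (use \<tau> in auto)
  then show "z \<in> R \<tau>" using XR[OF box_ctrl_imp_ctrl[OF v(1)]] by simp
next
  fix z assume "z \<in> R \<tau>"
  then obtain w where w: "ctrl w" and z: "z = X w \<tau>" unfolding R_def by blast
  define v where "v r = (if r \<in> {0..T} then w r else 0)" for r
  have v: "box_ctrl v" unfolding v_def by (rule box_ctrl_restrict[OF w])
  have cv: "ctrl v" by (rule box_ctrl_imp_ctrl[OF v])
  have z: "z = X v \<tau>" unfolding z by (rule X_eq_if_agree[OF w cv \<tau>]) (use \<tau> in \<open>auto simp: v_def\<close>)
  have "trajectory F' G' 0 v \<tau> (X v)"
    using traj_restrict[OF traj_X[OF cv], of \<tau>] \<tau> unfolding traj_def trajectory_def f by auto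
  then show "z \<in> reachable F' G' \<tau>"
    unfolding reachable_def z using box_ctrl_imp_admissible[OF v] by blast
qed

text \<open>Here the locale describes the reversed system: its trajectories leave the origin, those
  of \<open>F'\<close> and \<open>G'\<close> run into it. The point of larger minimum time is the
  endpoint \<open>X v t\<close> of the extended trajectory, which backwards passes through
  \<open>x\<close>.\<close>

lemma optimal_point_if_reversed:
  assumes f: "\<And>x u. - f x u = F' x + G' x *v u" and x: "x \<noteq> 0" and mt: "min_time F' G' x < ereal T"
  shows "optimal_point F' G' x"
proof -
  have bwd: "\<exists>w. ctrl w \<and> X w t1 = z \<and> (\<forall>r\<in>{0..<t1 - t}. w r = 0)"
    if u: "admissible u" "trajectory F' G' z u t y" "y t = 0" and t: "0 \<le> t" "t \<le> t1" "t1 \<le> T" for z u t y t1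
  proof -
    have "((\<lambda>r. - f (y r) (u r)) has_integral y s - z) {0..s}" if "s \<in> {0..t}" for s
      using u(2) that unfolding trajectory_def f by simp
    from admissible_replace[OF u(1), where g="\<lambda>x u. - f x u" and y=y and h="\<lambda>s. y s - z", OF this] obtain v where v: "box_ctrl v"
      "\<And>s. s \<in> {0..t} \<Longrightarrow> ((\<lambda>r. - f (y r) (v r)) has_integral y s - z) {0..s}" by blast
    have "continuous_on {0..t} y" using u(2) unfolding trajectory_def by blast
    from reverse_to_origin[OF v(1) this u(3) t v(2)] show ?thesis .
  qed
  have forth: "\<exists>u. admissible u \<and> trajectory F' G' (X w t1) u t1 (\<lambda>r. X w (t1 - r))"
    if w: "ctrl w" and t1: "t1 \<in> {0..T}" for w t1
    using reverse_from_origin[OF that] unfolding trajectory_def f by blast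
  have X0: "X w 0 = 0" if "ctrl w" for w using traj_0[OF traj_X[OF that]] T by simp
  obtain u0 t0 y0 where t0: "admissible u0" "0 \<le> t0" "t0 < T" "trajectory F' G' x u0 t0 y0" "y0 t0 = 0"
    using min_time_less_obtain[OF mt] by blast
  obtain w0 where w0: "ctrl w0" "X w0 t0 = x" using bwd[OF t0(1,4,5,2) order_refl] t0(3) by auto
  then have "x \<in> R t0" using XR by blast
  moreover have "t0 \<in> {0..T}" using t0 by simp
  ultimately obtain s u \<zeta> where s: "0 < s" "s \<le> t0" and u: "ctrl u" "X u s = x" and \<zeta>: "norm \<zeta> = 1"
    and min: "\<And>r. 0 \<le> r \<Longrightarrow> r < s \<Longrightarrow> x \<notin> R r" and ext: "\<And>w. ctrl w \<Longrightarrow> \<zeta> \<bullet> (X w s - x) \<le> 0"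
    using minimal_time_endpoint[OF x] by metis
  have sT: "s < T" using s t0 by simp
  obtain t v where t: "s < t" "t < T" and v: "ctrl v" "X v s = x"
    and opt: "\<And>w d. ctrl w \<Longrightarrow> 0 < d \<Longrightarrow> d \<le> t \<Longrightarrow> \<forall>r\<in>{0..<d}. w r = 0 \<Longrightarrow> X w t \<noteq> X v t"
    using optimal_extension[OF s(1) sT u \<zeta> ext] by metis
  have tT: "t \<in> {0..T}" "s \<in> {0..T}" using t s by auto
  obtain u1 where u1: "admissible u1" "trajectory F' G' (X v t) u1 t (\<lambda>r. X v (t - r))"
    using forth[OF v(1) tT(1)] by blast
  obtain u2 where u2: "admissible u2" "trajectory F' G' (X v s) u2 s (\<lambda>r. X v (s - r))"
    using forth[OF v(1) tT(2)] by blast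
  have "min_time F' G' x = ereal s"
  proof (rule min_time_eqI)
    show "\<exists>u y. admissible u \<and> trajectory F' G' x u s y \<and> y s = 0"
      using u2 X0[OF v(1)] unfolding v(2) by (intro exI[of _ u2] exI[of _ "\<lambda>r. X v (s - r)"]) simp
    fix r u y assume r: "0 \<le> r" "r < s" and u: "admissible u" "trajectory F' G' x u r y"
    show "y r \<noteq> 0"
    proof
      assume "y r = 0"
      then obtain w where "ctrl w" "X w r = x"
        using bwd[OF u _ r(1) order_refl] r sT by auto
      then show False using min[OF r] XR by blast
    qed
  qed (use s in simp)
  \<comment> \<open>An arrival at some \<open>r < t\<close>, prolonged by resting at the origin,
    reverses into a control that vanishes on \<open>{0..<t - r}\<close> and still ends at
    \<open>X v t\<close>; \<open>opt\<close> forbids this.\<close>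
  moreover have "min_time F' G' (X v t) = ereal t"
  proof (rule min_time_eqI)
    show "\<exists>u y. admissible u \<and> trajectory F' G' (X v t) u t y \<and> y t = 0"
      using u1 X0[OF v(1)] by (intro exI[of _ u1] exI[of _ "\<lambda>r. X v (t - r)"]) simp
    fix r u y assume r: "0 \<le> r" "r < t" and u: "admissible u" "trajectory F' G' (X v t) u r y"
    show "y r \<noteq> 0"
    proof
      assume "y r = 0"
      then obtain w where w: "ctrl w" "X w t = X v t" "\<forall>q\<in>{0..<t - r}. w q = 0"
        using bwd[OF u _ r(1), of t] r t by auto
      then show False using opt[OF w(1), of "t - r"] r by simp
    qed
  qed (use s t in simp)
  ultimately show ?thesis
    unfolding optimal_point_def using x u1 t(1) v X0[OF v(1)]
    by (intro conjI exI[of _ "X v t"] exI[of _ u1] exI[of _ "\<lambda>r. X v (t - r)"] exI[of _ t] exI[of _ s]) auto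
qed

end

theorem theorem6p2:
  fixes L :: real and A :: "real ^ 2 ^ 2" and B :: "real ^ 'm ^ 2"
  assumes "CARD('m) \<in> {1, 2}"
    and "\<forall>i. rank (transpose (vector [column i B, A *v column i B]) :: real ^ 2 ^ 2) = 2"
  shows "\<exists>\<T>>0. \<exists>\<gamma>>0.
    \<forall>(F :: real ^ 2 \<Rightarrow> real ^ 2) (G :: real ^ 2 \<Rightarrow> real ^ 'm ^ 2).
      C11_with L F \<and> C11_with L G \<and>
      F 0 = 0 \<and> (F has_derivative (\<lambda>v. A *v v)) (at 0) \<and>
      G 0 = B \<and> (G has_derivative (\<lambda>v. 0)) (at 0) \<longrightarrow>
      (\<forall>\<tau> x1 x2 \<zeta>. 0 < \<tau> \<and> \<tau> < \<T> \<and>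
         x1 \<in> frontier (reachable F G \<tau>) \<and> x2 \<in> reachable F G \<tau> \<and>
         \<zeta> \<in> proximal_normal_cone (reachable F G \<tau>) x1 \<longrightarrow>
         \<zeta> \<bullet> (x2 - x1) \<le> - \<gamma> * norm \<zeta> * (norm (x2 - x1))\<^sup>2) \<and>
      (\<forall>xbar. xbar \<noteq> 0 \<and> min_time F G xbar < ereal \<T> \<longrightarrow> optimal_point F G xbar)"
proof -
  have "\<forall>i. \<exists>c>0. \<forall>l. c * norm l \<le> \<bar>l \<bullet> column i B\<bar> + \<bar>l \<bullet> (A *v column i B)\<bar>"
    using assms(2) rank_2_coercive by blast
  then obtain c' where c': "\<And>i. 0 < c' i" "\<And>i l. c' i * norm l \<le> \<bar>l \<bullet> column i B\<bar> + \<bar>l \<bullet> (A *v column i B)\<bar>"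
    by metis
  define c where "c = Min (range c')"
  have c: "0 < c" unfolding c_def using c'(1) by simp
  have cl: "c * norm l \<le> \<bar>l \<bullet> column i B\<bar> + \<bar>l \<bullet> (A *v column i B)\<bar>" for i l
  proof -
    have "c * norm l \<le> c' i * norm l" unfolding c_def by (intro mult_right_mono Min_le) auto
    then show ?thesis using c'(2)[where i=i and l=l] by linarith
  qed
  \<comment> \<open>The absolute value is taken because \<open>L\<close> is known to be nonnegative
    only once a function with this constant is given.\<close>
  define K where "K = 1 + 3 * \<bar>L\<bar> + onorm ((*v) A) + norm B"
  have on: "0 \<le> onorm ((*v) A)" by (rule onorm_pos_le[OF matrix_vector_mul_bounded_linear])
  have K: "1 \<le> K" "3 * L \<le> K" "onorm ((*v) A) \<le> K" "norm (column i B) \<le> K" for i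
    unfolding K_def using on abs_ge_self[of L] abs_ge_zero[of L] norm_ge_zero[of B] norm_column_le[of i B]
    by linarith+
  define m where "m = real CARD('m)"
  define k where "k = K * (1 + m)"
  have m: "0 < m" unfolding m_def by simp
  have k: "0 < k" unfolding k_def using K(1) m by simp
  define T where "T = min 1 (min (1 / (16 * k)) (c / (100000 * k ^ 4)))"
  have T: "0 < T" "T \<le> 1" unfolding T_def using k c by auto
  have "T \<le> 1 / (16 * k)" "T \<le> c / (100000 * k ^ 4)" unfolding T_def by auto
  then have small: "16 * k * T \<le> 1" "100000 * k ^ 4 * T \<le> c"
    using k by (auto simp: pos_le_divide_eq mult_ac)
  \<comment> \<open>The constant of \<open>proximal_normal_strict\<close> written out, since it has
    to be chosen before \<open>F\<close> and \<open>G\<close>, hence before the locale is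
    available.\<close>
  define g where "g = c / (512 * m) / (16 * k\<^sup>2)"
  have g: "0 < g" unfolding g_def using c m k by simp
  show ?thesis
  proof (rule exI[of _ T], rule conjI[OF T(1)], rule exI[of _ g], rule conjI[OF g],
      intro allI impI conjI; elim conjE)
    fix F :: "real ^ 2 \<Rightarrow> real ^ 2" and G :: "real ^ 2 \<Rightarrow> real ^ 'm ^ 2"
    assume F: "C11_with L F" "C11_with L G" "F 0 = 0" "(F has_derivative (\<lambda>v. A *v v)) (at 0)"
      and G: "G 0 = B" "(G has_derivative (\<lambda>v. 0)) (at 0)"
    have "control_system F (total_deriv F) (\<lambda>i x. column i (G x)) (\<lambda>i x v. column i (total_deriv G x v)) K c T k m"
      by (rule control_system_C11[OF F(1,3,4,2) G(2) K(1-3) _ c _ T m_def k_def small])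
        (use K(4) cl in \<open>auto simp: G(1)\<close>)
    then interpret S: control_system_cart F "total_deriv F" "\<lambda>i x. column i (G x)"
        "\<lambda>i x v. column i (total_deriv G x v)" K c T k m
      by (rule control_system_cart.intro)
    have Sf: "S.f x u = F x + G x *v u" for x u
      unfolding S.f_def by (simp add: matrix_mult_sum scalar_mult_eq_scaleR)
    {
      fix \<tau> x1 x2 \<zeta>
      assume \<tau>: "0 < \<tau>" "\<tau> < T" and x: "x1 \<in> frontier (reachable F G \<tau>)" "x2 \<in> reachable F G \<tau>"
        and \<zeta>: "\<zeta> \<in> proximal_normal_cone (reachable F G \<tau>) x1"
      have \<tau>T: "\<tau> \<in> {0..T}" using \<tau> by simp
      note R = S.reachable_eq_R[OF Sf \<tau>T]
      obtain C where C: "0 \<le> C" "\<And>y. y \<in> S.R \<tau> \<Longrightarrow> \<zeta> \<bullet> (y - x1) \<le> C * (norm (y - x1))\<^sup>2"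
        using \<zeta> unfolding proximal_normal_cone_def R by blast
      have "x1 \<in> closure (S.R \<tau>)" using x(1) unfolding R frontier_def by blast
      from S.proximal_normal_strict[OF \<tau>T this _ C] x(2)
      show "\<zeta> \<bullet> (x2 - x1) \<le> - g * norm \<zeta> * (norm (x2 - x1))\<^sup>2"
        unfolding R g_def S.\<gamma>_def by simp
    next
      fix xbar assume x: "xbar \<noteq> 0" "min_time F G xbar < ereal T"
      \<comment> \<open>The second claim concerns motion towards the origin and uses the reversed
        instance; the first used the direct one. Both share the same constants.\<close>
      interpret B: control_system_cart "\<lambda>x. - F x" "\<lambda>x v. - total_deriv F x v" "\<lambda>i x. - column i (G x)"
        "\<lambda>i x v. - column i (total_deriv G x v)" K c T k m
        by (rule control_system_cart.intro[OF S.control_system_uminus])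
      have "- B.f x u = F x + G x *v u" for x u
        unfolding B.f_def by (simp add: matrix_mult_sum scalar_mult_eq_scaleR sum_negf)
      from B.optimal_point_if_reversed[OF this x] show "optimal_point F G xbar" .
    }
  qed
qed

end
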